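(* Let $(\mathcal S,\mathcal D,E,B)$ satisfy assumptions (i)–(iv) of the context and let $\Lambda=E(\mathcal S)$. For $\gamma\in\mathrm{Lip}([0,1];(\mathcal S,d_{\mathcal S}))$ let $$\mathrm{energy}_{\mathcal S}(\gamma):=\int_0^1\|B_{\gamma(t)}\dot\gamma(t)\|^2_{L^2(E(\gamma(t)))}\,dt.$$ Then $$\mathrm{energy}(E\circ\gamma)=\mathrm{energy}_{\mathcal S}(\gamma)\quad\text{for all }\gamma\in\mathrm{Lip}([0,1];(\mathcal S,d_{\mathcal S})),$$ $$\mathrm{energy}(\rho)=\mathrm{energy}_{\mathcal S}(E^{-1}\circ\rho)\quad\text{for all }\rho\in\mathrm{Lip}([0,1];(\Lambda,\mathrm W)).$$ In particular, for a curve $\gamma\in\mathrm{Lip}([0,1];(\mathcal S,d_{\mathcal S}))$, the velocity field $t\mapsto v(t)=B_{\gamma(t)}\dot\gamma(t)$ satisfies $\mathrm{energy}(E\circ\gamma)=\int_0^1\|v(t)\|^2_{L^2(E(\gamma(t)))}\,dt$.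
   Context: $\Omega\subset\mathbb R^d$ is compact and convex, $\mathcal P(\Omega)$ is the set of probability measures on $\Omega$, $\mathrm W$ is the Wasserstein-2 distance, $\mathrm W(\mu,\nu)^2=\inf_{\pi}\int|x-y|^2\,d\pi$ over couplings $\pi$ of $\mu,\nu$. $L^2(\mu)$ means $L^2(\mu;\mathbb R^d)$. $\|\cdot\|_{C^1(\mathbb R^d)}$ is the supremum norm of the function and its first derivatives. $\#$ denotes push-forward. $\mathrm{Lip}(X;Y)$ is the set of Lipschitz maps. Assumptions. (i) $\mathcal S$ is a compact, connected, finite-dimensional smooth Riemannian manifold with tangent norms $\|\eta\|_\theta$ ($\eta\in T_\theta\mathcal S$) and induced distance $d_{\mathcal S}$. $\mathcal D\subset T\mathcal S$ is a subset on which the Riemannian exponential map is well defined, such that $(\theta,\eta)\in\mathcal D$ implies $(\theta,t\eta)\in\mathcal D$ for $t\in[0,1]$; for every $(\theta,\eta)\in\mathcal D$ the curve $\gamma(t)=\exp_\theta(t\eta)$, $t\in[0,1]$, is a constant speed geodesic from $\theta$ to $\exp_\theta(\eta)$ with $\|\dot\gamma(t)\|_{\gamma(t)}=\|\eta\|_\theta=d_{\mathcal S}(\theta,\exp_\theta(\eta))$ for $t\in[0,1]$; and, with $\mathcal D_\theta=\{\eta:(\theta,\eta)\in\mathcal D\}$, for any $\theta_0,\theta_1\in\mathcal S$ there is $\eta\in\mathcal D_{\theta_0}$ with $\theta_1=\exp_{\theta_0}(\eta)$. ($\mathcal S$ may have a boundary as long as it is a geodesically convex subset of a larger, not necessarily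 compact, such manifold and the construction of geodesics via $\mathcal D$ remains valid.) (ii) $E:\mathcal S\to\mathcal P(\Omega)$ is a bi-Lipschitz bijection from $(\mathcal S,d_{\mathcal S})$ onto $\Lambda:=E(\mathcal S)$ with metric $\mathrm W$; write $\lambda_\theta=E(\theta)$. All $\lambda\in\Lambda$ are absolutely continuous with respect to Lebesgue measure. (iii) For each $\theta\in\mathcal S$, $B_\theta:T_\theta\mathcal S\to C^1(\mathbb R^d;\mathbb R^d)$ is linear with values in gradient vector fields, and there is $C_0\in(0,\infty)$ such that for all $(\theta,\eta)\in\mathcal D$, $x\in\mathbb R^d$, $t\in[0,1]$, with $\gamma(t)=\exp_\theta(t\eta)$: $C_0^{-1}\|\eta\|_\theta\le\|B_\theta\eta\|_{L^2(\lambda_\theta)}\le C_0\|\eta\|_\theta$; $\|B_\theta\eta\|_{C^1(\mathbb R^d)}\le C_0\|\eta\|_\theta$; $|\partial_t[B_{\gamma(t)}\dot\gamma(t)](x)|\le C_0\|\eta\|_\theta^2$. (iv) For every Lipschitz curve $\gamma:[0,1]\to\mathcal S$, let $v(t,\cdot)=B_{\gamma(t)}\dot\gamma(t)$ (defined for a.e. $t$) and let $\varphi:[0,1]\times\Omega\to\mathbb R^d$ be the solution of $\varphi(0,\cdot)=\mathrm{id}$, $\partial_t\varphi(t,\cdot)=v(t,\varphi(t,\cdot))$ for a.e. $t$; then $\lambda_{\gamma(t)}=\varphi(t,\cdot)_\#\lambda_{\gamma(0)}$ for all $t\in[0,1]$. Energy. For a Lipschitz curve $\rho:[0,1]\to(\mathcal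 P(\Omega),\mathrm W)$, $\mathrm{CE}(\rho)$ is the set of measurable $v$ with $v(t)\in L^2(\rho(t))$ such that for all $\phi\in C^1([0,1]\times\Omega)$: $\int_0^1\int_\Omega\partial_t\phi(t,\cdot)\,d\rho(t)\,dt+\int_0^1\int_\Omega\langle\nabla\phi(t,\cdot),v(t)\rangle\,d\rho(t)\,dt=\int_\Omega\phi(1,\cdot)\,d\rho(1)-\int_\Omega\phi(0,\cdot)\,d\rho(0)$. Set $\mathrm{energy}(\rho)=\inf\{\int_0^1\|v(t)\|_{L^2(\rho(t))}^2dt: v\in\mathrm{CE}(\rho)\}$. *)

theory Defs
  imports "HOL-Analysis.Analysis" "HOL-Probability.Probability_Measure"
begin

section \<open>Smooth manifolds\<close>

fun Ck_on :: "nat \<Rightarrow> 'a::euclidean_space set \<Rightarrow> ('a \<Rightarrow> 'b::euclidean_space) \<Rightarrow> bool" where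
  "Ck_on 0 U f = continuous_on U f"
| "Ck_on (Suc k) U f = ((\<forall>x\<in>U. f differentiable (at x)) \<and>
     (\<forall>h. Ck_on k U (\<lambda>x. frechet_derivative f (at x) h)))"

definition smooth_on :: "'a::euclidean_space set \<Rightarrow> ('a \<Rightarrow> 'b::euclidean_space) \<Rightarrow> bool" where
  "smooth_on U f \<longleftrightarrow> (\<forall>k. Ck_on k U f)"

text \<open>A chart is a domain together with a coordinate map, the values of which outside the
  domain are irrelevant. A manifold is a type with a Hausdorff and second countable topology
  and an atlas; its dimension is that of the model space \<open>'e\<close>.\<close>

type_synonym ('m, 'e) chart = "'m set \<times> ('m \<Rightarrow> 'e)"

abbreviation dom_chart :: "('m, 'e) chart \<Rightarrow> 'm set" where
  "dom_chart c \<equiv> fst c"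

abbreviation crd :: "('m, 'e) chart \<Rightarrow> 'm \<Rightarrow> 'e" where
  "crd c \<equiv> snd c"

abbreviation inv_crd :: "('m, 'e) chart \<Rightarrow> 'e \<Rightarrow> 'm" where
  "inv_crd c \<equiv> inv_into (dom_chart c) (crd c)"

definition is_chart :: "('m::topological_space, 'e::euclidean_space) chart \<Rightarrow> bool" where
  "is_chart c \<longleftrightarrow> open (dom_chart c) \<and> open (crd c ` dom_chart c) \<and>
     homeomorphism (dom_chart c) (crd c ` dom_chart c) (crd c) (inv_crd c)"

definition smooth_atlas :: "('m::topological_space, 'e::euclidean_space) chart set \<Rightarrow> bool" where
  "smooth_atlas A \<longleftrightarrow> (\<forall>c\<in>A. is_chart c) \<and> (\<Union>c\<in>A. dom_chart c) = UNIV \<and>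
     (\<forall>c\<in>A. \<forall>c'\<in>A. smooth_on (crd c ` (dom_chart c \<inter> dom_chart c')) (crd c' \<circ> inv_crd c))"

text \<open>A tangent vector at \<open>p\<close> is the family of its coordinate vectors in all charts around \<open>p\<close>,
  related by the contravariant transformation law. The entries for all other charts are zero, so
  that tangent vectors are determined by their components; the vector space operations are
  pointwise.\<close>

type_synonym ('m, 'e) tvec = "('m, 'e) chart \<Rightarrow> 'e"

definition tangent_space :: "('m, 'e::euclidean_space) chart set \<Rightarrow> 'm \<Rightarrow> ('m, 'e) tvec set" where
  "tangent_space A p = {\<xi>.
     (\<forall>c. \<not> (c \<in> A \<and> p \<in> dom_chart c) \<longrightarrow> \<xi> c = 0) \<and>
     (\<forall>c\<in>A. \<forall>c'\<in>A. p \<in> dom_chart c \<inter> dom_chart c' \<longrightarrow>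
        \<xi> c' = frechet_derivative (crd c' \<circ> inv_crd c) (at (crd c p)) (\<xi> c))}"

abbreviation tscale :: "real \<Rightarrow> ('m, 'e::euclidean_space) tvec \<Rightarrow> ('m, 'e) tvec" where
  "tscale a \<xi> \<equiv> (\<lambda>c. a *\<^sub>R \<xi> c)"

abbreviation tadd :: "('m, 'e::euclidean_space) tvec \<Rightarrow> ('m, 'e) tvec \<Rightarrow> ('m, 'e) tvec" where
  "tadd \<xi> \<zeta> \<equiv> (\<lambda>c. \<xi> c + \<zeta> c)"

text \<open>The tangent vector at \<open>p\<close> whose coordinate vector in the chart \<open>c\<close> is \<open>w\<close>.\<close>

definition coord_vec ::
    "('m, 'e::euclidean_space) chart set \<Rightarrow> ('m, 'e) chart \<Rightarrow> 'm \<Rightarrow> 'e \<Rightarrow> ('m, 'e) tvec" where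
  "coord_vec A c p w = (\<lambda>c'. if c' \<in> A \<and> p \<in> dom_chart c'
     then frechet_derivative (crd c' \<circ> inv_crd c) (at (crd c p)) w else 0)"

section \<open>Riemannian metrics, lengths and geodesics\<close>

type_synonym ('m, 'e) metric_tensor = "'m \<Rightarrow> ('m, 'e) tvec \<Rightarrow> ('m, 'e) tvec \<Rightarrow> real"

definition local_metric :: "('m, 'e::euclidean_space) chart set \<Rightarrow> ('m, 'e) metric_tensor \<Rightarrow>
    ('m, 'e) chart \<Rightarrow> 'e \<Rightarrow> 'e \<Rightarrow> 'e \<Rightarrow> real" where
  "local_metric A g c x v w =
     g (inv_crd c x) (coord_vec A c (inv_crd c x) v) (coord_vec A c (inv_crd c x) w)"

locale riemannian_manifold =
  fixes A :: "('m::{t2_space, second_countable_topology}, 'e::euclidean_space) chart set"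
    and g :: "('m, 'e) metric_tensor"
  assumes atlas: "smooth_atlas A"
    and metric_sym: "\<lbrakk>\<xi> \<in> tangent_space A p; \<zeta> \<in> tangent_space A p\<rbrakk> \<Longrightarrow> g p \<xi> \<zeta> = g p \<zeta> \<xi>"
    and metric_linear:
      "\<lbrakk>\<xi> \<in> tangent_space A p; \<xi>' \<in> tangent_space A p; \<zeta> \<in> tangent_space A p\<rbrakk> \<Longrightarrow>
        g p (tadd (tscale a \<xi>) \<xi>') \<zeta> = a * g p \<xi> \<zeta> + g p \<xi>' \<zeta>"
    and metric_pos: "\<lbrakk>\<xi> \<in> tangent_space A p; \<xi> \<noteq> (\<lambda>_. 0)\<rbrakk> \<Longrightarrow> 0 < g p \<xi> \<xi>"
    and metric_smooth:
      "c \<in> A \<Longrightarrow> smooth_on (crd c ` dom_chart c) (\<lambda>x. local_metric A g c x v w)"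

definition tnorm :: "('m, 'e) metric_tensor \<Rightarrow> 'm \<Rightarrow> ('m, 'e) tvec \<Rightarrow> real" where
  "tnorm g p \<xi> = sqrt (g p \<xi> \<xi>)"

text \<open>All curves are parametrized by \<open>{0..1}\<close>; their values elsewhere play no role, and velocities
  at the two end points are one-sided.\<close>

definition has_velocity :: "('m::t2_space, 'e::euclidean_space) chart set \<Rightarrow> (real \<Rightarrow> 'm) \<Rightarrow>
    ('m, 'e) tvec \<Rightarrow> real \<Rightarrow> bool" where
  "has_velocity A \<gamma> \<xi> t \<longleftrightarrow> \<xi> \<in> tangent_space A (\<gamma> t) \<and> continuous (at t within {0..1}) \<gamma> \<and>
     (\<forall>c\<in>A. \<gamma> t \<in> dom_chart c \<longrightarrow>
        ((\<lambda>s. crd c (\<gamma> s)) has_vector_derivative \<xi> c) (at t within {0..1}))"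

text \<open>At the times at which a curve is not differentiable (a null set for Lipschitz curves), the
  velocity is set to zero.\<close>

definition velocity :: "('m::t2_space, 'e::euclidean_space) chart set \<Rightarrow> (real \<Rightarrow> 'm) \<Rightarrow>
    real \<Rightarrow> ('m, 'e) tvec" where
  "velocity A \<gamma> t =
     (if \<exists>\<xi>. has_velocity A \<gamma> \<xi> t then THE \<xi>. has_velocity A \<gamma> \<xi> t else (\<lambda>_. 0))"

definition piecewise_C1_curve :: "('m::t2_space, 'e::euclidean_space) chart set \<Rightarrow> 'm set \<Rightarrow>
    (real \<Rightarrow> 'm) \<Rightarrow> bool" where
  "piecewise_C1_curve A S \<gamma> \<longleftrightarrow> continuous_on {0..1} \<gamma> \<and> \<gamma> ` {0..1} \<subseteq> S \<and>
     (\<exists>K. finite K \<and> (\<forall>t\<in>{0..1} - K. (\<exists>\<xi>. has_velocity A \<gamma> \<xi> t) \<and>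
        (\<forall>c\<in>A. \<gamma> t \<in> dom_chart c \<longrightarrow> continuous (at t within {0..1}) (\<lambda>s. velocity A \<gamma> s c))))"

definition curve_length :: "('m::t2_space, 'e::euclidean_space) chart set \<Rightarrow>
    ('m, 'e) metric_tensor \<Rightarrow> (real \<Rightarrow> 'm) \<Rightarrow> ennreal" where
  "curve_length A g \<gamma> = (\<integral>\<^sup>+t\<in>{0..1}. ennreal (tnorm g (\<gamma> t) (velocity A \<gamma> t)) \<partial>lebesgue)"

text \<open>The distance on \<open>S\<close> induced by the metric: only curves inside \<open>S\<close> compete.\<close>

definition riem_dist :: "('m::t2_space, 'e::euclidean_space) chart set \<Rightarrow>
    ('m, 'e) metric_tensor \<Rightarrow> 'm set \<Rightarrow> 'm \<Rightarrow> 'm \<Rightarrow> real" where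
  "riem_dist A g S p q =
     enn2real (INF \<gamma>\<in>{\<gamma>. piecewise_C1_curve A S \<gamma> \<and> \<gamma> 0 = p \<and> \<gamma> 1 = q}. curve_length A g \<gamma>)"

text \<open>The Christoffel symbols of the first kind (all indices lowered) at the point with
  coordinates \<open>x\<close>, contracted with \<open>a\<close>, \<open>b\<close>, \<open>w\<close>.\<close>

definition christoffel :: "('m, 'e::euclidean_space) chart set \<Rightarrow> ('m, 'e) metric_tensor \<Rightarrow>
    ('m, 'e) chart \<Rightarrow> 'e \<Rightarrow> 'e \<Rightarrow> 'e \<Rightarrow> 'e \<Rightarrow> real" where
  "christoffel A g c x a b w =
     (frechet_derivative (\<lambda>y. local_metric A g c y b w) (at x) a
      + frechet_derivative (\<lambda>y. local_metric A g c y a w) (at x) b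
      - frechet_derivative (\<lambda>y. local_metric A g c y a b) (at x) w) / 2"

text \<open>The geodesic equation: the covariant derivative of the velocity vanishes, tested in
  coordinates against an arbitrary vector \<open>w\<close>.\<close>

definition geodesic :: "('m::t2_space, 'e::euclidean_space) chart set \<Rightarrow>
    ('m, 'e) metric_tensor \<Rightarrow> (real \<Rightarrow> 'm) \<Rightarrow> bool" where
  "geodesic A g \<gamma> \<longleftrightarrow> continuous_on {0..1} \<gamma> \<and>
     (\<forall>c\<in>A. \<exists>u' u''. \<forall>t\<in>{0..1}. \<gamma> t \<in> dom_chart c \<longrightarrow>
        ((\<lambda>s. crd c (\<gamma> s)) has_vector_derivative u' t) (at t within {0..1}) \<and>
        (u' has_vector_derivative u'' t) (at t within {0..1}) \<and>
        (\<forall>w. local_metric A g c (crd c (\<gamma> t)) (u'' t) w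
              + christoffel A g c (crd c (\<gamma> t)) (u' t) (u' t) w = 0))"

definition geodesic_from :: "('m::t2_space, 'e::euclidean_space) chart set \<Rightarrow>
    ('m, 'e) metric_tensor \<Rightarrow> 'm \<Rightarrow> ('m, 'e) tvec \<Rightarrow> (real \<Rightarrow> 'm) \<Rightarrow> bool" where
  "geodesic_from A g \<theta> \<eta> \<gamma> \<longleftrightarrow> geodesic A g \<gamma> \<and> \<gamma> 0 = \<theta> \<and> has_velocity A \<gamma> \<eta> 0"

definition riem_exp :: "('m::t2_space, 'e::euclidean_space) chart set \<Rightarrow>
    ('m, 'e) metric_tensor \<Rightarrow> 'm \<Rightarrow> ('m, 'e) tvec \<Rightarrow> 'm" where
  "riem_exp A g \<theta> \<eta> = (THE q. \<exists>\<gamma>. geodesic_from A g \<theta> \<eta> \<gamma> \<and> \<gamma> 1 = q)"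

definition geodesically_convex :: "('m::t2_space, 'e::euclidean_space) chart set \<Rightarrow>
    ('m, 'e) metric_tensor \<Rightarrow> 'm set \<Rightarrow> bool" where
  "geodesically_convex A g S \<longleftrightarrow>
     (\<forall>p\<in>S. \<forall>q\<in>S. \<exists>\<gamma>. geodesic A g \<gamma> \<and> \<gamma> 0 = p \<and> \<gamma> 1 = q \<and> \<gamma> ` {0..1} \<subseteq> S \<and>
        (\<forall>\<sigma>. piecewise_C1_curve A UNIV \<sigma> \<and> \<sigma> 0 = p \<and> \<sigma> 1 = q \<longrightarrow>
              curve_length A g \<gamma> \<le> curve_length A g \<sigma>))"

definition lipschitz_curve :: "'x set \<Rightarrow> ('x \<Rightarrow> 'x \<Rightarrow> real) \<Rightarrow> (real \<Rightarrow> 'x) \<Rightarrow> bool" where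
  "lipschitz_curve X d \<gamma> \<longleftrightarrow> \<gamma> ` {0..1} \<subseteq> X \<and>
     (\<exists>L. \<forall>s\<in>{0..1}. \<forall>t\<in>{0..1}. d (\<gamma> s) (\<gamma> t) \<le> L * \<bar>s - t\<bar>)"

section \<open>Wasserstein distance and energy\<close>

text \<open>Probability measures on \<open>\<Omega>\<close> are Borel measures on the ambient space concentrated
  on \<open>\<Omega>\<close>.\<close>

definition prob_measures :: "'a::euclidean_space set \<Rightarrow> 'a measure set" where
  "prob_measures \<Omega> = {\<mu>. sets \<mu> = sets borel \<and> prob_space \<mu> \<and> emeasure \<mu> (- \<Omega>) = 0}"

definition couplings :: "'a::euclidean_space measure \<Rightarrow> 'a measure \<Rightarrow> ('a \<times> 'a) measure set" where
  "couplings \<mu> \<nu> = {\<pi>. sets \<pi> = sets (borel \<Otimes>\<^sub>M borel) \<and> prob_space \<pi> \<and>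
     distr \<pi> borel fst = \<mu> \<and> distr \<pi> borel snd = \<nu>}"

definition wasserstein :: "'a::euclidean_space measure \<Rightarrow> 'a measure \<Rightarrow> real" where
  "wasserstein \<mu> \<nu> = sqrt (enn2real
     (INF \<pi>\<in>couplings \<mu> \<nu>. \<integral>\<^sup>+z. ennreal ((norm (fst z - snd z))\<^sup>2) \<partial>\<pi>))"

definition L2_normsq ::
    "'a::euclidean_space set \<Rightarrow> 'a measure \<Rightarrow> ('a \<Rightarrow> 'a) \<Rightarrow> ennreal" where
  "L2_normsq \<Omega> \<mu> f = (\<integral>\<^sup>+x\<in>\<Omega>. ennreal ((norm (f x))\<^sup>2) \<partial>\<mu>)"

definition L2_norm :: "'a::euclidean_space set \<Rightarrow> 'a measure \<Rightarrow> ('a \<Rightarrow> 'a) \<Rightarrow> real" where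
  "L2_norm \<Omega> \<mu> f = sqrt (enn2real (L2_normsq \<Omega> \<mu> f))"

definition C1_norm :: "('a::euclidean_space \<Rightarrow> 'a) \<Rightarrow> ennreal" where
  "C1_norm f = (SUP x. ennreal (max (norm (f x)) (onorm (frechet_derivative f (at x)))))"

definition gradient_field :: "('a::euclidean_space \<Rightarrow> 'a) \<Rightarrow> bool" where
  "gradient_field f \<longleftrightarrow> (\<exists>\<psi>. \<forall>x. (\<psi> has_derivative (\<lambda>h. f x \<bullet> h)) (at x))"

text \<open>Functions of class \<open>C\<^sup>1\<close> on \<open>{0..1} \<times> \<Omega>\<close>, together with their time derivative and their
  spatial gradient. Derivatives are taken within the domain, i.e. up to the boundary.\<close>

definition C1_test :: "'a::euclidean_space set \<Rightarrow> (real \<Rightarrow> 'a \<Rightarrow> real) \<Rightarrow>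
    (real \<Rightarrow> 'a \<Rightarrow> real) \<Rightarrow> (real \<Rightarrow> 'a \<Rightarrow> 'a) \<Rightarrow> bool" where
  "C1_test \<Omega> \<phi> \<phi>\<^sub>t \<phi>\<^sub>x \<longleftrightarrow>
     continuous_on ({0..1} \<times> \<Omega>) (\<lambda>(t, x). \<phi>\<^sub>t t x) \<and>
     continuous_on ({0..1} \<times> \<Omega>) (\<lambda>(t, x). \<phi>\<^sub>x t x) \<and>
     (\<forall>t\<in>{0..1}. \<forall>x\<in>\<Omega>. ((\<lambda>(s, y). \<phi> s y) has_derivative (\<lambda>(r, h). r * \<phi>\<^sub>t t x + \<phi>\<^sub>x t x \<bullet> h))
        (at (t, x) within {0..1} \<times> \<Omega>))"

text \<open>The integrability clause only makes explicit that the second integral of the continuity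
  equation has to exist, since Bochner integrals of non-integrable functions are zero by
  convention.\<close>

definition CE :: "'a::euclidean_space set \<Rightarrow> (real \<Rightarrow> 'a measure) \<Rightarrow> (real \<Rightarrow> 'a \<Rightarrow> 'a) set" where
  "CE \<Omega> \<rho> = {v.
     (\<lambda>(t, x). v t x) \<in> borel_measurable (restrict_space borel ({0..1} \<times> \<Omega>)) \<and>
     (\<forall>t\<in>{0..1}. L2_normsq \<Omega> (\<rho> t) (v t) < \<infinity>) \<and>
     (\<forall>\<phi> \<phi>\<^sub>t \<phi>\<^sub>x. C1_test \<Omega> \<phi> \<phi>\<^sub>t \<phi>\<^sub>x \<longrightarrow>
        set_integrable lebesgue {0..1} (\<lambda>t. LINT x:\<Omega>|\<rho> t. \<phi>\<^sub>x t x \<bullet> v t x) \<and>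
        (LINT t:{0..1}|lebesgue. LINT x:\<Omega>|\<rho> t. \<phi>\<^sub>t t x)
          + (LINT t:{0..1}|lebesgue. LINT x:\<Omega>|\<rho> t. \<phi>\<^sub>x t x \<bullet> v t x)
        = (LINT x:\<Omega>|\<rho> 1. \<phi> 1 x) - (LINT x:\<Omega>|\<rho> 0. \<phi> 0 x))}"

definition energy :: "'a::euclidean_space set \<Rightarrow> (real \<Rightarrow> 'a measure) \<Rightarrow> ennreal" where
  "energy \<Omega> \<rho> = (INF v\<in>CE \<Omega> \<rho>. \<integral>\<^sup>+t\<in>{0..1}. L2_normsq \<Omega> (\<rho> t) (v t) \<partial>lebesgue)"

definition energy_S :: "'a::euclidean_space set \<Rightarrow> ('m::t2_space, 'e::euclidean_space) chart set \<Rightarrow>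
    ('m \<Rightarrow> 'a measure) \<Rightarrow> ('m \<Rightarrow> ('m, 'e) tvec \<Rightarrow> 'a \<Rightarrow> 'a) \<Rightarrow> (real \<Rightarrow> 'm) \<Rightarrow> ennreal" where
  "energy_S \<Omega> A E B \<gamma> =
     (\<integral>\<^sup>+t\<in>{0..1}. L2_normsq \<Omega> (E (\<gamma> t)) (B (\<gamma> t) (velocity A \<gamma> t)) \<partial>lebesgue)"

text \<open>Solutions of the flow equation in the sense of Caratheodory. For the bounded velocity fields
  used below, absolute continuity in time is the same as Lipschitz continuity.\<close>

definition flow_of :: "'a::euclidean_space set \<Rightarrow> (real \<Rightarrow> 'a \<Rightarrow> 'a) \<Rightarrow>
    (real \<Rightarrow> 'a \<Rightarrow> 'a) \<Rightarrow> bool" where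
  "flow_of \<Omega> v \<phi> \<longleftrightarrow>
     (\<forall>x\<in>\<Omega>. \<phi> 0 x = x) \<and>
     (\<forall>x\<in>\<Omega>. \<exists>L. L-lipschitz_on {0..1} (\<lambda>t. \<phi> t x)) \<and>
     (AE t in lebesgue. t \<in> {0..1} \<longrightarrow> (\<forall>x\<in>\<Omega>.
        ((\<lambda>s. \<phi> s x) has_vector_derivative v t (\<phi> t x)) (at t within {0..1})))"

section \<open>The parametrized submanifold of the Wasserstein space\<close>

text \<open>The parameter manifold \<open>S\<close> is either the whole manifold (the case without boundary) or a
  geodesically convex subset of a larger one, from which it inherits its tangent spaces. The two
  assumptions \<open>flow_exists\<close> and \<open>flow_transport\<close> together express that the flow is well-defined
  and transports the measures along every Lipschitz curve.\<close>

locale wasserstein_submanifold = riemannian_manifold A g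
  for A :: "('m::{t2_space, second_countable_topology}, 'e::euclidean_space) chart set"
    and g :: "('m, 'e) metric_tensor" +
  fixes \<Omega> :: "'a::euclidean_space set"
    and S :: "'m set"
    and D :: "('m \<times> ('m, 'e) tvec) set"
    and E :: "'m \<Rightarrow> 'a measure"
    and B :: "'m \<Rightarrow> ('m, 'e) tvec \<Rightarrow> 'a \<Rightarrow> 'a"
  assumes compact_Omega: "compact \<Omega>"
    and convex_Omega: "convex \<Omega>"
    and compact_S: "compact S"
    and connected_S: "connected S"
    and S_cases: "S = UNIV \<or> geodesically_convex A g S"
    and D_subset: "(\<theta>, \<eta>) \<in> D \<Longrightarrow> \<theta> \<in> S \<and> \<eta> \<in> tangent_space A \<theta>"
    and D_star: "\<lbrakk>(\<theta>, \<eta>) \<in> D; t \<in> {0..1}\<rbrakk> \<Longrightarrow> (\<theta>, tscale t \<eta>) \<in> D"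
    and D_geodesic: "\<lbrakk>(\<theta>, \<eta>) \<in> D; \<gamma> = (\<lambda>t. riem_exp A g \<theta> (tscale t \<eta>))\<rbrakk> \<Longrightarrow>
      geodesic_from A g \<theta> \<eta> \<gamma> \<and> \<gamma> ` {0..1} \<subseteq> S \<and>
      (\<forall>t\<in>{0..1}. tnorm g (\<gamma> t) (velocity A \<gamma> t) = tnorm g \<theta> \<eta>) \<and>
      tnorm g \<theta> \<eta> = riem_dist A g S \<theta> (riem_exp A g \<theta> \<eta>)"
    and D_onto: "\<lbrakk>\<theta>\<^sub>0 \<in> S; \<theta>\<^sub>1 \<in> S\<rbrakk> \<Longrightarrow> \<exists>\<eta>. (\<theta>\<^sub>0, \<eta>) \<in> D \<and> \<theta>\<^sub>1 = riem_exp A g \<theta>\<^sub>0 \<eta>"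
    and E_prob: "\<theta> \<in> S \<Longrightarrow> E \<theta> \<in> prob_measures \<Omega>"
    and E_inj: "inj_on E S"
    and E_bilipschitz: "\<exists>L>0. \<forall>\<theta>\<in>S. \<forall>\<theta>'\<in>S.
      riem_dist A g S \<theta> \<theta>' / L \<le> wasserstein (E \<theta>) (E \<theta>') \<and>
      wasserstein (E \<theta>) (E \<theta>') \<le> L * riem_dist A g S \<theta> \<theta>'"
    and E_ac: "\<theta> \<in> S \<Longrightarrow> absolutely_continuous lborel (E \<theta>)"
    and B_linear: "\<lbrakk>\<theta> \<in> S; \<xi> \<in> tangent_space A \<theta>; \<zeta> \<in> tangent_space A \<theta>\<rbrakk> \<Longrightarrow>
      B \<theta> (tadd (tscale a \<xi>) \<zeta>) = (\<lambda>x. a *\<^sub>R B \<theta> \<xi> x + B \<theta> \<zeta> x)"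
    and B_C1: "\<lbrakk>\<theta> \<in> S; \<xi> \<in> tangent_space A \<theta>\<rbrakk> \<Longrightarrow> Ck_on 1 UNIV (B \<theta> \<xi>)"
    and B_gradient: "\<lbrakk>\<theta> \<in> S; \<xi> \<in> tangent_space A \<theta>\<rbrakk> \<Longrightarrow> gradient_field (B \<theta> \<xi>)"
    and B_bounds: "\<exists>C\<^sub>0>0. \<forall>(\<theta>, \<eta>)\<in>D.
      tnorm g \<theta> \<eta> / C\<^sub>0 \<le> L2_norm \<Omega> (E \<theta>) (B \<theta> \<eta>) \<and>
      L2_norm \<Omega> (E \<theta>) (B \<theta> \<eta>) \<le> C\<^sub>0 * tnorm g \<theta> \<eta> \<and>
      C1_norm (B \<theta> \<eta>) \<le> ennreal (C\<^sub>0 * tnorm g \<theta> \<eta>) \<and>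
      (let \<gamma> = (\<lambda>t. riem_exp A g \<theta> (tscale t \<eta>)) in
        \<forall>x. \<forall>t\<in>{0..1}. \<exists>w.
          ((\<lambda>s. B (\<gamma> s) (velocity A \<gamma> s) x) has_vector_derivative w) (at t within {0..1}) \<and>
          norm w \<le> C\<^sub>0 * (tnorm g \<theta> \<eta>)\<^sup>2)"
    and flow_exists: "lipschitz_curve S (riem_dist A g S) \<gamma> \<Longrightarrow>
      \<exists>\<phi>. flow_of \<Omega> (\<lambda>t. B (\<gamma> t) (velocity A \<gamma> t)) \<phi>"
    and flow_transport: "\<lbrakk>lipschitz_curve S (riem_dist A g S) \<gamma>;
        flow_of \<Omega> (\<lambda>t. B (\<gamma> t) (velocity A \<gamma> t)) \<phi>; t \<in> {0..1}\<rbrakk> \<Longrightarrow>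
      E (\<gamma> t) = distr (restrict_space (E (\<gamma> 0)) \<Omega>) borel (\<phi> t)"

end

theory Submission
  imports Defs
begin

text \<open>
  Let \<open>v t = B (\<gamma> t) (velocity A \<gamma> t)\<close>. Geodesics from \<open>\<gamma> t\<close> to nearby points of the curve have
  initial vectors in \<open>D\<close> whose quotients by the time increment converge to the velocity, hence \<open>v\<close> is
  uniformly bounded. Dominated convergence along the flow then shows that \<open>v\<close> satisfies the
  continuity equation, apart from joint measurability, which is recovered by averaging.

  Conversely, testing with functions \<open>a t * \<psi> x\<close>, where \<open>\<nabla>\<psi>\<close> runs through a countable
  uniformly dense set of gradients, shows that any other solution \<open>w\<close> satisfies
  \<open>\<integral>\<langle>\<nabla>\<psi>, w t - v t\<rangle> = 0\<close> for all gradients and almost every \<open>t\<close>. As \<open>v t\<close> is itself a gradient, it is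
  the orthogonal projection of \<open>w t\<close>, and so has the smaller norm.

  The case of a curve in the Wasserstein space follows since \<open>E\<close> is bi-Lipschitz.
\<close>

section \<open>Coordinates on a Riemannian manifold\<close>

text \<open>The bounds on \<open>B\<close> hold for vectors of \<open>D\<close> only, velocities of
  curves need not lie in \<open>D\<close>, and along an arbitrary Lipschitz curve nothing is known
  about the regularity of \<open>B\<close> in the base point. Hence the second-order estimate for
  geodesics in a chart: it compares vectors at the single base point \<open>\<gamma> t\<close>,
  where linearity of \<open>B\<close> suffices to pass to the limit. For the same reason
  \<open>v\<close> is not known to be measurable in time, and integrability in time of its integrals
  has to come from limits of difference quotients. Likewise \<open>flow_of\<close> is silent about
  measurability in space and about trajectories remaining in \<open>\<Omega>\<close>; both are drawn
  from the push-forward identity, whose left-hand side is a probability measure concentrated on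
  \<open>\<Omega>\<close>. Null sets are the last obstacle: the gradient \<open>v t\<close> to test
  with changes with \<open>t\<close>, so one exceptional set of times must serve all gradients at
  once, which is why a countable dense family is needed.\<close>

lemma linear_basis_expansion:
  fixes f :: "'e::euclidean_space \<Rightarrow> 'b::real_vector"
  assumes "linear f"
  shows "f v = (\<Sum>i\<in>Basis. (v \<bullet> i) *\<^sub>R f i)"
proof -
  have "f v = f (\<Sum>i\<in>Basis. (v \<bullet> i) *\<^sub>R i)" by (simp add: euclidean_representation)
  also have "\<dots> = (\<Sum>i\<in>Basis. (v \<bullet> i) *\<^sub>R f i)"
    using assms by (simp add: linear_sum linear_scale)
  finally show ?thesis .
qed

lemma vector_derivative_unique_Icc01:
  assumes "(f has_vector_derivative a) (at t within {0..1::real})"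
    and "(f has_vector_derivative b) (at t within {0..1})" and "t \<in> {0..1}"
  shows "a = b"
proof (rule vector_derivative_unique_within[OF _ assms(1,2)])
  show "at t within {0..1} \<noteq> bot"
    using assms(3) by (simp add: trivial_limit_within islimpt_Icc)
qed

context riemannian_manifold
begin

lemma chartD:
  assumes "c \<in> A"
  shows "open (dom_chart c)" "open (crd c ` dom_chart c)" "continuous_on (dom_chart c) (crd c)"
    "continuous_on (crd c ` dom_chart c) (inv_crd c)" "inj_on (crd c) (dom_chart c)"
    "p \<in> dom_chart c \<Longrightarrow> inv_crd c (crd c p) = p"
    "x \<in> crd c ` dom_chart c \<Longrightarrow> inv_crd c x \<in> dom_chart c"
    "x \<in> crd c ` dom_chart c \<Longrightarrow> crd c (inv_crd c x) = x"
proof -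
  have *: "is_chart c" using atlas assms by (auto simp: smooth_atlas_def)
  then have h: "homeomorphism (dom_chart c) (crd c ` dom_chart c) (crd c) (inv_crd c)"
    and o: "open (dom_chart c)" "open (crd c ` dom_chart c)" by (auto simp: is_chart_def)
  show "open (dom_chart c)" "open (crd c ` dom_chart c)" by (fact o)+
  show "continuous_on (dom_chart c) (crd c)" "continuous_on (crd c ` dom_chart c) (inv_crd c)"
    using h by (auto simp: homeomorphism_def)
  show "inj_on (crd c) (dom_chart c)"
    using h by (metis homeomorphism_def inj_on_inverseI)
  then show "p \<in> dom_chart c \<Longrightarrow> inv_crd c (crd c p) = p" by simp
  show "x \<in> crd c ` dom_chart c \<Longrightarrow> inv_crd c x \<in> dom_chart c" by (rule inv_into_into)
  show "x \<in> crd c ` dom_chart c \<Longrightarrow> crd c (inv_crd c x) = x" by (rule f_inv_into_f)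
qed

lemma chart_around: obtains c where "c \<in> A" "p \<in> dom_chart c"
  using atlas unfolding smooth_atlas_def by blast

lemma tangent_space_component_0:
  "\<xi> \<in> tangent_space A p \<Longrightarrow> \<not> (c \<in> A \<and> p \<in> dom_chart c) \<Longrightarrow> \<xi> c = 0"
  unfolding tangent_space_def by blast

lemma open_chart_overlap:
  assumes "c \<in> A" "c' \<in> A"
  shows "open (crd c ` (dom_chart c \<inter> dom_chart c'))"
proof -
  have "crd c ` (dom_chart c \<inter> dom_chart c') = crd c ` dom_chart c \<inter> inv_crd c -` dom_chart c'"
    using chartD(6,7,8)[OF assms(1)] by (auto simp: image_iff)
  then show ?thesis
    using continuous_open_preimage[OF chartD(4,2,1)] assms by metis
qed

lemma transition_has_derivative:
  assumes "c \<in> A" "c' \<in> A" "p \<in> dom_chart c" "p \<in> dom_chart c'"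
  shows "(crd c' \<circ> inv_crd c has_derivative frechet_derivative (crd c' \<circ> inv_crd c) (at (crd c p)))
    (at (crd c p))"
proof -
  have "smooth_on (crd c ` (dom_chart c \<inter> dom_chart c')) (crd c' \<circ> inv_crd c)"
    using atlas assms by (auto simp: smooth_atlas_def)
  then have "Ck_on (Suc 0) (crd c ` (dom_chart c \<inter> dom_chart c')) (crd c' \<circ> inv_crd c)"
    by (simp only: smooth_on_def)
  then have "(crd c' \<circ> inv_crd c) differentiable (at (crd c p))"
    using assms by auto
  then show ?thesis by (simp add: frechet_derivative_works)
qed

lemma transition_linear:
  assumes "c \<in> A" "c' \<in> A" "p \<in> dom_chart c" "p \<in> dom_chart c'"
  shows "linear (frechet_derivative (crd c' \<circ> inv_crd c) (at (crd c p)))"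
  using transition_has_derivative[OF assms] by (rule has_derivative_linear)

text \<open>This is the chain rule. The composite of two coordinate changes agrees with the third
  one only on the overlap of \<open>c\<close> and \<open>c'\<close>, whose coordinate image is open,
  and this is enough for derivatives.\<close>

lemma transition_cocycle:
  assumes "c \<in> A" "c' \<in> A" "c'' \<in> A" "p \<in> dom_chart c" "p \<in> dom_chart c'" "p \<in> dom_chart c''"
  shows "frechet_derivative (crd c'' \<circ> inv_crd c) (at (crd c p)) w =
    frechet_derivative (crd c'' \<circ> inv_crd c') (at (crd c' p))
      (frechet_derivative (crd c' \<circ> inv_crd c) (at (crd c p)) w)"
proof -
  let ?D = "\<lambda>c c'. frechet_derivative (crd c' \<circ> inv_crd c) (at (crd c p))"
  have e: "(crd c' \<circ> inv_crd c) (crd c p) = crd c' p" using chartD(6) assms by simp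
  have "((crd c'' \<circ> inv_crd c') \<circ> (crd c' \<circ> inv_crd c) has_derivative ?D c' c'' \<circ> ?D c c') (at (crd c p))"
    using assms by (intro diff_chain_at) (auto simp only: e intro!: transition_has_derivative)
  then have "(crd c'' \<circ> inv_crd c has_derivative ?D c' c'' \<circ> ?D c c') (at (crd c p))"
    by (rule has_derivative_transform_within_open[OF _ open_chart_overlap[OF assms(1,2)]])
      (use assms chartD(6) in auto)
  from frechet_derivative_at[OF this] show ?thesis by (metis comp_apply)
qed

lemma transition_self:
  assumes "c \<in> A" "p \<in> dom_chart c"
  shows "frechet_derivative (crd c \<circ> inv_crd c) (at (crd c p)) w = w"
proof -
  have "(crd c \<circ> inv_crd c has_derivative (\<lambda>h. h)) (at (crd c p))"
    by (rule has_derivative_transform_within_open[OF has_derivative_ident chartD(2)[OF assms(1)]])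
      (use assms chartD(8) in auto)
  from frechet_derivative_at[OF this] show ?thesis by metis
qed

lemma coord_vec_component [simp]:
  "c \<in> A \<Longrightarrow> p \<in> dom_chart c \<Longrightarrow> coord_vec A c p w c = w"
  by (simp add: coord_vec_def transition_self)

lemma coord_vec_in_tangent_space:
  assumes "c \<in> A" "p \<in> dom_chart c"
  shows "coord_vec A c p w \<in> tangent_space A p"
proof -
  have "coord_vec A c p w c'' =
      frechet_derivative (crd c'' \<circ> inv_crd c') (at (crd c' p)) (coord_vec A c p w c')"
    if "c' \<in> A" "c'' \<in> A" "p \<in> dom_chart c' \<inter> dom_chart c''" for c' c''
  proof -
    have "coord_vec A c p w c'' = frechet_derivative (crd c'' \<circ> inv_crd c) (at (crd c p)) w"
      "coord_vec A c p w c' = frechet_derivative (crd c' \<circ> inv_crd c) (at (crd c p)) w"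
      using that by (auto simp: coord_vec_def)
    then show ?thesis
      using transition_cocycle[OF assms(1) that(1,2) assms(2), of w] that(3) by (simp only: Int_iff)
  qed
  moreover have "coord_vec A c p w c' = 0" if "\<not> (c' \<in> A \<and> p \<in> dom_chart c')" for c'
    unfolding coord_vec_def using that by (rule if_not_P)
  ultimately show ?thesis unfolding tangent_space_def by blast
qed

text \<open>The transformation law determines all components from one, and the entries outside the
  charts around \<open>p\<close> are zero. Tangent vectors can thus be handled as vectors of the
  model space.\<close>

lemma coord_vec_eq:
  assumes "c \<in> A" "p \<in> dom_chart c" "\<xi> \<in> tangent_space A p"
  shows "coord_vec A c p (\<xi> c) = \<xi>"
proof
  fix c'
  show "coord_vec A c p (\<xi> c) c' = \<xi> c'"
  proof (cases "c' \<in> A \<and> p \<in> dom_chart c'")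
    case True
    then have "\<xi> c' = frechet_derivative (crd c' \<circ> inv_crd c) (at (crd c p)) (\<xi> c)"
      using assms unfolding tangent_space_def by blast
    moreover have "coord_vec A c p (\<xi> c) c' = frechet_derivative (crd c' \<circ> inv_crd c) (at (crd c p)) (\<xi> c)"
      unfolding coord_vec_def using True by (rule if_P)
    ultimately show ?thesis by (rule trans[OF _ sym, rotated])
  next
    case False
    then have "coord_vec A c p (\<xi> c) c' = 0" unfolding coord_vec_def by (rule if_not_P)
    with tangent_space_component_0[OF assms(3) False] show ?thesis by (rule trans[OF _ sym, rotated])
  qed
qed

lemma coord_vec_linear:
  assumes "c \<in> A" "p \<in> dom_chart c"
  shows "coord_vec A c p (a *\<^sub>R v + w) = tadd (tscale a (coord_vec A c p v)) (coord_vec A c p w)"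
proof
  fix c'
  show "coord_vec A c p (a *\<^sub>R v + w) c' = a *\<^sub>R coord_vec A c p v c' + coord_vec A c p w c'"
    using transition_linear[OF assms(1) _ assms(2), of c']
    by (simp add: coord_vec_def linear_add linear_scale)
qed

lemma zero_in_tangent_space: "(\<lambda>_. 0) \<in> tangent_space A p"
proof -
  have "linear (frechet_derivative (crd c' \<circ> inv_crd c) (at (crd c p)))"
    if "c \<in> A" "c' \<in> A" "p \<in> dom_chart c" "p \<in> dom_chart c'" for c c'
    using transition_linear that by auto
  then show ?thesis by (simp add: tangent_space_def linear_0)
qed

lemma tnorm_nonneg:
  assumes "\<xi> \<in> tangent_space A p"
  shows "0 \<le> g p \<xi> \<xi>" "0 \<le> tnorm g p \<xi>"
proof -
  have "g p (\<lambda>_. 0) (\<lambda>_. 0) = 0"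
    using metric_linear[OF zero_in_tangent_space zero_in_tangent_space zero_in_tangent_space, where a = 1]
    by simp
  then show "0 \<le> g p \<xi> \<xi>" using metric_pos[OF assms] by (cases "\<xi> = (\<lambda>_. 0)") auto
  then show "0 \<le> tnorm g p \<xi>" by (simp add: tnorm_def)
qed

text \<open>The convention that entries of irrelevant charts are zero turns agreement in the charts
  around the point into equality of functions.\<close>

lemma has_velocity_unique:
  assumes "has_velocity A \<gamma> \<xi> t" "has_velocity A \<gamma> \<zeta> t" "t \<in> {0..1}"
  shows "\<xi> = \<zeta>"
proof
  fix c
  show "\<xi> c = \<zeta> c"
  proof (cases "c \<in> A \<and> \<gamma> t \<in> dom_chart c")
    case True
    then have "((\<lambda>s. crd c (\<gamma> s)) has_vector_derivative \<xi> c) (at t within {0..1})"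
      "((\<lambda>s. crd c (\<gamma> s)) has_vector_derivative \<zeta> c) (at t within {0..1})"
      using assms by (auto simp: has_velocity_def)
    then show ?thesis by (rule vector_derivative_unique_Icc01) (fact assms(3))
  next
    case False
    have "\<xi> c = 0" "\<zeta> c = 0"
      using assms False unfolding has_velocity_def by (blast intro: tangent_space_component_0)+
    then show ?thesis by simp
  qed
qed

lemma velocity_eq:
  assumes "has_velocity A \<gamma> \<xi> t" "t \<in> {0..1}"
  shows "velocity A \<gamma> t = \<xi>"
proof -
  have "(THE \<xi>. has_velocity A \<gamma> \<xi> t) = \<xi>"
    using assms has_velocity_unique by blast
  then show ?thesis unfolding velocity_def using assms(1) by metis
qed

section \<open>The metric tensor in coordinates\<close>

lemma local_metric_at_point:
  assumes "c \<in> A" "p \<in> dom_chart c" "\<xi> \<in> tangent_space A p"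
  shows "local_metric A g c (crd c p) (\<xi> c) (\<xi> c) = g p \<xi> \<xi>"
  using assms by (simp add: local_metric_def chartD(6) coord_vec_eq)

context
  fixes c and U
  assumes c: "c \<in> A" and U_def: "U = crd c ` dom_chart c"
begin

lemma local_metric_linear_left: "x \<in> U \<Longrightarrow> linear (\<lambda>v. local_metric A g c x v w)"
proof (rule linearI)
  fix v v' assume "x \<in> U"
  then have p: "inv_crd c x \<in> dom_chart c" using chartD(7) c U_def by auto
  note l = metric_linear[OF coord_vec_in_tangent_space[OF c p] coord_vec_in_tangent_space[OF c p]
      coord_vec_in_tangent_space[OF c p]]
  note * = l[folded coord_vec_linear[OF c p]]
  show add: "local_metric A g c x (v + v') w = local_metric A g c x v w + local_metric A g c x v' w"
    using *[where a = 1 ] by (simp add: local_metric_def)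
  fix r
  have "local_metric A g c x 0 w = 0" using *[of 1 0 0] by (simp add: local_metric_def)
  then show "local_metric A g c x (r *\<^sub>R v) w = r *\<^sub>R local_metric A g c x v w"
    using *[of r v 0] by (simp add: local_metric_def)
qed

lemma local_metric_sym: "x \<in> U \<Longrightarrow> local_metric A g c x v w = local_metric A g c x w v"
  unfolding local_metric_def U_def
  by (intro metric_sym coord_vec_in_tangent_space c chartD(7)[OF c])

text \<open>Smoothness of the metric is given for fixed \<open>v\<close> and \<open>w\<close> only.
  The expansion in a basis yields joint continuity in point and vectors, and bounds that are uniform
  in the vectors.\<close>

lemma local_metric_expand:
  assumes "x \<in> U"
  shows "local_metric A g c x v w =
    (\<Sum>i\<in>Basis. \<Sum>j\<in>Basis. (v \<bullet> i) * (w \<bullet> j) * local_metric A g c x i j)"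
proof -
  have lin: "local_metric A g c x v w = (\<Sum>i\<in>Basis. (v \<bullet> i) *\<^sub>R local_metric A g c x i w)" for v w
    by (rule linear_basis_expansion[OF local_metric_linear_left[OF assms]])
  have "local_metric A g c x i w = (\<Sum>j\<in>Basis. (w \<bullet> j) * local_metric A g c x i j)" for i
    unfolding local_metric_sym[OF assms, of i] using lin[of w i] by simp
  with lin[of v w] show ?thesis by (simp add: sum_distrib_left mult.assoc)
qed

lemma local_metric_smoothD:
  shows "continuous_on U (\<lambda>x. local_metric A g c x v w)"
    and "x \<in> U \<Longrightarrow> (\<lambda>x. local_metric A g c x v w) differentiable (at x)"
    and "continuous_on U (\<lambda>x. frechet_derivative (\<lambda>y. local_metric A g c y v w) (at x) h)"
proof -
  have *: "Ck_on k U (\<lambda>x. local_metric A g c x v w)" for k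
    using metric_smooth[OF c] by (simp add: smooth_on_def U_def)
  show "continuous_on U (\<lambda>x. local_metric A g c x v w)" using *[of 0] by simp
  show "x \<in> U \<Longrightarrow> (\<lambda>x. local_metric A g c x v w) differentiable (at x)"
    "continuous_on U (\<lambda>x. frechet_derivative (\<lambda>y. local_metric A g c y v w) (at x) h)"
    using *[of "Suc 0"] by auto
qed

text \<open>Pointwise positivity becomes uniform by compactness of \<open>K\<close> times the unit
  sphere; homogeneity extends it to all vectors.\<close>

lemma local_metric_lower_bound:
  assumes K: "compact K" "K \<subseteq> U"
  shows "\<exists>m>0. \<forall>x\<in>K. \<forall>v. m * (norm v)\<^sup>2 \<le> local_metric A g c x v v"
proof (cases "K = {}")
  case True
  then show ?thesis by (intro exI[of _ 1]) auto
next
  case False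
  define f where "f = (\<lambda>(x, v). local_metric A g c x v v)"
  have pos: "0 < local_metric A g c x v v" if "x \<in> U" "v \<noteq> 0" for x v
  proof -
    have p: "inv_crd c x \<in> dom_chart c" using that chartD(7) c U_def by auto
    have "coord_vec A c (inv_crd c x) v c = v" by (simp add: c p)
    then have "coord_vec A c (inv_crd c x) v \<noteq> (\<lambda>_. 0)" using that by auto
    then show ?thesis unfolding local_metric_def
      by (intro metric_pos coord_vec_in_tangent_space c p)
  qed
  have "continuous_on (K \<times> sphere 0 1)
      (\<lambda>z. \<Sum>i\<in>Basis. \<Sum>j\<in>Basis. (snd z \<bullet> i) * (snd z \<bullet> j) * local_metric A g c (fst z) i j)"
    by (intro continuous_intros continuous_on_compose2[OF local_metric_smoothD(1)]) (use K in auto)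
  then have cont: "continuous_on (K \<times> sphere 0 1) f"
    by (rule continuous_on_eq) (use K in \<open>auto simp: f_def local_metric_expand[symmetric]\<close>)
  have "K \<times> sphere 0 (1::real) \<noteq> ({} :: ('e \<times> 'e) set)" using False by auto
  then obtain z where z: "z \<in> K \<times> sphere 0 1" "\<And>y. y \<in> K \<times> sphere 0 1 \<Longrightarrow> f z \<le> f y"
    using continuous_attains_inf[OF compact_Times[OF K(1) compact_sphere] _ cont] by blast
  have "0 < f z" using z(1) K pos[of "fst z" "snd z"] by (fastforce simp: f_def split: prod.splits)
  moreover have "f z * (norm v)\<^sup>2 \<le> local_metric A g c x v v" if "x \<in> K" for x v
  proof (cases "v = 0")
    case True
    then show ?thesis using linear_0[OF local_metric_linear_left, of x] that K by auto
  next
    case False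
    have x: "x \<in> U" using that K by auto
    define u where "u = v /\<^sub>R norm v"
    have v: "v = norm v *\<^sub>R u" using False by (simp add: u_def)
    have "f z \<le> local_metric A g c x u u"
      using z(2)[of "(x, u)"] that False by (auto simp: f_def u_def)
    moreover have "local_metric A g c x v v = (norm v)\<^sup>2 * local_metric A g c x u u"
    proof -
      have scale: "local_metric A g c x (r *\<^sub>R y) w = r * local_metric A g c x y w" for r y w
        using linear_scale[OF local_metric_linear_left[OF x], of r y w] by simp
      have "local_metric A g c x (norm v *\<^sub>R u) (norm v *\<^sub>R u) =
          (norm v)\<^sup>2 * local_metric A g c x u u"
        unfolding scale[of "norm v" u "norm v *\<^sub>R u"]
          local_metric_sym[OF x, of u "norm v *\<^sub>R u"] scale[of "norm v" u u]
        by (simp only: power2_eq_square mult.assoc)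
      then show ?thesis unfolding v[symmetric] .
    qed
    ultimately show ?thesis by (metis mult.commute mult_left_mono zero_le_power2)
  qed
  ultimately show ?thesis by blast
qed

text \<open>Only the finitely many derivatives along triples of basis vectors have to be bounded on
  \<open>K\<close>; multilinearity does the rest.\<close>

lemma local_metric_derivative_bound:
  assumes K: "compact K" "K \<subseteq> U"
  shows "\<exists>M\<ge>0. \<forall>x\<in>K. \<forall>a b w.
    \<bar>frechet_derivative (\<lambda>y. local_metric A g c y b w) (at x) a\<bar> \<le> M * norm a * norm b * norm w"
proof -
  define d where "d k i j x = frechet_derivative (\<lambda>y. local_metric A g c y i j) (at x) k" for k i j x
  have "\<exists>M. \<forall>x\<in>K. \<bar>d k i j x\<bar> \<le> M" for k i j
  proof -
    have "compact (d k i j ` K)" unfolding d_def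
      using local_metric_smoothD(3) K by (intro compact_continuous_image) (auto intro: continuous_on_subset)
    then show ?thesis by (meson bounded_real compact_imp_bounded imageI)
  qed
  then obtain M where M: "\<And>k i j x. x \<in> K \<Longrightarrow> \<bar>d k i j x\<bar> \<le> M k i j" by metis
  define N where "N = (\<Sum>i\<in>(Basis::'e set). \<Sum>j\<in>(Basis::'e set). \<Sum>k\<in>(Basis::'e set). \<bar>M k i j\<bar>)"
  have "\<bar>d a b w x\<bar> \<le> N * norm a * norm b * norm w" if "x \<in> K" for x a b w
  proof -
    have x: "x \<in> U" using that K by auto
    have der: "((\<lambda>y. local_metric A g c y i j) has_derivative (\<lambda>h. d h i j x)) (at x)" for i j
      unfolding d_def using local_metric_smoothD(2)[OF x, of i j, unfolded frechet_derivative_works] .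
    have "((\<lambda>y. \<Sum>i\<in>Basis. \<Sum>j\<in>Basis. (b \<bullet> i) * (w \<bullet> j) * local_metric A g c y i j) has_derivative
        (\<lambda>h. \<Sum>i\<in>Basis. \<Sum>j\<in>Basis. (b \<bullet> i) * (w \<bullet> j) * d h i j x)) (at x)"
      by (intro has_derivative_sum has_derivative_mult_right der)
    then have "((\<lambda>y. local_metric A g c y b w) has_derivative
        (\<lambda>h. \<Sum>i\<in>Basis. \<Sum>j\<in>Basis. (b \<bullet> i) * (w \<bullet> j) * d h i j x)) (at x)"
      by (rule has_derivative_transform_within_open[OF _ _ x])
        (use chartD(2)[OF c] in \<open>auto simp: U_def local_metric_expand[unfolded U_def, symmetric]\<close>)
    then have "d a b w x = (\<Sum>i\<in>Basis. \<Sum>j\<in>Basis. (b \<bullet> i) * (w \<bullet> j) * d a i j x)"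
      unfolding d_def[of a b w] by (simp only: frechet_derivative_at[symmetric])
    also have "\<dots> = (\<Sum>i\<in>Basis. \<Sum>j\<in>Basis. \<Sum>k\<in>Basis. (b \<bullet> i) * (w \<bullet> j) * ((a \<bullet> k) * d k i j x))"
    proof (intro sum.cong refl)
      fix i j
      show "(b \<bullet> i) * (w \<bullet> j) * d a i j x
          = (\<Sum>k\<in>Basis. (b \<bullet> i) * (w \<bullet> j) * ((a \<bullet> k) * d k i j x))"
        using linear_basis_expansion[OF has_derivative_linear[OF der], of a i j]
        by (simp add: sum_distrib_left)
    qed
    also have "\<bar>\<dots>\<bar> \<le> (\<Sum>i\<in>Basis. \<Sum>j\<in>Basis. \<Sum>k\<in>Basis.
        norm b * norm w * (norm a * \<bar>M k i j\<bar>))"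
    proof (intro order.trans[OF sum_abs] sum_mono)
      fix i j k :: 'e assume "i \<in> Basis" "j \<in> Basis" "k \<in> Basis"
      then show "\<bar>b \<bullet> i * (w \<bullet> j) * (a \<bullet> k * d k i j x)\<bar> \<le> norm b * norm w * (norm a * \<bar>M k i j\<bar>)"
        unfolding abs_mult using M[OF that, of k i j]
        by (intro mult_mono Basis_le_norm) auto
    qed
    also have "\<dots> = N * norm a * norm b * norm w"
      by (simp add: N_def sum_distrib_left sum_distrib_right mult_ac)
    finally show ?thesis .
  qed
  moreover have "N \<ge> 0" by (auto simp: N_def intro!: sum_nonneg)
  ultimately show ?thesis unfolding d_def by blast
qed

end

end

section \<open>Geodesics and the velocity of Lipschitz curves\<close>

lemma has_vector_derivative_bound_Icc:
  fixes f :: "real \<Rightarrow> 'b::real_normed_vector"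
  assumes "\<And>x. x \<in> {a..b} \<Longrightarrow> (f has_vector_derivative f' x) (at x within {a..b})"
    and "\<And>x. x \<in> {a..b} \<Longrightarrow> norm (f' x) \<le> C" and "a \<le> b"
  shows "norm (f b - f a) \<le> C * (b - a)"
proof -
  have "norm (f b - f a) \<le> C * norm (b - a)"
    by (rule differentiable_bound[of "{a..b}" f "\<lambda>x h. h *\<^sub>R f' x"])
      (use assms in \<open>auto simp: has_vector_derivative_def onorm_scaleR_left[OF bounded_linear_ident] onorm_id
        intro!: onorm_bound mult_left_mono\<close>)
  then show ?thesis using assms by simp
qed

context riemannian_manifold
begin

text \<open>The geodesic equation supplies derivatives chart by chart. That they form a single
  tangent vector follows from the chain rule for coordinate changes and uniqueness of
  derivatives.\<close>

lemma geodesic_has_velocity: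
  assumes "geodesic A g \<gamma>" and t: "t \<in> {0..1}"
  shows "\<exists>\<xi>. has_velocity A \<gamma> \<xi> t"
proof -
  have cont: "continuous (at t within {0..1}) \<gamma>"
    using assms by (auto simp: geodesic_def continuous_on_eq_continuous_within)
  have "\<forall>c. \<exists>d. c \<in> A \<longrightarrow> \<gamma> t \<in> dom_chart c \<longrightarrow>
      ((\<lambda>s. crd c (\<gamma> s)) has_vector_derivative d) (at t within {0..1})"
    using assms unfolding geodesic_def by blast
  from choice[OF this] obtain d where d: "\<And>c. c \<in> A \<Longrightarrow> \<gamma> t \<in> dom_chart c \<Longrightarrow>
      ((\<lambda>s. crd c (\<gamma> s)) has_vector_derivative d c) (at t within {0..1})" by blast
  define \<xi> where "\<xi> = (\<lambda>c. if c \<in> A \<and> \<gamma> t \<in> dom_chart c then d c else 0)"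
  have trans: "d c' = frechet_derivative (crd c' \<circ> inv_crd c) (at (crd c (\<gamma> t))) (d c)"
    if c: "c \<in> A" "\<gamma> t \<in> dom_chart c" and c': "c' \<in> A" "\<gamma> t \<in> dom_chart c'" for c c'
  proof (rule vector_derivative_unique_Icc01[OF d[OF c'] _ t])
    let ?D = "frechet_derivative (crd c' \<circ> inv_crd c) (at (crd c (\<gamma> t)))"
    have "((crd c' \<circ> inv_crd c) \<circ> (\<lambda>s. crd c (\<gamma> s)) has_vector_derivative ?D (d c)) (at t within {0..1})"
      by (rule vector_derivative_diff_chain_within[OF d[OF c]
          has_derivative_at_withinI[OF transition_has_derivative[OF c(1) c'(1) c(2) c'(2)]]])
    moreover have "eventually (\<lambda>s. \<gamma> s \<in> dom_chart c) (at t within {0..1})"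
      using cont chartD(1)[OF c(1)] c(2) unfolding continuous_within by (rule topological_tendstoD)
    then have "eventually (\<lambda>s. ((crd c' \<circ> inv_crd c) \<circ> (\<lambda>s. crd c (\<gamma> s))) s = crd c' (\<gamma> s))
        (at t within {0..1})"
      by eventually_elim (simp add: chartD(6)[OF c(1)])
    ultimately show "((\<lambda>s. crd c' (\<gamma> s)) has_vector_derivative ?D (d c)) (at t within {0..1})"
      unfolding has_vector_derivative_def
      by (rule has_derivative_transform_eventually) (use t c chartD(6)[OF c(1)] in auto)
  qed
  have in_chart: "\<xi> c = d c" if "c \<in> A" "\<gamma> t \<in> dom_chart c" for c
    unfolding \<xi>_def using that by simp
  have "\<xi> c = 0" if "\<not> (c \<in> A \<and> \<gamma> t \<in> dom_chart c)" for c
    unfolding \<xi>_def using that by (rule if_not_P)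
  moreover have "\<xi> c' = frechet_derivative (crd c' \<circ> inv_crd c) (at (crd c (\<gamma> t))) (\<xi> c)"
    if "c \<in> A" "c' \<in> A" "\<gamma> t \<in> dom_chart c \<inter> dom_chart c'" for c c'
    using trans[OF that(1) _ that(2)] that in_chart[OF that(1)] in_chart[OF that(2)]
    by (simp only: Int_iff)
  ultimately have "\<xi> \<in> tangent_space A (\<gamma> t)"
    unfolding tangent_space_def by blast
  moreover have "((\<lambda>s. crd c (\<gamma> s)) has_vector_derivative \<xi> c) (at t within {0..1})"
    if "c \<in> A" "\<gamma> t \<in> dom_chart c" for c
    unfolding in_chart[OF that] by (rule d[OF that])
  ultimately have "has_velocity A \<gamma> \<xi> t"
    using cont unfolding has_velocity_def by blast
  then show ?thesis by blast
qed

lemma christoffel_bound: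
  assumes "c \<in> A" "compact K" "K \<subseteq> crd c ` dom_chart c"
  shows "\<exists>M\<ge>0. \<forall>x\<in>K. \<forall>a w. \<bar>christoffel A g c x a a w\<bar> \<le> M * (norm a)\<^sup>2 * norm w"
proof -
  obtain M where M: "M \<ge> 0" "\<And>x a b w. x \<in> K \<Longrightarrow>
      \<bar>frechet_derivative (\<lambda>y. local_metric A g c y b w) (at x) a\<bar> \<le> M * norm a * norm b * norm w"
    using local_metric_derivative_bound[OF assms(1) refl assms(2,3)] by blast
  \<comment> \<open>With both velocity slots equal to \<open>a\<close>, two of the three derivatives
    coincide, so two instances of the bound cover them all.\<close>
  have "\<bar>christoffel A g c x a a w\<bar> \<le> 3 / 2 * M * (norm a)\<^sup>2 * norm w" if "x \<in> K" for x a w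
    using M(2)[OF that, of a w a] M(2)[OF that, of a a w]
    unfolding christoffel_def power2_eq_square
    by (simp add: mult_ac)
  then show ?thesis using M(1) by (intro exI[of _ "3 / 2 * M"]) auto
qed

text \<open>The geodesic equation bounds the acceleration by the square of the speed, and a short geodesic cannot leave a
  coordinate ball because its coordinate speed is controlled there.\<close>

lemma geodesic_chart_estimate:
  assumes c: "c \<in> A" and \<theta>: "\<theta> \<in> dom_chart c"
  shows "\<exists>\<delta> \<kappa>. 0 < \<delta> \<and> (\<forall>\<eta>\<in>tangent_space A \<theta>. \<forall>\<gamma>. geodesic_from A g \<theta> \<eta> \<gamma> \<longrightarrow>
    (\<forall>t\<in>{0..1}. tnorm g (\<gamma> t) (velocity A \<gamma> t) = tnorm g \<theta> \<eta>) \<longrightarrow> tnorm g \<theta> \<eta> < \<delta> \<longrightarrow>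
    norm (crd c (\<gamma> 1) - crd c \<theta> - \<eta> c) \<le> \<kappa> * (tnorm g \<theta> \<eta>)\<^sup>2)"
proof -
  define U where "U = crd c ` dom_chart c"
  define x0 where "x0 = crd c \<theta>"
  have "open U" "x0 \<in> U" using chartD(2)[OF c] \<theta> by (auto simp: U_def x0_def)
  then obtain r where r: "r > 0" "cball x0 r \<subseteq> U" using open_contains_cball by blast
  obtain m where m: "m > 0" "\<And>x v. x \<in> cball x0 r \<Longrightarrow> m * (norm v)\<^sup>2 \<le> local_metric A g c x v v"
    using local_metric_lower_bound[OF c U_def compact_cball r(2)] by blast
  obtain M where M: "M \<ge> 0" "\<And>x a w. x \<in> cball x0 r \<Longrightarrow>
      \<bar>christoffel A g c x a a w\<bar> \<le> M * (norm a)\<^sup>2 * norm w"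
    using christoffel_bound[OF c compact_cball r(2)[unfolded U_def]] by blast
  \<comment> \<open>From m |u''|^2 \<le> M |u'|^2 |u''| and |u'| \<le> T / sqrt m one gets |u''|
    \<le> (M / m / m) T^2, where \<open>T\<close> is the Riemannian speed.\<close>
  define \<kappa> where "\<kappa> = M / m / m"
  \<comment> \<open>The threshold \<open>r * sqrt m\<close> ensures \<open>T / sqrt m < r\<close>:
    the coordinate distance covered in unit time is smaller than the radius of the ball.\<close>
  show ?thesis
  proof (rule exI[of _ "r * sqrt m"], rule exI[of _ \<kappa>], intro conjI ballI allI impI)
    show "0 < r * sqrt m" using r m by simp
    fix \<eta> \<gamma>
    assume \<eta>: "\<eta> \<in> tangent_space A \<theta>" and geo: "geodesic_from A g \<theta> \<eta> \<gamma>"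
      and speed: "\<forall>t\<in>{0..1}. tnorm g (\<gamma> t) (velocity A \<gamma> t) = tnorm g \<theta> \<eta>"
      and small: "tnorm g \<theta> \<eta> < r * sqrt m"
    define T where "T = tnorm g \<theta> \<eta>"
    have T: "0 \<le> T" "T / sqrt m < r"
      using tnorm_nonneg[OF \<eta>] small m(1) by (auto simp: T_def field_simps)
    have cont: "continuous_on {0..1} \<gamma>" and \<gamma>0: "\<gamma> 0 = \<theta>" and vel0: "has_velocity A \<gamma> \<eta> 0"
      using geo by (auto simp: geodesic_from_def geodesic_def)
    obtain u' u'' where u: "\<And>t. t \<in> {0..1} \<Longrightarrow> \<gamma> t \<in> dom_chart c \<Longrightarrow>
        ((\<lambda>s. crd c (\<gamma> s)) has_vector_derivative u' t) (at t within {0..1}) \<and>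
        (u' has_vector_derivative u'' t) (at t within {0..1}) \<and>
        (\<forall>w. local_metric A g c (crd c (\<gamma> t)) (u'' t) w
              + christoffel A g c (crd c (\<gamma> t)) (u' t) (u' t) w = 0)"
      using geo c unfolding geodesic_from_def geodesic_def by meson
    have speed_bound: "norm (u' t) \<le> T / sqrt m"
      if t: "t \<in> {0..1}" "\<gamma> t \<in> dom_chart c" "crd c (\<gamma> t) \<in> cball x0 r" for t
    proof -
      obtain \<xi> where \<xi>: "has_velocity A \<gamma> \<xi> t"
        using geodesic_has_velocity t geo by (auto simp: geodesic_from_def)
      then have \<xi>T: "\<xi> \<in> tangent_space A (\<gamma> t)"
        and "((\<lambda>s. crd c (\<gamma> s)) has_vector_derivative \<xi> c) (at t within {0..1})"
        using t c by (auto simp: has_velocity_def)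
      then have "\<xi> c = u' t" using u t by (blast intro: vector_derivative_unique_Icc01)
      then have "m * (norm (u' t))\<^sup>2 \<le> g (\<gamma> t) \<xi> \<xi>"
        using m(2)[OF t(3), of "u' t"] local_metric_at_point[OF c t(2) \<xi>T] by simp
      also have "\<dots> = (tnorm g (\<gamma> t) \<xi>)\<^sup>2"
        using tnorm_nonneg(1)[OF \<xi>T] by (simp add: tnorm_def)
      also have "\<dots> = T\<^sup>2"
        using bspec[OF speed t(1)] velocity_eq[OF \<xi> t(1)] by (simp add: T_def)
      finally have "(norm (u' t))\<^sup>2 \<le> (T / sqrt m)\<^sup>2"
        using m(1) by (simp add: power_divide field_simps)
      then show ?thesis using T m(1) by (simp add: power2_le_iff_abs_le)
    qed
    \<comment> \<open>Let \<open>s\<close> be the first time outside the coordinate ball. Before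
      \<open>s\<close> the curve lies in \<open>Q\<close>, the points within coordinate distance
      \<open>T / sqrt m\<close> of the centre. Being compact, \<open>Q\<close> is closed in the
      Hausdorff manifold, so \<open>\<gamma> s\<close> still lies in \<open>Q\<close> and thus in
      the open ball, a contradiction. Closedness in the manifold also rules out an escape from the
      chart itself.\<close>
    have stay: "\<gamma> t \<in> dom_chart c \<and> crd c (\<gamma> t) \<in> ball x0 r" if "t \<in> {0..1}" for t
    proof (rule ccontr)
      define P where "P = dom_chart c \<inter> crd c -` ball x0 r"
      assume "\<not> ?thesis"
      then have tP: "\<gamma> t \<notin> P" by (auto simp: P_def)
      have "open P" unfolding P_def
        by (intro continuous_open_preimage chartD[OF c] open_ball)
      then have "closed ({0..1} \<inter> \<gamma> -` (- P))"
        by (intro continuous_closed_preimage cont) auto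
      then have "compact ({0..1} \<inter> \<gamma> -` (- P))"
        by (meson bounded_Int bounded_closed_interval compact_eq_bounded_closed)
      moreover have "{0..1} \<inter> \<gamma> -` (- P) \<noteq> {}" using that tP by blast
      ultimately obtain s where "s \<in> {0..1} \<inter> \<gamma> -` (- P)"
        and "\<forall>y\<in>{0..1} \<inter> \<gamma> -` (- P). s \<le> y"
        using compact_attains_inf[of "{0..1} \<inter> \<gamma> -` (- P)"] by blast
      then have s: "s \<in> {0..1}" "\<gamma> s \<notin> P"
        and min: "\<And>y. y \<in> {0..1} \<Longrightarrow> \<gamma> y \<notin> P \<Longrightarrow> s \<le> y" by blast+
      have "s \<noteq> 0" using s(2) \<gamma>0 \<theta> r by (auto simp: P_def x0_def)
      then have "0 < s" using s by auto
      define Q where "Q = inv_crd c ` cball x0 (T / sqrt m)"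
      have QU: "cball x0 (T / sqrt m) \<subseteq> U" using T r by auto
      have "compact Q" unfolding Q_def
        using chartD(4)[OF c] QU unfolding U_def
        by (intro compact_continuous_image compact_cball) (rule continuous_on_subset)
      then have "closed Q" by (rule compact_imp_closed)
      have "\<gamma> y \<in> Q" if y: "y \<in> {0..<s}" for y
      proof -
        have inP: "\<gamma> z \<in> P" if "z \<in> {0..y}" for z using min[of z] that y s by force
        have "norm (crd c (\<gamma> y) - crd c (\<gamma> 0)) \<le> T / sqrt m * (y - 0)"
        proof (rule has_vector_derivative_bound_Icc)
          fix z assume z: "z \<in> {0..y}"
          then have zz: "z \<in> {0..1}" "\<gamma> z \<in> dom_chart c" "crd c (\<gamma> z) \<in> cball x0 r"
            using inP[OF z] y s by (auto simp: P_def)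
          show "((\<lambda>s. crd c (\<gamma> s)) has_vector_derivative u' z) (at z within {0..y})"
            by (rule has_vector_derivative_within_subset[OF conjunct1[OF u[OF zz(1,2)]]])
              (use y s in auto)
          show "norm (u' z) \<le> T / sqrt m" using speed_bound zz by blast
        qed (use y in auto)
        also have "\<dots> \<le> T / sqrt m * 1" using y s T m by (intro mult_left_mono) auto
        finally have "crd c (\<gamma> y) \<in> cball x0 (T / sqrt m)"
          by (simp add: x0_def \<gamma>0 dist_norm norm_minus_commute)
        moreover have "\<gamma> y = inv_crd c (crd c (\<gamma> y))"
          using inP[of y] y chartD(6)[OF c] by (auto simp: P_def)
        ultimately show ?thesis unfolding Q_def by blast
      qed
      then have "\<gamma> ` {0..<s} \<subseteq> Q" by blast
      moreover have cl: "closure {0..<s} = {0..s}" using \<open>0 < s\<close> by (simp add: closure_atLeastLessThan)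
      ultimately have "\<gamma> ` {0..s} \<subseteq> Q"
        using image_closure_subset[of "{0..<s}" \<gamma> Q] \<open>closed Q\<close> continuous_on_subset[OF cont, of "{0..s}"] s
        by (auto simp: cl)
      then have "\<gamma> s \<in> Q" using \<open>0 < s\<close> by auto
      then obtain y where y: "y \<in> cball x0 (T / sqrt m)" "\<gamma> s = inv_crd c y" by (auto simp: Q_def)
      then have "\<gamma> s \<in> dom_chart c" "crd c (\<gamma> s) = y"
        using chartD(7,8)[OF c] QU unfolding U_def by auto
      then have "\<gamma> s \<in> P" using y T by (auto simp: P_def)
      with s show False by simp
    qed
    have acc: "norm (u'' t) \<le> \<kappa> * T\<^sup>2" if t: "t \<in> {0..1}" for t
    proof (cases "u'' t = 0")
      case True
      then show ?thesis using M m by (simp add: \<kappa>_def)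
    next
      case False
      have tt: "\<gamma> t \<in> dom_chart c" "crd c (\<gamma> t) \<in> cball x0 r" using stay[OF t] by auto
      \<comment> \<open>Testing the geodesic equation with the acceleration itself isolates its
        length.\<close>
      have "local_metric A g c (crd c (\<gamma> t)) (u'' t) (u'' t)
          + christoffel A g c (crd c (\<gamma> t)) (u' t) (u' t) (u'' t) = 0"
        using u[OF t tt(1)] by blast
      then have "m * (norm (u'' t))\<^sup>2 \<le> M * (norm (u' t))\<^sup>2 * norm (u'' t)"
        using m(2)[OF tt(2), of "u'' t"] M(2)[OF tt(2), of "u' t" "u'' t"] by linarith
      then have "m * norm (u'' t) \<le> M * (norm (u' t))\<^sup>2"
        using False by (simp add: power2_eq_square[of "norm (u'' t)"] flip: mult.assoc)
      also have "\<dots> \<le> M * (T / sqrt m)\<^sup>2"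
        using speed_bound[OF t tt] M(1) by (intro mult_left_mono power_mono) auto
      finally show ?thesis using m(1) by (simp add: \<kappa>_def field_simps)
    qed
    have u': "norm (u' t - u' 0) \<le> \<kappa> * T\<^sup>2" if t: "t \<in> {0..1}" for t
    proof -
      have "norm (u' t - u' 0) \<le> \<kappa> * T\<^sup>2 * (t - 0)"
      proof (rule has_vector_derivative_bound_Icc)
        fix z assume z: "z \<in> {0..t}"
        then have z1: "z \<in> {0..1}" using t by auto
        show "(u' has_vector_derivative u'' z) (at z within {0..t})"
          by (rule has_vector_derivative_within_subset[OF conjunct1[OF conjunct2[OF u[OF z1]]]])
            (use stay[OF z1] t in auto)
        show "norm (u'' z) \<le> \<kappa> * T\<^sup>2" using acc[OF z1] .
      qed (use t in auto)
      also have "\<dots> \<le> \<kappa> * T\<^sup>2 * 1"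
        using t M m by (intro mult_left_mono) (auto simp: \<kappa>_def)
      finally show ?thesis by simp
    qed
    \<comment> \<open>Subtracting the uniform motion with the initial velocity leaves a curve whose
      derivative is of second order in the speed.\<close>
    have "norm ((crd c (\<gamma> 1) - 1 *\<^sub>R u' 0) - (crd c (\<gamma> 0) - 0 *\<^sub>R u' 0)) \<le> \<kappa> * T\<^sup>2 * (1 - 0)"
    proof (rule has_vector_derivative_bound_Icc[where f = "\<lambda>t. crd c (\<gamma> t) - t *\<^sub>R u' 0" and f' = "\<lambda>t. u' t - u' 0"])
      fix z :: real assume z: "z \<in> {0..1}"
      have "((\<lambda>s. crd c (\<gamma> s)) has_vector_derivative u' z) (at z within {0..1})"
        using u[OF z] stay[OF z] by blast
      then show "((\<lambda>t. crd c (\<gamma> t) - t *\<^sub>R u' 0) has_vector_derivative u' z - u' 0) (at z within {0..1})"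
        by (auto intro!: derivative_eq_intros)
      show "norm (u' z - u' 0) \<le> \<kappa> * T\<^sup>2" using u'[OF z] .
    qed simp
    moreover have "u' 0 = \<eta> c"
      using u[of 0] stay[of 0] vel0 c \<gamma>0 \<theta> unfolding has_velocity_def
      by (intro vector_derivative_unique_Icc01[of "\<lambda>s. crd c (\<gamma> s)" _ 0]) auto
    ultimately show "norm (crd c (\<gamma> 1) - crd c \<theta> - \<eta> c) \<le> \<kappa> * (tnorm g \<theta> \<eta>)\<^sup>2"
      by (simp add: \<gamma>0 T_def algebra_simps)
  qed
qed

end

context wasserstein_submanifold
begin

lemma B_zero: "\<theta> \<in> S \<Longrightarrow> B \<theta> (\<lambda>_. 0) = (\<lambda>_. 0)"
  using B_linear[OF _ zero_in_tangent_space zero_in_tangent_space, of \<theta> 1]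
  by (auto simp: fun_eq_iff)

lemma B_coord_linear:
  assumes "\<theta> \<in> S" "c \<in> A" "\<theta> \<in> dom_chart c"
  shows "linear (\<lambda>w. B \<theta> (coord_vec A c \<theta> w) x)"
proof -
  have *: "B \<theta> (coord_vec A c \<theta> (a *\<^sub>R v + w)) x
      = a *\<^sub>R B \<theta> (coord_vec A c \<theta> v) x + B \<theta> (coord_vec A c \<theta> w) x" for a v w
    unfolding coord_vec_linear[OF assms(2,3)]
    by (subst B_linear[OF assms(1)]) (auto intro: coord_vec_in_tangent_space assms(2,3))
  have z: "B \<theta> (coord_vec A c \<theta> 0) x = 0" using *[of 1 0 0] by simp
  show ?thesis
    by (rule linearI) (use *[of 1] *[of _ _ 0] z in auto)
qed

text \<open>The vectors of \<open>D\<close> that join \<open>\<gamma> t\<close> to nearby points \<open>\<gamma> s\<close>, divided by \<open>s - t\<close>, converge to the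
  velocity, so the bounds on \<open>B\<close> are inherited by the velocity.\<close>

lemma velocity_field_bounded:
  assumes \<gamma>: "lipschitz_curve S (riem_dist A g S) \<gamma>"
  shows "\<exists>C. \<forall>t\<in>{0..1}. \<forall>x. norm (B (\<gamma> t) (velocity A \<gamma> t) x) \<le> C"
proof -
  obtain L where L: "\<And>s t. s \<in> {0..1} \<Longrightarrow> t \<in> {0..1} \<Longrightarrow>
      riem_dist A g S (\<gamma> s) (\<gamma> t) \<le> L * \<bar>s - t\<bar>"
    using \<gamma> unfolding lipschitz_curve_def by blast
  have \<gamma>S: "\<gamma> t \<in> S" if "t \<in> {0..1}" for t using \<gamma> that by (auto simp: lipschitz_curve_def)
  obtain C0 where C0: "C0 > 0"
    and C1: "\<And>\<theta> \<eta>. (\<theta>, \<eta>) \<in> D \<Longrightarrow> C1_norm (B \<theta> \<eta>) \<le> ennreal (C0 * tnorm g \<theta> \<eta>)"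
    using B_bounds by fastforce
  have bound: "norm (B (\<gamma> t) (velocity A \<gamma> t) x) \<le> C0 * \<bar>L\<bar>" if t: "t \<in> {0..1}" for t x
  proof (cases "\<exists>\<xi>. has_velocity A \<gamma> \<xi> t")
    case False
    then have "velocity A \<gamma> t = (\<lambda>_. 0)" by (simp only: velocity_def if_False)
    then show ?thesis using B_zero[OF \<gamma>S[OF t]] C0 by simp
  next
    case True
    then obtain \<xi> where \<xi>: "has_velocity A \<gamma> \<xi> t" by blast
    then have \<xi>T: "\<xi> \<in> tangent_space A (\<gamma> t)" by (simp only: has_velocity_def)
    define \<theta> where "\<theta> = \<gamma> t"
    obtain c where c: "c \<in> A" "\<theta> \<in> dom_chart c" by (rule chart_around)
    define F where "F = at t within {0..1::real}"
    have F: "F \<noteq> bot" unfolding F_def using t by (simp add: trivial_limit_within islimpt_Icc)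
    \<comment> \<open>The base point is frozen at \<open>\<theta>\<close> and only the vectors
      \<open>\<eta> s\<close> vary, so the limit below takes place in one tangent space.\<close>
    have "\<exists>\<eta>. (\<theta>, \<eta>) \<in> D \<and> \<gamma> s = riem_exp A g \<theta> \<eta>" if "s \<in> {0..1}" for s
      unfolding \<theta>_def by (intro D_onto \<gamma>S t that)
    then obtain \<eta> where \<eta>: "\<And>s. s \<in> {0..1} \<Longrightarrow> (\<theta>, \<eta> s) \<in> D"
      and \<gamma>\<eta>: "\<And>s. s \<in> {0..1} \<Longrightarrow> \<gamma> s = riem_exp A g \<theta> (\<eta> s)" by metis
    have \<eta>T: "\<eta> s \<in> tangent_space A \<theta>" if "s \<in> {0..1}" for s using D_subset \<eta>[OF that] by blast
    \<comment> \<open>On \<open>D\<close> the norm of a vector equals the distance that it bridges.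
      The absolute value of \<open>L\<close> appears because the Lipschitz constant is not assumed
      to be nonnegative.\<close>
    have len: "tnorm g \<theta> (\<eta> s) \<le> \<bar>L\<bar> * \<bar>s - t\<bar>" if s: "s \<in> {0..1}" for s
    proof -
      have "tnorm g \<theta> (\<eta> s) = riem_dist A g S (\<gamma> t) (\<gamma> s)"
        using D_geodesic[OF \<eta>[OF s] refl] \<gamma>\<eta>[OF s] by (simp add: \<theta>_def)
      also have "\<dots> \<le> L * \<bar>t - s\<bar>" by (rule L[OF t s])
      also have "\<dots> \<le> \<bar>L\<bar> * \<bar>s - t\<bar>" by (simp add: abs_minus_commute mult_right_mono)
      finally show ?thesis .
    qed
    obtain \<delta> \<kappa> where \<delta>: "\<delta> > 0" and est: "\<And>\<eta> \<gamma>. \<eta> \<in> tangent_space A \<theta> \<Longrightarrow> geodesic_from A g \<theta> \<eta> \<gamma> \<Longrightarrow>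
        (\<forall>t\<in>{0..1}. tnorm g (\<gamma> t) (velocity A \<gamma> t) = tnorm g \<theta> \<eta>) \<Longrightarrow> tnorm g \<theta> \<eta> < \<delta> \<Longrightarrow>
        norm (crd c (\<gamma> 1) - crd c \<theta> - \<eta> c) \<le> \<kappa> * (tnorm g \<theta> \<eta>)\<^sup>2"
      using geodesic_chart_estimate[OF c] by meson
    have est': "norm (crd c (\<gamma> s) - crd c \<theta> - \<eta> s c) \<le> \<bar>\<kappa>\<bar> * (\<bar>L\<bar> * \<bar>s - t\<bar>)\<^sup>2"
      if s: "s \<in> {0..1}" "\<bar>L\<bar> * \<bar>s - t\<bar> < \<delta>" for s
    proof -
      define \<sigma> where "\<sigma> = (\<lambda>r. riem_exp A g \<theta> (tscale r (\<eta> s)))"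
      have "geodesic_from A g \<theta> (\<eta> s) \<sigma> \<and> (\<forall>t\<in>{0..1}. tnorm g (\<sigma> t) (velocity A \<sigma> t) = tnorm g \<theta> (\<eta> s))"
        using D_geodesic[OF \<eta>[OF s(1)] \<sigma>_def] by blast
      moreover have "\<sigma> 1 = \<gamma> s" by (simp add: \<sigma>_def \<gamma>\<eta>[OF s(1)])
      ultimately have "norm (crd c (\<gamma> s) - crd c \<theta> - \<eta> s c) \<le> \<kappa> * (tnorm g \<theta> (\<eta> s))\<^sup>2"
        using est[OF \<eta>T[OF s(1)], of \<sigma>] len[OF s(1)] s(2) by simp
      also have "\<dots> \<le> \<bar>\<kappa>\<bar> * (\<bar>L\<bar> * \<bar>s - t\<bar>)\<^sup>2"
        using len[OF s(1)] tnorm_nonneg(2)[OF \<eta>T[OF s(1)]] by (intro mult_mono power_mono) auto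
      finally show ?thesis .
    qed
    have to_t: "((\<lambda>s. \<bar>s - t\<bar>) \<longlongrightarrow> 0) F" unfolding F_def
      by (rule tendsto_eq_intros refl | simp)+
    have inF: "eventually (\<lambda>s. s \<in> {0..1} \<and> s \<noteq> t) F"
      unfolding F_def by (auto simp: eventually_at_filter)
    have "((\<lambda>s. \<bar>L\<bar> * \<bar>s - t\<bar>) \<longlongrightarrow> 0) F" using tendsto_mult_right_zero[OF to_t] .
    then have smallF: "eventually (\<lambda>s. \<bar>L\<bar> * \<bar>s - t\<bar> < \<delta>) F" using \<delta> by (rule order_tendstoD)
    have "((\<lambda>s. crd c (\<gamma> s)) has_vector_derivative \<xi> c) (at t within {0..1})"
      using \<xi> c unfolding has_velocity_def \<theta>_def by blast
    then have "((\<lambda>s. (1 / norm (s - t)) *\<^sub>R (crd c (\<gamma> s) - (crd c (\<gamma> t) + (s - t) *\<^sub>R \<xi> c))) \<longlongrightarrow> 0) F"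
      unfolding has_vector_derivative_def has_derivative_within F_def by blast
    then have "((\<lambda>s. norm ((1 / norm (s - t)) *\<^sub>R (crd c (\<gamma> s) - (crd c (\<gamma> t) + (s - t) *\<^sub>R \<xi> c)))
        + \<bar>\<kappa>\<bar> * L\<^sup>2 * \<bar>s - t\<bar>) \<longlongrightarrow> 0) F"
      using tendsto_add[OF tendsto_norm tendsto_mult_right_zero[OF to_t]] by force
    moreover have "eventually (\<lambda>s. norm ((1 / (s - t)) *\<^sub>R \<eta> s c - \<xi> c) \<le>
        norm ((1 / norm (s - t)) *\<^sub>R (crd c (\<gamma> s) - (crd c (\<gamma> t) + (s - t) *\<^sub>R \<xi> c)))
        + \<bar>\<kappa>\<bar> * L\<^sup>2 * \<bar>s - t\<bar>) F"
      using inF smallF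
    proof eventually_elim
      case (elim s)
      define h where "h = s - t"
      have h: "h \<noteq> 0" using elim by (simp add: h_def)
      let ?y = "crd c (\<gamma> s) - (crd c (\<gamma> t) + h *\<^sub>R \<xi> c)"
      let ?z = "crd c (\<gamma> s) - crd c \<theta> - \<eta> s c"
      \<comment> \<open>Here \<open>?y\<close> is the error of differentiability of the curve, of
        order o(h), and \<open>?z\<close> is the error of replacing a geodesic by its initial
        vector, of order h^2.\<close>
      have "(1 / h) *\<^sub>R \<eta> s c - \<xi> c = (1 / h) *\<^sub>R ?y - (1 / h) *\<^sub>R ?z"
        using h by (simp add: \<theta>_def algebra_simps)
      then have "norm ((1 / h) *\<^sub>R \<eta> s c - \<xi> c) \<le> norm ((1 / h) *\<^sub>R ?y) + norm ((1 / h) *\<^sub>R ?z)"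
        by (metis norm_triangle_ineq4)
      also have "norm ((1 / h) *\<^sub>R ?z) \<le> (1 / \<bar>h\<bar>) * (\<bar>\<kappa>\<bar> * (\<bar>L\<bar> * \<bar>h\<bar>)\<^sup>2)"
        using est'[of s] elim unfolding norm_scaleR h_def by (simp add: divide_right_mono)
      also have "\<dots> = \<bar>\<kappa>\<bar> * L\<^sup>2 * \<bar>h\<bar>"
      proof -
        have "(\<bar>L\<bar> * \<bar>h\<bar>)\<^sup>2 = \<bar>h\<bar> * (L\<^sup>2 * \<bar>h\<bar>)"
          by (simp add: power_mult_distrib) (simp add: power2_eq_square mult_ac)
        then show ?thesis using h by simp
      qed
      finally show ?case by (simp add: h_def)
    qed
    ultimately have "((\<lambda>s. (1 / (s - t)) *\<^sub>R \<eta> s c - \<xi> c) \<longlongrightarrow> 0) F"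
      by (rule Lim_null_comparison[rotated])
    then have lim: "((\<lambda>s. (1 / (s - t)) *\<^sub>R \<eta> s c) \<longlongrightarrow> \<xi> c) F" by (simp add: LIM_zero_iff)
    \<comment> \<open>At a fixed base point \<open>B\<close> is linear on a finite-dimensional
      space, hence continuous, and the limit passes through it.\<close>
    define b where "b w = B \<theta> (coord_vec A c \<theta> w) x" for w
    have \<theta>S: "\<theta> \<in> S" using \<gamma>S t by (simp add: \<theta>_def)
    have "linear b" unfolding b_def by (rule B_coord_linear[OF \<theta>S c])
    then have bl: "bounded_linear b" by (rule linear_conv_bounded_linear[THEN iffD1])
    have "((\<lambda>s. b ((1 / (s - t)) *\<^sub>R \<eta> s c)) \<longlongrightarrow> b (\<xi> c)) F"
      by (rule bounded_linear.tendsto[OF bl lim])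
    \<comment> \<open>The quotients themselves may lie outside \<open>D\<close>. The bound is
      applied to \<open>\<eta> s\<close> and scaled by linearity, whereupon
      \<open>\<bar>s - t\<bar>\<close> cancels.\<close>
    moreover have "eventually (\<lambda>s. norm (b ((1 / (s - t)) *\<^sub>R \<eta> s c)) \<le> C0 * \<bar>L\<bar>) F"
      using inF
    proof eventually_elim
      case (elim s)
      then have s: "s \<in> {0..1}" by simp
      have "ennreal (norm (B \<theta> (\<eta> s) x)) \<le> C1_norm (B \<theta> (\<eta> s))"
        unfolding C1_norm_def by (rule order.trans[OF _ SUP_upper[of x]]) (auto intro: ennreal_leI)
      also have "\<dots> \<le> ennreal (C0 * tnorm g \<theta> (\<eta> s))" by (rule C1[OF \<eta>[OF s]])
      finally have "norm (B \<theta> (\<eta> s) x) \<le> C0 * tnorm g \<theta> (\<eta> s)"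
        using C0 tnorm_nonneg(2)[OF \<eta>T[OF s]] by (simp add: ennreal_le_iff)
      also have "\<dots> \<le> C0 * (\<bar>L\<bar> * \<bar>s - t\<bar>)" using C0 len[OF s] by simp
      finally have "norm (b (\<eta> s c)) \<le> C0 * (\<bar>L\<bar> * \<bar>s - t\<bar>)"
        by (simp add: b_def coord_vec_eq[OF c \<eta>T[OF s]])
      then show ?case
        using elim by (simp add: linear_scale[OF \<open>linear b\<close>] divide_le_eq mult.assoc)
    qed
    ultimately have "norm (b (\<xi> c)) \<le> C0 * \<bar>L\<bar>"
      using Lim_norm_ubound[OF F] by blast
    moreover have "b (\<xi> c) = B (\<gamma> t) (velocity A \<gamma> t) x"
      using coord_vec_eq[OF c, of \<xi>] \<xi>T velocity_eq[OF \<xi> t] by (simp add: b_def \<theta>_def)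
    ultimately show ?thesis by simp
  qed
  then show ?thesis by blast
qed

end

section \<open>Analytic tools\<close>

text \<open>Away from \<open>t\<close> the error terms of the two formulations differ only by the
  sign of \<open>s - t\<close>, hence have equal norms.\<close>

lemma has_vector_derivative_iff_quotient:
  fixes f :: "real \<Rightarrow> 'b::real_normed_vector"
  shows "(f has_vector_derivative d) (at t within S) \<longleftrightarrow>
    ((\<lambda>s. (1 / (s - t)) *\<^sub>R (f s - f t)) \<longlongrightarrow> d) (at t within S)"
proof -
  have "(f has_vector_derivative d) (at t within S) \<longleftrightarrow>
      ((\<lambda>s. (1 / norm (s - t)) *\<^sub>R (f s - (f t + (s - t) *\<^sub>R d))) \<longlongrightarrow> 0) (at t within S)"
    by (simp add: has_vector_derivative_def has_derivative_within bounded_linear_scaleR_left)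
  also have "\<dots> \<longleftrightarrow> ((\<lambda>s. norm ((1 / norm (s - t)) *\<^sub>R (f s - (f t + (s - t) *\<^sub>R d)))) \<longlongrightarrow> 0) (at t within S)"
    by (simp only: tendsto_norm_zero_iff)
  also have "\<dots> \<longleftrightarrow> ((\<lambda>s. norm ((1 / (s - t)) *\<^sub>R (f s - f t) - d)) \<longlongrightarrow> 0) (at t within S)"
  proof (rule tendsto_cong)
    have "norm ((1 / norm (s - t)) *\<^sub>R (f s - (f t + (s - t) *\<^sub>R d)))
        = norm ((1 / (s - t)) *\<^sub>R (f s - f t) - d)" if "s \<noteq> t" for s
    proof -
      have "(1 / (s - t)) *\<^sub>R (f s - f t) - d = (1 / (s - t)) *\<^sub>R (f s - (f t + (s - t) *\<^sub>R d))"
        using that by (simp add: scaleR_diff_right scaleR_add_right)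
      then show ?thesis by simp
    qed
    then show "eventually (\<lambda>s. norm ((1 / norm (s - t)) *\<^sub>R (f s - (f t + (s - t) *\<^sub>R d)))
        = norm ((1 / (s - t)) *\<^sub>R (f s - f t) - d)) (at t within S)"
      by (auto simp: eventually_at_filter)
  qed
  also have "\<dots> \<longleftrightarrow> ((\<lambda>s. (1 / (s - t)) *\<^sub>R (f s - f t) - d) \<longlongrightarrow> 0) (at t within S)"
    by (simp only: tendsto_norm_zero_iff)
  also have "\<dots> \<longleftrightarrow> ((\<lambda>s. (1 / (s - t)) *\<^sub>R (f s - f t)) \<longlongrightarrow> d) (at t within S)"
    by (simp only: LIM_zero_iff)
  finally show ?thesis .
qed

lemma has_vector_derivative_forward_quotients:
  fixes f :: "real \<Rightarrow> 'b::real_normed_vector"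
  assumes "(f has_vector_derivative d) (at t within {a..b})" "a \<le> t" "t < b"
  shows "(\<lambda>n. real (Suc n) *\<^sub>R (f (t + 1 / real (Suc n)) - f t)) \<longlonglongrightarrow> d"
proof -
  have lim: "(\<lambda>n. t + 1 / real (Suc n)) \<longlonglongrightarrow> t"
    using tendsto_add[OF tendsto_const LIMSEQ_inverse_real_of_nat, of t] by (simp add: inverse_eq_divide)
  then have "eventually (\<lambda>n. t + 1 / real (Suc n) < b) sequentially"
    using assms(3) by (rule order_tendstoD)
  then have "filterlim (\<lambda>n. t + 1 / real (Suc n)) (at t within {a..b}) sequentially"
    unfolding filterlim_at using lim
    by (auto elim!: eventually_mono) (use assms(2) in \<open>smt (verit) divide_nonneg_nonneg of_nat_0_le_iff\<close>)
  with assms(1)[unfolded has_vector_derivative_iff_quotient]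
  have "(\<lambda>n. (1 / (t + 1 / real (Suc n) - t)) *\<^sub>R (f (t + 1 / real (Suc n)) - f t)) \<longlonglongrightarrow> d"
    by (rule filterlim_compose)
  then show ?thesis by simp
qed

lemma has_integral_set_lebesgue_integral:
  fixes f :: "real \<Rightarrow> 'b::euclidean_space"
  assumes "set_integrable lebesgue S f"
  shows "(f has_integral (LINT t:S|lebesgue. f t)) S"
  using set_lebesgue_integral_eq_integral[OF assms] by (simp add: has_integral_iff)

text \<open>The derivative of a Lipschitz function is the pointwise limit of bounded difference quotients,
  so the fundamental theorem of calculus follows by dominated convergence.\<close>

lemma lipschitz_fundamental_theorem:
  fixes f :: "real \<Rightarrow> 'b::euclidean_space"
  assumes lip: "L-lipschitz_on {a..b} f" and ab: "a \<le> b"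
    and der: "AE t in lebesgue. t \<in> {a..b} \<longrightarrow> (f has_vector_derivative f' t) (at t within {a..b})"
  shows "set_integrable lebesgue {a..b} f'" and "(f' has_integral (f b - f a)) {a..b}"
proof -
  \<comment> \<open>Constant continuation beyond the interval keeps the Lipschitz constant and gives
    a meaning to forward quotients at every time.\<close>
  define e where "e t = f (max a (min b t))" for t
  have L: "0 \<le> L" using lip by (rule lipschitz_on_nonneg)
  have elip: "norm (e s - e t) \<le> L * \<bar>s - t\<bar>" for s t
  proof -
    have "norm (e s - e t) \<le> L * \<bar>max a (min b s) - max a (min b t)\<bar>"
      using lipschitz_onD[OF lip, of "max a (min b s)" "max a (min b t)"] ab
      by (auto simp: e_def dist_norm)
    also have "\<dots> \<le> L * \<bar>s - t\<bar>" using L by (intro mult_left_mono) auto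
    finally show ?thesis .
  qed
  have "L-lipschitz_on UNIV e"
    using elip L by (intro lipschitz_onI) (auto simp: dist_norm)
  then have econt: "continuous_on X e" for X
    using lipschitz_on_continuous_on continuous_on_subset by blast
  have ef: "e t = f t" if "t \<in> {a..b}" for t using that by (simp add: e_def)
  define q where "q n t = real (Suc n) *\<^sub>R (e (t + 1 / real (Suc n)) - e t)" for n t
  have qbound: "norm (q n t) \<le> L" for n t
  proof -
    have "norm (q n t) \<le> real (Suc n) * (L * \<bar>1 / real (Suc n)\<bar>)"
      unfolding q_def norm_scaleR using elip[of "t + 1 / real (Suc n)" t]
      by (intro mult_mono) auto
    then show ?thesis by simp
  qed
  \<comment> \<open>An antiderivative on an interval longer by one, the largest step. It turns the
    integral of a difference quotient of \<open>e\<close> into difference quotients of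
    \<open>F\<close> at the two ends, and these converge to the values of \<open>e\<close>
    there.\<close>
  define F where "F u = integral {a..u} e" for u
  have F: "(F has_vector_derivative e t) (at t within {a..b + 1})" if "t \<in> {a..b + 1}" for t
    unfolding F_def by (intro integral_has_vector_derivative econt that)
  have qint: "(q n has_integral real (Suc n) *\<^sub>R (F (b + 1 / real (Suc n)) - F b)
      - real (Suc n) *\<^sub>R (F (a + 1 / real (Suc n)) - F a)) {a..b}" for n
  proof -
    define h where "h = 1 / real (Suc n)"
    have h: "0 \<le> h" "h \<le> 1" by (auto simp: h_def)
    have "((\<lambda>t. F (t + h) - F t) has_vector_derivative e (t + h) - e t) (at t within {a..b})"
      if t: "t \<in> {a..b}" for t
    proof (rule has_vector_derivative_diff)
      show "(F has_vector_derivative e t) (at t within {a..b})"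
        by (rule has_vector_derivative_within_subset[OF F]) (use t in auto)
      have "((\<lambda>t. t + h) has_vector_derivative 1) (at t within {a..b})"
        by (auto intro!: derivative_eq_intros)
      moreover have "(F has_vector_derivative e (t + h)) (at (t + h) within (\<lambda>t. t + h) ` {a..b})"
        by (rule has_vector_derivative_within_subset[OF F]) (use t h in auto)
      ultimately have "((F \<circ> (\<lambda>t. t + h)) has_vector_derivative 1 *\<^sub>R e (t + h)) (at t within {a..b})"
        by (rule vector_diff_chain_within)
      then show "((\<lambda>t. F (t + h)) has_vector_derivative e (t + h)) (at t within {a..b})"
        by (simp add: o_def)
    qed
    then have "((\<lambda>t. e (t + h) - e t) has_integral ((F (b + h) - F b) - (F (a + h) - F a))) {a..b}"
      by (rule fundamental_theorem_of_calculus[OF ab])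
    from has_integral_cmul[OF this, of "real (Suc n)"] show ?thesis
      by (simp add: q_def[abs_def] h_def scaleR_diff_right)
  qed
  obtain N0 where N0: "N0 \<in> null_sets lebesgue"
    "{t. \<not> (t \<in> {a..b} \<longrightarrow> (f has_vector_derivative f' t) (at t within {a..b}))} \<subseteq> N0"
    using der by (auto simp: eventually_ae_filter)
  \<comment> \<open>The end point \<open>b\<close> joins the exceptional set because forward steps
    from it leave the interval.\<close>
  define N where "N = insert b N0"
  have N: "negligible N" using N0 by (simp add: N_def negligible_iff_null_sets[symmetric])
  have qlim: "(\<lambda>n. q n t) \<longlonglongrightarrow> f' t" if t: "t \<in> {a..b} - N" for t
  proof -
    have d: "(f has_vector_derivative f' t) (at t within {a..b})" "t \<in> {a..b}" "t < b"
      using t N0 by (auto simp: N_def)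
    have "(e has_vector_derivative f' t) (at t within {a..b})"
      by (rule has_vector_derivative_transform[OF d(2) _ d(1)]) (simp add: ef)
    from has_vector_derivative_forward_quotients[OF this] d show ?thesis by (simp add: q_def)
  qed
  \<comment> \<open>Quotients and limit are set to zero on \<open>N\<close>, so that convergence
    holds at every point, as the dominated convergence theorem for this integral demands.\<close>
  define q0 where "q0 n t = (if t \<in> N then 0 else q n t)" for n t
  define f0 where "f0 t = (if t \<in> N then 0 else f' t)" for t
  have ylim: "(\<lambda>n. real (Suc n) *\<^sub>R (F (b + 1 / real (Suc n)) - F b)
      - real (Suc n) *\<^sub>R (F (a + 1 / real (Suc n)) - F a)) \<longlonglongrightarrow> f b - f a"
    using has_vector_derivative_forward_quotients[OF F[of b]]
      has_vector_derivative_forward_quotients[OF F[of a]] ab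
    by (intro tendsto_diff) (auto simp: ef)
  have q0int: "(q0 n has_integral real (Suc n) *\<^sub>R (F (b + 1 / real (Suc n)) - F b)
      - real (Suc n) *\<^sub>R (F (a + 1 / real (Suc n)) - F a)) {a..b}" for n
    by (rule has_integral_spike[OF N _ qint]) (simp add: q0_def)
  have "(f0 has_integral (f b - f a)) {a..b}"
  proof (rule has_integral_dominated_convergence[OF q0int _ _ _ ylim])
    show "(\<lambda>t. L) integrable_on {a..b}" by (rule integrable_const_ivl)
    show "\<forall>x\<in>{a..b}. norm (q0 k x) \<le> L" for k using qbound L by (auto simp: q0_def)
    show "\<forall>t\<in>{a..b}. (\<lambda>k. q0 k t) \<longlonglongrightarrow> f0 t" using qlim by (auto simp: q0_def f0_def)
  qed
  moreover then have "f0 absolutely_integrable_on {a..b}"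
  proof (intro absolutely_integrable_integrable_bound[where g = "\<lambda>_. L"])
    fix t assume t: "t \<in> {a..b}"
    show "norm (f0 t) \<le> L"
    proof (cases "t \<in> N")
      case False
      with Lim_norm_ubound[OF _ qlim, of t L] t qbound show ?thesis by (auto simp: f0_def)
    qed (use L in \<open>simp add: f0_def\<close>)
  qed (auto intro: integrable_const_ivl)
  moreover have "f' t = f0 t" if "t \<in> {a..b} - N" for t using that by (simp add: f0_def)
  ultimately show "set_integrable lebesgue {a..b} f'" "(f' has_integral (f b - f a)) {a..b}"
    using N by (blast intro: absolutely_integrable_spike has_integral_spike)+
qed

text \<open>A mean value inequality for a derivative that exists only almost everywhere: it is
  integrated over the interval between the two times.\<close>

lemma lipschitz_AE_derivative_bound:
  fixes f :: "real \<Rightarrow> 'b::euclidean_space"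
  assumes lip: "L-lipschitz_on {a..b} f"
    and der: "AE t in lebesgue. t \<in> {a..b} \<longrightarrow> (f has_vector_derivative f' t) (at t within {a..b})"
    and bound: "\<And>t. t \<in> {a..b} \<Longrightarrow> norm (f' t) \<le> C"
    and st: "s \<in> {a..b}" "t \<in> {a..b}"
  shows "norm (f s - f t) \<le> C * \<bar>s - t\<bar>"
proof -
  have *: "norm (f t - f s) \<le> C * (t - s)" if st: "s \<in> {a..b}" "t \<in> {a..b}" "s \<le> t" for s t
  proof -
    have sub: "{s..t} \<subseteq> {a..b}" using st by auto
    have "(f' has_integral (f t - f s)) {s..t}"
    proof (rule lipschitz_fundamental_theorem(2)[OF lipschitz_on_subset[OF lip sub] st(3)])
      show "AE r in lebesgue. r \<in> {s..t} \<longrightarrow> (f has_vector_derivative f' r) (at r within {s..t})"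
        using der by eventually_elim (use sub in \<open>blast intro: has_vector_derivative_within_subset\<close>)
    qed
    moreover have "0 \<le> C" using bound[OF st(1)] norm_ge_zero order_trans by blast
    ultimately show ?thesis
      using has_integral_bound[of C f' "f t - f s" s t] bound sub st by auto
  qed
  show ?thesis
    using *[of s t] *[of t s] st by (cases "s \<le> t") (auto simp: norm_minus_commute)
qed

text \<open>For a non-measurable \<open>f\<close>, the junk value of \<^const>\<open>distr\<close> is a null measure.\<close>

lemma measurable_of_prob_space_distr:
  assumes p: "prob_space (distr M N f)" and f: "f \<in> space M \<rightarrow> space N"
  shows "f \<in> measurable M N"
proof (rule measurableI)
  show "\<And>x. x \<in> space M \<Longrightarrow> f x \<in> space N" using f by auto
  let ?m = "\<lambda>A. emeasure M (f -` A \<inter> space M)"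
  \<comment> \<open>By definition the measure of the push-forward is \<open>?m\<close> if that is a
    measure on \<open>N\<close>, and zero otherwise.\<close>
  define ok where "ok \<longleftrightarrow> measure_space (space N) (sets N) ?m"
  have e: "emeasure (distr M N f) A = (if ok then ?m A else 0)" if "A \<in> sets N" for A
    unfolding distr_def emeasure_measure_of_conv ok_def
    using that sets.sigma_sets_eq[of N] by auto
  fix A assume A: "A \<in> sets N"
  show "f -` A \<inter> space M \<in> sets M"
  proof (rule ccontr)
    \<comment> \<open>Sets that are not measurable have \<open>emeasure\<close> zero. Since the
      preimage of the complement of \<open>A\<close> is not measurable either, both parts of
      \<open>N\<close> would be null and the total mass could not be one.\<close>
    assume n: "f -` A \<inter> space M \<notin> sets M"
    have "f -` (space N - A) \<inter> space M \<notin> sets M"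
    proof
      assume "f -` (space N - A) \<inter> space M \<in> sets M"
      then have "space M - (f -` (space N - A) \<inter> space M) \<in> sets M" by blast
      moreover have "space M - (f -` (space N - A) \<inter> space M) = f -` A \<inter> space M" using f by auto
      ultimately show False using n by simp
    qed
    then have "?m A = 0" "?m (space N - A) = 0" using n by (auto intro: emeasure_notin_sets)
    then have "emeasure (distr M N f) A = 0" "emeasure (distr M N f) (space N - A) = 0"
      using A by (auto simp: e)
    then have "emeasure (distr M N f) (space N) = 0"
      using emeasure_subadditive[of A "distr M N f" "space N - A"] A sets.sets_into_space[OF A]
      by (simp add: Un_absorb1)
    with prob_space.emeasure_space_1[OF p] show False by simp
  qed
qed

text \<open>For each pair of precisions and each function from a finite net into a countable dense set, one
  member of the family is chosen that is approximated by it, if there is any.\<close>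

lemma countable_uniformly_dense_subfamily:
  fixes \<F> :: "('a::euclidean_space \<Rightarrow> 'b::euclidean_space) set"
  assumes K: "compact K" and cont: "\<And>f. f \<in> \<F> \<Longrightarrow> continuous_on K f"
  shows "\<exists>\<G>. countable \<G> \<and> \<G> \<subseteq> \<F> \<and> (\<forall>f\<in>\<F>. \<forall>e>0. \<exists>h\<in>\<G>. \<forall>x\<in>K. norm (f x - h x) < e)"
proof -
  obtain Q :: "'b set" where Q: "countable Q" "closure Q = UNIV"
    using separable[of "UNIV :: 'b set"] by (metis top.extremum_uniqueI)
  have "\<exists>T. finite T \<and> T \<subseteq> K \<and> K \<subseteq> (\<Union>x\<in>T. ball x (1 / real (Suc n)))" for n
    using seq_compact_imp_totally_bounded[OF compact_imp_seq_compact[OF K]]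
    by (metis of_nat_0_less_iff zero_less_Suc zero_less_divide_1_iff)
  then obtain T where T: "\<And>n. finite (T n)" "\<And>n. T n \<subseteq> K"
    "\<And>n. K \<subseteq> (\<Union>x\<in>T n. ball x (1 / real (Suc n)))" by metis
  define I where "I = (SIGMA n:(UNIV :: nat set). (UNIV :: nat set) \<times> (T n \<rightarrow>\<^sub>E Q))"
  define fits :: "nat \<times> nat \<times> ('a \<Rightarrow> 'b) \<Rightarrow> ('a \<Rightarrow> 'b) \<Rightarrow> bool" where "fits = (\<lambda>(n, m, q) f. \<forall>y\<in>T n. \<forall>x\<in>K \<inter> ball y (1 / real (Suc n)).
    norm (f x - q y) < 1 / real (Suc m))"
  define \<G> where "\<G> = (\<lambda>i. SOME f. f \<in> \<F> \<and> fits i f) ` {i \<in> I. \<exists>f\<in>\<F>. fits i f}"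
  have "countable I"
    unfolding I_def using T(1) Q(1) by (intro countable_SIGMA countable_PiE) auto
  then have "countable \<G>" unfolding \<G>_def by (intro countable_image) simp
  moreover have choice: "(SOME f. f \<in> \<F> \<and> fits i f) \<in> \<F> \<and> fits i (SOME f. f \<in> \<F> \<and> fits i f)"
    if "\<exists>f\<in>\<F>. fits i f" for i
    using that someI_ex[of "\<lambda>f. f \<in> \<F> \<and> fits i f"] by blast
  then have "\<G> \<subseteq> \<F>" unfolding \<G>_def by blast
  moreover have "\<exists>h\<in>\<G>. \<forall>x\<in>K. norm (f x - h x) < e" if f: "f \<in> \<F>" and e: "e > 0" for f e
  proof -
    \<comment> \<open>Both \<open>f\<close> and its substitute \<open>h\<close> will be within
      \<open>1 / (m + 1)\<close> of the same values \<open>q\<close>, hence the first halving. The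
      second one, in \<open>d\<close>, splits that error into the oscillation of \<open>f\<close> on
      a net ball and the rounding of its value into \<open>Q\<close>.\<close>
    obtain m where m: "1 / real (Suc m) < e / 2"
      using e nat_approx_posE[of "e / 2"] by auto
    define d where "d = 1 / real (Suc m) / 2"
    have d: "d > 0" by (simp add: d_def)
    obtain r where r: "r > 0" "\<And>x y. x \<in> K \<Longrightarrow> y \<in> K \<Longrightarrow> dist y x < r \<Longrightarrow> dist (f y) (f x) < d"
      using compact_uniformly_continuous[OF cont[OF f] K] d unfolding uniformly_continuous_on_def by metis
    obtain n where n: "1 / real (Suc n) < r" using r(1) nat_approx_posE by blast
    have "\<exists>z\<in>Q. dist z (f y) < d" for y
      using Q(2) d closure_approachable by (metis UNIV_I)
    then obtain q where q: "\<And>y. q y \<in> Q" "\<And>y. dist (q y) (f y) < d" by metis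
    define i where "i = (n, m, restrict q (T n))"
    have i: "i \<in> I" unfolding i_def I_def using q(1) by auto
    have fit: "fits i f"
      unfolding fits_def i_def
    proof (clarsimp)
      fix y x assume y: "y \<in> T n" and x: "x \<in> K" "dist y x < 1 / (1 + real n)"
      have "dist (f x) (q y) \<le> dist (f x) (f y) + dist (f y) (q y)" by (rule dist_triangle)
      also have "\<dots> < d + d" using r(2)[of y x] q(2)[of y] x y T(2)[of n] n
        by (intro add_strict_mono) (auto simp: dist_commute)
      finally show "norm (f x - q y) < 1 / (1 + real m)"
        unfolding d_def dist_norm by (simp only: field_sum_of_halves of_nat_Suc)
    qed
    define h where "h = (SOME f. f \<in> \<F> \<and> fits i f)"
    have h: "h \<in> \<G>" "fits i h"
      using choice[of i] fit f i unfolding h_def \<G>_def by auto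
    have "norm (f x - h x) < e" if x: "x \<in> K" for x
    proof -
      obtain y where y: "y \<in> T n" "x \<in> ball y (1 / real (Suc n))" using T(3)[of n] x by auto
      have "norm (f x - q y) < 1 / real (Suc m)" "norm (h x - q y) < 1 / real (Suc m)"
        using fit h(2) x y unfolding fits_def i_def by auto
      then show ?thesis using m norm_triangle_ineq4[of "f x - q y" "h x - q y"] by auto
    qed
    then show ?thesis using h(1) by blast
  qed
  ultimately show ?thesis by blast
qed

text \<open>Open half-lines are an intersection-stable generator of the Borel sets, so the integral
  vanishes over all Borel sets by a Dynkin argument; \<open>total\<close> carries the step to
  complements. Uniqueness of densities then compares \<open>G\<close> with zero.\<close>

lemma AE_zero_of_initial_integrals:
  fixes G :: "real \<Rightarrow> real"
  assumes G: "integrable lborel G" and zero: "\<And>s. (LINT t:{..<s}|lborel. G t) = 0"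
    and total: "(LINT t|lborel. G t) = 0"
  shows "AE t in lborel. G t = 0"
proof -
  have "(LINT t:A|lborel. G t) = 0" if "A \<in> sets borel" for A
  proof -
    have Gset: "set_integrable lborel X G" if "X \<in> sets borel" for X
      unfolding set_integrable_def using that by (intro integrable_mult_indicator G) auto
    have "Int_stable (range (lessThan :: real \<Rightarrow> real set))"
    proof -
    have "{..<a} \<inter> {..<b} = {..<min a b}" for a b :: real by auto
    then show ?thesis by (auto simp: Int_stable_def)
  qed
    moreover have "range lessThan \<subseteq> Pow (UNIV :: real set)" by simp
    moreover have "A \<in> sigma_sets UNIV (range lessThan)"
      using that unfolding borel_Iio by (simp add: sets_measure_of)
    ultimately show ?thesis
    proof (induction rule: sigma_sets_induct_disjoint)
      case (compl X)
      then have X: "X \<in> sets borel" unfolding borel_Iio by (simp add: sets_measure_of)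
      have "(LINT t:X \<union> (UNIV - X)|lborel. G t) = (LINT t:X|lborel. G t) + (LINT t:UNIV - X|lborel. G t)"
        by (rule set_integral_Un) (use X Gset in auto)
      moreover have "X \<union> (UNIV - X) = UNIV" by auto
      ultimately show ?case using compl total by (simp add: set_lebesgue_integral_def)
    next
      case (union X)
      then have X: "X i \<in> sets borel" for i unfolding borel_Iio by (auto simp: sets_measure_of)
      have "(LINT t:(\<Union>i. X i)|lborel. G t) = (\<Sum>i. LINT t:X i|lborel. G t)"
        using X union(1) Gset by (intro lebesgue_integral_countable_add) (auto simp: disjoint_family_on_def)
      then show ?case using union by simp
    qed (use zero in \<open>auto simp: set_lebesgue_integral_def\<close>)
  qed
  then show ?thesis
    using density_unique_real[OF G, of "\<lambda>_. 0"] by (auto simp: set_lebesgue_integral_def)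
qed

text \<open>The functions \<open>1 - exp (- n (max 0 (s - t))\<^sup>2)\<close> are of class \<open>C\<^sup>1\<close> and increase to the
  indicator of \<open>{..<s}\<close>.\<close>

lemma AE_zero_of_C1_tests:
  fixes G :: "real \<Rightarrow> real"
  assumes G: "set_integrable lebesgue {0..1} G"
    and test: "\<And>a a'. (\<And>t. (a has_real_derivative a' t) (at t)) \<Longrightarrow> continuous_on UNIV a' \<Longrightarrow>
      (LINT t:{0..1}|lebesgue. a t * G t) = 0"
  shows "AE t in lebesgue. t \<in> {0..1} \<longrightarrow> G t = 0"
proof -
  define G0 where "G0 t = indicator {0..1} t * G t" for t
  have G0: "integrable lebesgue G0" using G by (simp add: G0_def[abs_def] set_integrable_def)
  have test0: "(LINT t|lebesgue. a t * G0 t) = 0"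
    if "\<And>t. (a has_real_derivative a' t) (at t)" "continuous_on UNIV a'" for a a'
  proof -
    have "(\<lambda>t. a t * G0 t) = (\<lambda>t. indicator {0..1} t *\<^sub>R (a t * G t))" by (auto simp: G0_def)
    then show ?thesis using test[OF that] by (simp only: set_lebesgue_integral_def)
  qed
  define a where "a s n t = 1 - exp (- (real n * (max 0 (s - t))\<^sup>2))" for s :: real and n and t :: real
  define a' where "a' s n t = - (exp (- (real n * (max 0 (s - t))\<^sup>2)) * (2 * real n * max 0 (s - t)))"
    for s :: real and n and t :: real
  \<comment> \<open>Squaring smooths the kink at \<open>s\<close>: the quotient there is at most
    \<open>\<bar>h\<bar>\<close>, and on either side the function is locally a polynomial.\<close>
  have sq: "((\<lambda>t. (max 0 (s - t))\<^sup>2) has_real_derivative - (2 * max 0 (s - t))) (at t)" for s t :: real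
  proof (cases "t = s")
    case True
    have "((\<lambda>h. ((max 0 (s - (s + h)))\<^sup>2 - (max 0 (s - s))\<^sup>2) / h) \<longlongrightarrow> 0) (at 0)"
    proof (rule Lim_null_comparison)
      have "norm (((max 0 (s - (s + h)))\<^sup>2 - (max 0 (s - s))\<^sup>2) / h) \<le> \<bar>h\<bar>" for h :: real
        by (auto simp: max_def power2_eq_square divide_simps abs_if)
      then show "eventually (\<lambda>h. norm (((max 0 (s - (s + h)))\<^sup>2 - (max 0 (s - s))\<^sup>2) / h) \<le> \<bar>h\<bar>) (at 0)"
        by simp
      show "((\<lambda>h::real. \<bar>h\<bar>) \<longlongrightarrow> 0) (at 0)" by (rule tendsto_eq_intros refl | simp)+
    qed
    then show ?thesis using True by (simp add: DERIV_def)
  next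
    case False
    show ?thesis
    proof (cases "t < s")
      case True
      have "((\<lambda>t. (s - t)\<^sup>2) has_real_derivative - (2 * max 0 (s - t))) (at t)"
        using True by (auto intro!: derivative_eq_intros)
      then show ?thesis
        by (rule DERIV_cong_ev[THEN iffD1, rotated -1])
          (use True in \<open>auto intro!: eventually_mono[OF eventually_nhds_in_open[of "{..<s}"]]\<close>)
    next
      case False
      with \<open>t \<noteq> s\<close> have ts: "t > s" by simp
      have "((\<lambda>t. 0) has_real_derivative - (2 * max 0 (s - t))) (at t)"
        using ts by (auto intro!: derivative_eq_intros)
      then show ?thesis
        by (rule DERIV_cong_ev[THEN iffD1, rotated -1])
          (use ts in \<open>auto intro!: eventually_mono[OF eventually_nhds_in_open[of "{s<..}"]]\<close>)
    qed
  qed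
  have da: "(a s n has_real_derivative a' s n t) (at t)" for s n t
    unfolding a_def[abs_def] a'_def by (rule derivative_eq_intros sq refl | simp)+
  have ca': "continuous_on UNIV (a' s n)" for s n
    unfolding a'_def[abs_def] by (intro continuous_intros)
  have ca: "continuous_on UNIV (a s n)" for s n
    unfolding a_def[abs_def] by (intro continuous_intros)
  have ia: "(LINT t|lebesgue. a s n t * G0 t) = 0" for s n by (rule test0[OF da ca'])
  have lim: "(\<lambda>n. a s n t) \<longlonglongrightarrow> indicator {..<s} t" for s t
  proof (cases "t < s")
    case True
    have "filterlim (\<lambda>n. (max 0 (s - t))\<^sup>2 * real n) at_top sequentially"
      by (rule filterlim_tendsto_pos_mult_at_top[OF tendsto_const _ filterlim_real_sequentially])
        (use True in simp)
    then have "filterlim (\<lambda>n. - (real n * (max 0 (s - t))\<^sup>2)) at_bot sequentially"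
      by (simp add: filterlim_uminus_at_top mult.commute)
    then have "(\<lambda>n. exp (- (real n * (max 0 (s - t))\<^sup>2))) \<longlonglongrightarrow> 0"
      by (rule filterlim_compose[OF exp_at_bot])
    from tendsto_diff[OF tendsto_const[of 1] this] show ?thesis using True by (simp add: a_def)
  qed (simp add: a_def)
  have zero: "(LINT t|lebesgue. indicator {..<s} t * G0 t) = 0" for s
  proof -
    have "(\<lambda>n. LINT t|lebesgue. a s n t * G0 t) \<longlonglongrightarrow> (LINT t|lebesgue. indicator {..<s} t * G0 t)"
    proof (rule integral_dominated_convergence[where w = "\<lambda>t. \<bar>G0 t\<bar>"])
      have [measurable]: "G0 \<in> borel_measurable lebesgue" using G0 by simp
      have [measurable]: "a s n \<in> borel_measurable lebesgue" for n
        using borel_measurable_continuous_onI[OF ca] by (intro measurable_completion) simp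
      show "(\<lambda>t. a s n t * G0 t) \<in> borel_measurable lebesgue" for n by measurable
      show "(\<lambda>t. indicator {..<s} t * G0 t) \<in> borel_measurable lebesgue"
        by (intro borel_measurable_times borel_measurable_indicator) auto
      show "integrable lebesgue (\<lambda>t. \<bar>G0 t\<bar>)" using G0 by (rule integrable_abs)
      have "\<bar>a s n t\<bar> \<le> 1" for n t by (simp add: a_def)
      then show "AE t in lebesgue. norm (a s n t * G0 t) \<le> \<bar>G0 t\<bar>" for n
        by (auto simp: abs_mult intro!: AE_I2 mult_left_le_one_le)
      show "AE t in lebesgue. (\<lambda>n. a s n t * G0 t) \<longlonglongrightarrow> indicator {..<s} t * G0 t"
        by (intro AE_I2 tendsto_mult lim tendsto_const)
    qed
    then show ?thesis by (simp add: ia LIMSEQ_const_iff)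
  qed
  \<comment> \<open>\<open>G0\<close> is only Lebesgue measurable, while the uniqueness argument
    runs over Borel sets; it is therefore applied to a Borel version.\<close>
  obtain H where H: "H \<in> borel_measurable lborel" and GH: "AE t in lborel. G0 t = H t"
    using completion_ex_borel_measurable_real[of G0 lborel] G0 by auto
  have GH': "AE t in lebesgue. G0 t = H t" using GH by (rule AE_completion)
  have Hleb: "integrable lebesgue H"
    using G0 by (rule integrable_cong_AE_imp) (use H GH' in \<open>auto intro: measurable_completion elim: eventually_mono\<close>)
  then have Hint: "integrable lborel H" using H by (simp add: integrable_completion)
  have "(LINT t:{..<s}|lborel. H t) = 0" for s
  proof -
    have "(LINT t:{..<s}|lborel. H t) = (LINT t|lebesgue. indicator {..<s} t * H t)"
      unfolding set_lebesgue_integral_def using H by (subst integral_completion) auto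
    also have "\<dots> = (LINT t|lebesgue. indicator {..<s} t * G0 t)"
    proof (rule integral_cong_AE)
      show "(\<lambda>t. indicator {..<s} t * H t) \<in> borel_measurable lebesgue"
        "(\<lambda>t. indicator {..<s} t * G0 t) \<in> borel_measurable lebesgue"
        using G0 Hleb by (auto intro!: borel_measurable_times borel_measurable_indicator)
      show "AE t in lebesgue. indicator {..<s} t * H t = indicator {..<s} t * G0 t"
        using GH' by eventually_elim simp
    qed
    finally show ?thesis using zero by simp
  qed
  moreover have "(LINT t|lborel. H t) = 0"
  proof -
    have "(LINT t|lborel. H t) = (LINT t|lebesgue. H t)"
      using H by (subst integral_completion) auto
    \<comment> \<open>The constant function 1 is itself an admissible test.\<close>
    also have "\<dots> = (LINT t|lebesgue. 1 * G0 t)"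
      using G0 Hleb GH' by (intro integral_cong_AE) (auto elim: eventually_mono)
    also have "\<dots> = 0" by (rule test0[where a' = "\<lambda>_. 0"]) auto
    finally show ?thesis .
  qed
  ultimately have "AE t in lborel. H t = 0" by (rule AE_zero_of_initial_integrals[OF Hint])
  then have "AE t in lebesgue. H t = 0" by (rule AE_completion)
  with GH' show ?thesis by eventually_elim (auto simp: G0_def)
qed

lemma has_vector_derivative_LIMSEQ_quotient:
  fixes f :: "real \<Rightarrow> 'b::real_normed_vector"
  assumes "(f has_vector_derivative d) (at t within S)"
    and "\<And>n. X n \<in> S" "\<And>n. X n \<noteq> t" "X \<longlonglongrightarrow> t"
  shows "(\<lambda>n. (1 / (X n - t)) *\<^sub>R (f (X n) - f t)) \<longlonglongrightarrow> d"
proof -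
  have "filterlim X (at t within S) sequentially" unfolding filterlim_at using assms by simp
  with assms(1)[unfolded has_vector_derivative_iff_quotient] show ?thesis by (rule filterlim_compose)
qed

lemma continuous_on_compact_norm_bound:
  assumes "compact K" "continuous_on K f"
  obtains b where "0 \<le> b" "\<And>x. x \<in> K \<Longrightarrow> norm (f x :: 'b::real_normed_vector) \<le> b"
proof -
  obtain b where "\<forall>y\<in>f ` K. norm y \<le> b"
    using compact_imp_bounded[OF compact_continuous_image[OF assms(2,1)]] unfolding bounded_iff by blast
  then show thesis by (intro that[of "\<bar>b\<bar>"]) force+
qed

text \<open>Derivatives are taken within \<open>{0..1} \<times> \<Omega>\<close>. Convexity of this
  set makes the mean value inequality available, and compactness bounds both partial
  derivatives.\<close>

lemma C1_test_lipschitz: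
  fixes \<Omega> :: "'a::euclidean_space set"
  assumes "compact \<Omega>" "convex \<Omega>" "C1_test \<Omega> \<psi> \<psi>t \<psi>x"
  shows "\<exists>K\<ge>0. \<forall>s\<in>{0..1}. \<forall>t\<in>{0..1}. \<forall>x\<in>\<Omega>. \<forall>y\<in>\<Omega>.
    \<bar>\<psi> s x - \<psi> t y\<bar> \<le> K * (\<bar>s - t\<bar> + norm (x - y))"
proof -
  define Z where "Z = {0..1::real} \<times> \<Omega>"
  have Z: "compact Z" "convex Z" unfolding Z_def using assms by (auto intro: compact_Times convex_Times)
  have c: "continuous_on Z (\<lambda>(t, x). \<psi>t t x)" "continuous_on Z (\<lambda>(t, x). \<psi>x t x)"
    and d: "\<And>t x. (t, x) \<in> Z \<Longrightarrow>
      ((\<lambda>(s, y). \<psi> s y) has_derivative (\<lambda>(r, h). r * \<psi>t t x + \<psi>x t x \<bullet> h)) (at (t, x) within Z)"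
    using assms(3) by (auto simp: C1_test_def Z_def)
  obtain a where a: "0 \<le> a" "\<And>z. z \<in> Z \<Longrightarrow> norm ((\<lambda>(t, x). \<psi>t t x) z) \<le> a"
    using continuous_on_compact_norm_bound[OF Z(1) c(1)] by blast
  obtain b where b: "0 \<le> b" "\<And>z. z \<in> Z \<Longrightarrow> norm ((\<lambda>(t, x). \<psi>x t x) z) \<le> b"
    using continuous_on_compact_norm_bound[OF Z(1) c(2)] by blast
  define K where "K = a + b"
  have bound: "norm ((\<lambda>(s, y). \<psi> s y) z - (\<lambda>(s, y). \<psi> s y) z') \<le> K * norm (z - z')"
    if z: "z \<in> Z" "z' \<in> Z" for z z'
  proof (rule differentiable_bound[OF Z(2), where f' = "\<lambda>(t, x) (r, h). r * \<psi>t t x + \<psi>x t x \<bullet> h"])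
    fix p assume p: "p \<in> Z"
    show "((\<lambda>(s, y). \<psi> s y) has_derivative (case p of (t, x) \<Rightarrow> \<lambda>(r, h). r * \<psi>t t x + \<psi>x t x \<bullet> h)) (at p within Z)"
      using d[of "fst p" "snd p"] p by (simp add: case_prod_beta)
    show "onorm (case p of (t, x) \<Rightarrow> \<lambda>(r, h). r * \<psi>t t x + \<psi>x t x \<bullet> h) \<le> K"
    proof (rule onorm_le)
      fix q :: "real \<times> 'a"
      obtain t x r h where pq: "p = (t, x)" "q = (r, h)" by (metis surj_pair)
      have "norm (r * \<psi>t t x + \<psi>x t x \<bullet> h) \<le> \<bar>r\<bar> * \<bar>\<psi>t t x\<bar> + norm (\<psi>x t x) * norm h"
        using Cauchy_Schwarz_ineq2[of "\<psi>x t x" h] by (simp add: abs_mult abs_triangle_ineq[THEN order_trans])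
      also have "\<dots> \<le> norm q * a + b * norm q"
        using a(1) b(1) a(2)[OF p] b(2)[OF p] norm_fst_le[of r h] norm_snd_le[of h r] pq
        by (intro add_mono mult_mono) auto
      finally show "norm ((case p of (t, x) \<Rightarrow> \<lambda>(r, h). r * \<psi>t t x + \<psi>x t x \<bullet> h) q) \<le> K * norm q"
        by (simp add: pq K_def algebra_simps)
    qed
  qed (use z in auto)
  have "\<bar>\<psi> s x - \<psi> t y\<bar> \<le> K * (\<bar>s - t\<bar> + norm (x - y))"
    if "s \<in> {0..1}" "t \<in> {0..1}" "x \<in> \<Omega>" "y \<in> \<Omega>" for s t x y
  proof -
    have "\<bar>\<psi> s x - \<psi> t y\<bar> \<le> K * norm ((s, x) - (t, y))"
      using bound[of "(s, x)" "(t, y)"] that by (simp add: Z_def)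
    also have "\<dots> \<le> K * (\<bar>s - t\<bar> + norm (x - y))"
      using norm_Pair_le[of "s - t" "x - y"] a(1) b(1) by (intro mult_left_mono) (auto simp: K_def)
    finally show ?thesis .
  qed
  moreover have "K \<ge> 0" using a(1) b(1) by (simp add: K_def)
  ultimately show ?thesis by blast
qed

section \<open>Measures transported by a bounded gradient field\<close>

text \<open>This is what remains of a curve on the manifold, with \<open>E (\<gamma> t)\<close> as
  \<open>\<mu> t\<close>, once charts and metric are forgotten. The field is continuous in space at
  each time, nothing is said about its dependence on time, and the flow is described on points of
  \<open>\<Omega>\<close> only.\<close>

locale transported_measures =
  fixes \<Omega> :: "'a::euclidean_space set" and \<mu> :: "real \<Rightarrow> 'a measure"
    and v \<phi> :: "real \<Rightarrow> 'a \<Rightarrow> 'a" and C :: real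
  assumes compact: "compact \<Omega>" and convex: "convex \<Omega>"
    and prob: "\<And>t. t \<in> {0..1} \<Longrightarrow> \<mu> t \<in> prob_measures \<Omega>"
    and v_cont: "\<And>t. t \<in> {0..1} \<Longrightarrow> continuous_on UNIV (v t)"
    and v_grad: "\<And>t. t \<in> {0..1} \<Longrightarrow> gradient_field (v t)"
    and v_bound: "\<And>t x. t \<in> {0..1} \<Longrightarrow> norm (v t x) \<le> C"
    and flow: "flow_of \<Omega> v \<phi>"
    and push: "\<And>t. t \<in> {0..1} \<Longrightarrow> \<mu> t = distr (restrict_space (\<mu> 0) \<Omega>) borel (\<phi> t)"
begin

text \<open>The probability space of trajectories, indexed by their starting points. Integrals with
  respect to any \<open>\<mu> t\<close> are pulled back to it, so that the measure no longer moves
  with time.\<close>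

definition P where "P = restrict_space (\<mu> 0) \<Omega>"

lemma C_nonneg: "0 \<le> C"
  using order_trans[OF norm_ge_zero v_bound[of 0 undefined]] by simp

lemma \<Omega>_borel [measurable]: "\<Omega> \<in> sets borel"
  using compact by (intro borel_closed compact_imp_closed)

lemma \<mu>_facts:
  assumes "t \<in> {0..1}"
  shows "prob_space (\<mu> t)" "sets (\<mu> t) = sets borel" "AE x in \<mu> t. x \<in> \<Omega>"
proof -
  show "prob_space (\<mu> t)" "sets (\<mu> t) = sets borel" using prob[OF assms] by (auto simp: prob_measures_def)
  then show "AE x in \<mu> t. x \<in> \<Omega>"
    using prob[OF assms] by (intro AE_I[of _ _ "- \<Omega>"]) (auto simp: prob_measures_def)
qed

lemma measurable_\<mu>: "t \<in> {0..1} \<Longrightarrow> measurable (\<mu> t) N = measurable borel N"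
  by (rule measurable_cong_sets) (auto simp: \<mu>_facts)

lemma prob_P: "prob_space P"
proof -
  interpret prob_space "\<mu> 0" using \<mu>_facts(1)[of 0] by simp
  have "AE x in \<mu> 0. x \<in> \<Omega>" using \<mu>_facts(3)[of 0] by simp
  then have "emeasure (\<mu> 0) \<Omega> = 1"
    using emeasure_eq_1_AE[of \<Omega>] \<mu>_facts(2)[of 0] by simp
  then show ?thesis unfolding P_def
    by (intro prob_space_restrict_space) (simp_all add: \<mu>_facts(2)[of 0])
qed

lemma space_P: "space P = \<Omega>"
  unfolding P_def using sets_eq_imp_space_eq[OF \<mu>_facts(2)[of 0]] by (simp add: space_restrict_space)

text \<open>Measurability in space is not part of \<open>flow_of\<close>. It is forced by the
  push-forward having total mass one.\<close>

lemma flow_measurable [measurable]: "t \<in> {0..1} \<Longrightarrow> \<phi> t \<in> measurable P borel"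
  using \<mu>_facts(1)[of t] push[of t] by (intro measurable_of_prob_space_distr) (auto simp: P_def)

lemma push': "t \<in> {0..1} \<Longrightarrow> \<mu> t = distr P borel (\<phi> t)"
  unfolding P_def by (rule push)

lemma flow_derivative:
  "AE t in lebesgue. t \<in> {0..1} \<longrightarrow>
     (\<forall>x\<in>\<Omega>. ((\<lambda>s. \<phi> s x) has_vector_derivative v t (\<phi> t x)) (at t within {0..1}))"
  using flow by (simp add: flow_of_def)

text \<open>The Lipschitz constants in \<open>flow_of\<close> may depend on the trajectory; the
  bound on the field replaces them by a common one.\<close>

lemma flow_lipschitz:
  assumes "x \<in> \<Omega>" "s \<in> {0..1}" "t \<in> {0..1}"
  shows "norm (\<phi> s x - \<phi> t x) \<le> C * \<bar>s - t\<bar>"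
proof -
  obtain L where L: "L-lipschitz_on {0..1} (\<lambda>t. \<phi> t x)"
    using flow assms(1) by (auto simp: flow_of_def)
  show ?thesis
    by (rule lipschitz_AE_derivative_bound[OF L, of "\<lambda>t. v t (\<phi> t x)"])
      (use flow_derivative v_bound assms in \<open>auto elim!: eventually_mono\<close>)
qed

lemma flow_continuous: "x \<in> \<Omega> \<Longrightarrow> continuous_on {0..1} (\<lambda>t. \<phi> t x)"
  using flow by (auto simp: flow_of_def intro: lipschitz_on_continuous_on)

text \<open>As \<open>\<mu> t\<close> is concentrated on \<open>\<Omega>\<close>, almost every
  trajectory is in \<open>\<Omega>\<close> at time \<open>t\<close>. A countable dense set of times
  allows one exceptional set for all of them, and closedness of \<open>\<Omega>\<close> with
  continuity of the trajectories covers the remaining times.\<close>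

lemma flow_stays: "AE x in P. \<forall>t\<in>{0..1}. \<phi> t x \<in> \<Omega>"
proof -
  obtain T where T: "countable T" "T \<subseteq> {0..1::real}" "{0..1} \<subseteq> closure T"
    using separable[of "{0..1::real}"] by metis
  have "AE x in P. \<phi> t x \<in> \<Omega>" if t: "t \<in> T" for t
  proof -
    have tt: "t \<in> {0..1}" using t T by auto
    have "AE x in distr P borel (\<phi> t). x \<in> \<Omega>" using \<mu>_facts(3)[OF tt] unfolding push'[OF tt] .
    then show ?thesis by (rule AE_distrD[OF flow_measurable[OF tt]])
  qed
  then have "AE x in P. \<forall>t\<in>T. \<phi> t x \<in> \<Omega>" by (intro AE_ball_countable' T(1))
  moreover have "AE x in P. x \<in> \<Omega>" by (rule AE_I2) (simp add: space_P)
  ultimately show ?thesis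
  proof eventually_elim
    case (elim x)
    have "closure T \<subseteq> {0..1}" using T(2) by (intro closure_minimal) auto
    then have "(\<lambda>t. \<phi> t x) ` closure T \<subseteq> \<Omega>"
      using elim by (intro image_closure_subset compact_imp_closed compact)
        (auto intro: continuous_on_subset[OF flow_continuous])
    then show ?case using T(3) by blast
  qed
qed

section \<open>Integrals along the flow and the continuity equation\<close>

lemma integral_\<mu>:
  assumes t: "t \<in> {0..1}" and f: "f \<in> borel_measurable borel"
  shows "(LINT x|\<mu> t. f x) = (LINT x|P. f (\<phi> t x) :: 'b::{banach, second_countable_topology})"
  unfolding push'[OF t] by (rule integral_distr[OF flow_measurable[OF t] f])

lemma indicator_measurable:
  "continuous_on \<Omega> f \<Longrightarrow> (\<lambda>x. indicator \<Omega> x *\<^sub>R f x :: 'b::real_normed_vector) \<in> borel_measurable borel"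
  by (intro borel_measurable_continuous_on_indicator) auto

lemma set_integrable_continuous:
  fixes f :: "'a \<Rightarrow> 'b::{banach, second_countable_topology}"
  assumes t: "t \<in> {0..1}" and f: "continuous_on \<Omega> f"
  shows "set_integrable (\<mu> t) \<Omega> f"
proof -
  interpret prob_space "\<mu> t" using \<mu>_facts(1)[OF t] .
  obtain b where b: "0 \<le> b" "\<And>x. x \<in> \<Omega> \<Longrightarrow> norm (f x) \<le> b"
    using continuous_on_compact_norm_bound[OF compact f] by blast
  show ?thesis unfolding set_integrable_def
    by (rule integrable_const_bound[where B = b])
      (use b indicator_measurable[OF f] in \<open>auto simp: measurable_\<mu>[OF t] indicator_def intro!: AE_I2\<close>)
qed

lemma continuous_section:
  assumes "continuous_on ({0..1} \<times> \<Omega>) (\<lambda>(t, x). f t x)" "t \<in> {0..1}"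
  shows "continuous_on \<Omega> (f t)"
proof -
  have "continuous_on \<Omega> (\<lambda>x. (\<lambda>(t, x). f t x) (t, x))"
    by (rule continuous_on_compose2[OF assms(1)]) (use assms(2) in \<open>auto intro!: continuous_intros\<close>)
  then show ?thesis by simp
qed

lemma integral_\<Omega>:
  assumes t: "t \<in> {0..1}" and f: "continuous_on \<Omega> f"
  shows "(LINT x:\<Omega>|\<mu> t. f x) =
    (LINT x|P. indicator \<Omega> (\<phi> t x) *\<^sub>R f (\<phi> t x) :: 'b::{banach, second_countable_topology})"
  unfolding set_lebesgue_integral_def by (rule integral_\<mu>[OF t indicator_measurable[OF f]])

text \<open>Dominated convergence on the space of trajectories. This provides integrability of the
  term with the time derivative in the continuity equation.\<close>

lemma integral_continuous_in_time:
  fixes f :: "real \<Rightarrow> 'a \<Rightarrow> 'b::euclidean_space"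
  assumes f: "continuous_on ({0..1} \<times> \<Omega>) (\<lambda>(t, x). f t x)"
  shows "continuous_on {0..1} (\<lambda>t. LINT x:\<Omega>|\<mu> t. f t x)"
  unfolding continuous_on_sequentially
proof (intro allI ballI impI, elim conjE)
  fix X t assume X: "\<forall>n. X n \<in> {0..1::real}" "X \<longlonglongrightarrow> t" and t: "t \<in> {0..1}"
  interpret prob_space P by (rule prob_P)
  obtain b where b: "0 \<le> b" "\<And>z. z \<in> {0..1} \<times> \<Omega> \<Longrightarrow> norm ((\<lambda>(t, x). f t x) z) \<le> b"
    using continuous_on_compact_norm_bound[OF compact_Times[OF compact_Icc compact] f] by blast
  let ?g = "\<lambda>t x. indicator \<Omega> (\<phi> t x) *\<^sub>R f t (\<phi> t x)"
  have m: "?g t \<in> borel_measurable P" if "t \<in> {0..1}" for t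
    using measurable_compose[OF flow_measurable[OF that] indicator_measurable[OF continuous_section[OF f that]]] .
  have "(\<lambda>n. LINT x|P. ?g (X n) x) \<longlonglongrightarrow> (LINT x|P. ?g t x)"
  proof (rule integral_dominated_convergence[where w = "\<lambda>_. b"])
    show "AE x in P. norm (?g (X n) x) \<le> b" for n
      using b(1) b(2)[of "(X n, \<phi> (X n) y)" for y] X(1) by (intro AE_I2) (simp add: indicator_def)
    show "AE x in P. (\<lambda>n. ?g (X n) x) \<longlonglongrightarrow> ?g t x"
      using flow_stays AE_space
    proof eventually_elim
      case (elim x)
      then have x: "x \<in> \<Omega>" by (simp add: space_P)
      have "continuous_on {0..1} (\<lambda>t. (\<lambda>(t, x). f t x) (t, \<phi> t x))"
        using elim x by (intro continuous_on_compose2[OF f] continuous_intros flow_continuous) auto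
      then have "(\<lambda>n. f (X n) (\<phi> (X n) x)) \<longlonglongrightarrow> f t (\<phi> t x)"
        using X t unfolding continuous_on_sequentially by (auto simp: o_def)
      then show ?case using elim X t by simp
    qed
  qed (use m X(1) t in auto)
  then show "((\<lambda>t. LINT x:\<Omega>|\<mu> t. f t x) \<circ> X) \<longlonglongrightarrow> (LINT x:\<Omega>|\<mu> t. f t x)"
    using X(1) t continuous_section[OF f] by (simp add: o_def integral_\<Omega>)
qed

text \<open>The exceptional times of the flow equation do not depend on the trajectory. At any other
  time the difference quotients along almost all trajectories converge and have a common bound, so
  differentiation passes under the integral.\<close>

lemma transport_derivative:
  assumes test: "C1_test \<Omega> \<psi> \<psi>t \<psi>x"
  defines "F \<equiv> \<lambda>t. LINT x:\<Omega>|\<mu> t. \<psi> t x"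
  shows "\<exists>K. K-lipschitz_on {0..1} F"
    and "AE t in lebesgue. t \<in> {0..1} \<longrightarrow>
      (F has_vector_derivative (LINT x:\<Omega>|\<mu> t. \<psi>t t x + \<psi>x t x \<bullet> v t x)) (at t within {0..1})"
proof -
  interpret prob_space P by (rule prob_P)
  have ct: "continuous_on ({0..1} \<times> \<Omega>) (\<lambda>(t, x). \<psi>t t x)"
    and cx: "continuous_on ({0..1} \<times> \<Omega>) (\<lambda>(t, x). \<psi>x t x)"
    and d: "\<And>t x. t \<in> {0..1} \<Longrightarrow> x \<in> \<Omega> \<Longrightarrow>
      ((\<lambda>(s, y). \<psi> s y) has_derivative (\<lambda>(r, h). r * \<psi>t t x + \<psi>x t x \<bullet> h)) (at (t, x) within {0..1} \<times> \<Omega>)"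
    using test by (auto simp: C1_test_def)
  have c: "continuous_on ({0..1} \<times> \<Omega>) (\<lambda>(t, x). \<psi> t x)"
    unfolding continuous_on_eq_continuous_within using d has_derivative_continuous by fast
  obtain K where K: "K \<ge> 0" "\<And>s t x y. s \<in> {0..1} \<Longrightarrow> t \<in> {0..1} \<Longrightarrow> x \<in> \<Omega> \<Longrightarrow> y \<in> \<Omega> \<Longrightarrow>
      \<bar>\<psi> s x - \<psi> t y\<bar> \<le> K * (\<bar>s - t\<bar> + norm (x - y))"
    using C1_test_lipschitz[OF compact convex test] by blast
  define h where "h t x = indicator \<Omega> (\<phi> t x) *\<^sub>R \<psi> t (\<phi> t x)" for t x
  \<comment> \<open>\<open>K\<close> is the Lipschitz constant of the test function in time and
    space, and trajectories have speed at most \<open>C\<close>.\<close>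
  define K' where "K' = K * (1 + C)"
  have F: "F t = (LINT x|P. h t x)" if "t \<in> {0..1}" for t
    unfolding F_def h_def by (rule integral_\<Omega>[OF that continuous_section[OF c that]])
  have hm: "h t \<in> borel_measurable P" if "t \<in> {0..1}" for t
    using measurable_compose[OF flow_measurable[OF that] indicator_measurable[OF continuous_section[OF c that]]]
    by (simp add: h_def[abs_def])
  obtain b where b: "0 \<le> b" "\<And>z. z \<in> {0..1} \<times> \<Omega> \<Longrightarrow> norm ((\<lambda>(t, x). \<psi> t x) z) \<le> b"
    using continuous_on_compact_norm_bound[OF compact_Times[OF compact_Icc compact] c] by blast
  have hint: "integrable P (h t)" if "t \<in> {0..1}" for t
    by (rule integrable_const_bound[where B = b])
      (use hm that b(1) b(2)[of "(t, \<phi> t y)" for y] in \<open>auto simp: h_def indicator_def intro!: AE_I2\<close>)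
  have hlip: "AE x in P. \<forall>s\<in>{0..1}. \<forall>t\<in>{0..1}. \<bar>h s x - h t x\<bar> \<le> K' * \<bar>s - t\<bar>"
    using flow_stays AE_space
  proof eventually_elim
    case (elim x)
    then have x: "x \<in> \<Omega>" by (simp add: space_P)
    have "\<bar>h s x - h t x\<bar> \<le> K' * \<bar>s - t\<bar>" if "s \<in> {0..1}" "t \<in> {0..1}" for s t
    proof -
      have "\<bar>h s x - h t x\<bar> \<le> K * (\<bar>s - t\<bar> + norm (\<phi> s x - \<phi> t x))"
        using K(2)[OF that, of "\<phi> s x" "\<phi> t x"] elim that by (simp add: h_def)
      also have "\<dots> \<le> K * (\<bar>s - t\<bar> + C * \<bar>s - t\<bar>)"
        using flow_lipschitz[OF x that] K(1) by (intro mult_left_mono add_left_mono)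
      finally show ?thesis by (simp add: K'_def algebra_simps)
    qed
    then show ?case by blast
  qed
  have Flip: "\<bar>F s - F t\<bar> \<le> K' * \<bar>s - t\<bar>" if "s \<in> {0..1}" "t \<in> {0..1}" for s t
  proof -
    have "F s - F t = (LINT x|P. h s x - h t x)" using that hint by (simp add: F)
    also have "\<bar>\<dots>\<bar> \<le> (LINT x|P. \<bar>h s x - h t x\<bar>)"
      using integral_norm_bound[of P "\<lambda>x. h s x - h t x"] by simp
    also have "\<dots> \<le> (LINT x|P. K' * \<bar>s - t\<bar>)"
      using hlip that hint by (intro integral_mono_AE) (auto elim!: eventually_mono)
    also have "\<dots> = K' * \<bar>s - t\<bar>" by (simp add: prob_space)
    finally show ?thesis .
  qed
  then show "\<exists>K. K-lipschitz_on {0..1} F"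
    using K(1) C_nonneg by (intro exI[of _ K'] lipschitz_onI) (auto simp: dist_real_def K'_def)
  show "AE t in lebesgue. t \<in> {0..1} \<longrightarrow>
      (F has_vector_derivative (LINT x:\<Omega>|\<mu> t. \<psi>t t x + \<psi>x t x \<bullet> v t x)) (at t within {0..1})"
    using flow_derivative
  proof eventually_elim
    case (elim t)
    show ?case
    proof
      assume t: "t \<in> {0..1}"
      let ?d = "\<lambda>y. \<psi>t t y + \<psi>x t y \<bullet> v t y"
      have dcont: "continuous_on \<Omega> ?d"
        using continuous_section[OF ct t] continuous_section[OF cx t] continuous_on_subset[OF v_cont[OF t]]
        by (intro continuous_intros) auto
      let ?D = "\<lambda>x. indicator \<Omega> (\<phi> t x) *\<^sub>R ?d (\<phi> t x)"
      have Dm: "?D \<in> borel_measurable P"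
        using measurable_compose[OF flow_measurable[OF t] indicator_measurable[OF dcont]] .
      have hder: "((\<lambda>s. h s x) has_vector_derivative ?D x) (at t within {0..1})"
        if x: "x \<in> \<Omega>" and stays: "\<forall>s\<in>{0..1}. \<phi> s x \<in> \<Omega>" for x
      proof -
        have "((\<lambda>s. \<phi> s x) has_vector_derivative v t (\<phi> t x)) (at t within {0..1})"
          using elim t x by blast
        \<comment> \<open>The graph of the trajectory stays in
          \<open>{0..1} \<times> \<Omega>\<close>, the set relative to which the test function is
          differentiable, so the chain rule applies along it.\<close>
        then have "((\<lambda>s. (s, \<phi> s x)) has_vector_derivative (1, v t (\<phi> t x))) (at t within {0..1})"
          by (intro has_vector_derivative_Pair has_vector_derivative_id)
        moreover have "((\<lambda>(s, y). \<psi> s y) has_derivative (\<lambda>(r, h). r * \<psi>t t (\<phi> t x) + \<psi>x t (\<phi> t x) \<bullet> h))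
            (at (t, \<phi> t x) within (\<lambda>s. (s, \<phi> s x)) ` {0..1})"
          using stays t by (intro has_derivative_subset[OF d]) auto
        ultimately have "((\<lambda>(s, y). \<psi> s y) \<circ> (\<lambda>s. (s, \<phi> s x)) has_vector_derivative
            (\<lambda>(r, h). r * \<psi>t t (\<phi> t x) + \<psi>x t (\<phi> t x) \<bullet> h) (1, v t (\<phi> t x))) (at t within {0..1})"
          by (rule vector_derivative_diff_chain_within)
        then have "((\<lambda>s. \<psi> s (\<phi> s x)) has_vector_derivative ?d (\<phi> t x)) (at t within {0..1})"
          by (simp add: o_def)
        then have "((\<lambda>s. h s x) has_vector_derivative ?d (\<phi> t x)) (at t within {0..1})"
          by (rule has_vector_derivative_transform[OF t, rotated]) (use stays in \<open>simp add: h_def\<close>)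
        then show ?thesis using stays t by simp
      qed
      have "((\<lambda>s. (1 / (s - t)) *\<^sub>R (F s - F t)) \<longlongrightarrow> (LINT x:\<Omega>|\<mu> t. ?d x)) (at t within {0..1})"
        unfolding tendsto_at_iff_sequentially
      proof (intro allI impI)
        fix X assume "\<forall>i. X i \<in> {0..1} - {t}" and Xt: "X \<longlonglongrightarrow> t"
        then have X: "X n \<in> {0..1}" "X n \<noteq> t" for n by auto
        have "(\<lambda>n. LINT x|P. (1 / (X n - t)) *\<^sub>R (h (X n) x - h t x)) \<longlonglongrightarrow> (LINT x|P. ?D x)"
        proof (rule integral_dominated_convergence[where w = "\<lambda>_. K'"])
          show "AE x in P. norm ((1 / (X n - t)) *\<^sub>R (h (X n) x - h t x)) \<le> K'" for n
            using hlip
          proof eventually_elim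
            case (elim x)
            then have "\<bar>h (X n) x - h t x\<bar> \<le> K' * \<bar>X n - t\<bar>" using X t by blast
            then show ?case using X(2)[of n] by (simp add: divide_le_eq)
          qed
          show "AE x in P. (\<lambda>n. (1 / (X n - t)) *\<^sub>R (h (X n) x - h t x)) \<longlonglongrightarrow> ?D x"
            using flow_stays AE_space
            by eventually_elim
              (rule has_vector_derivative_LIMSEQ_quotient[OF hder _ _ Xt], use X in \<open>auto simp: space_P\<close>)
        qed (use Dm hm X t in auto)
        then show "((\<lambda>s. (1 / (s - t)) *\<^sub>R (F s - F t)) \<circ> X) \<longlonglongrightarrow> (LINT x:\<Omega>|\<mu> t. ?d x)"
          using X t hint by (simp add: o_def F integral_\<Omega>[OF t dcont])
      qed
      then show "(F has_vector_derivative (LINT x:\<Omega>|\<mu> t. ?d x)) (at t within {0..1})"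
        by (simp add: has_vector_derivative_iff_quotient)
    qed
  qed
qed

text \<open>The derivative just computed is integrated in time. Since \<open>v\<close> may depend on
  time in a wild way, integrability of its term is obtained indirectly: the full derivative is
  integrable as a limit of quotients, and the other summand is continuous in time.\<close>

lemma continuity_equation:
  assumes test: "C1_test \<Omega> \<psi> \<psi>t \<psi>x"
  shows "set_integrable lebesgue {0..1} (\<lambda>t. LINT x:\<Omega>|\<mu> t. \<psi>x t x \<bullet> v t x)" (is ?int)
    and "(LINT t:{0..1}|lebesgue. LINT x:\<Omega>|\<mu> t. \<psi>t t x)
      + (LINT t:{0..1}|lebesgue. LINT x:\<Omega>|\<mu> t. \<psi>x t x \<bullet> v t x)
      = (LINT x:\<Omega>|\<mu> 1. \<psi> 1 x) - (LINT x:\<Omega>|\<mu> 0. \<psi> 0 x)" (is ?id)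
proof -
  have ct: "continuous_on ({0..1} \<times> \<Omega>) (\<lambda>(t, x). \<psi>t t x)"
    and cx: "continuous_on ({0..1} \<times> \<Omega>) (\<lambda>(t, x). \<psi>x t x)"
    using test by (auto simp: C1_test_def)
  let ?A = "\<lambda>t. LINT x:\<Omega>|\<mu> t. \<psi>t t x" and ?B = "\<lambda>t. LINT x:\<Omega>|\<mu> t. \<psi>x t x \<bullet> v t x"
  have split: "(LINT x:\<Omega>|\<mu> t. \<psi>t t x + \<psi>x t x \<bullet> v t x) = ?A t + ?B t" if t: "t \<in> {0..1}" for t
    by (intro set_integral_add set_integrable_continuous t continuous_section[OF ct t] continuous_intros
        continuous_section[OF cx t] continuous_on_subset[OF v_cont[OF t]]) auto
  obtain K where K: "K-lipschitz_on {0..1} (\<lambda>t. LINT x:\<Omega>|\<mu> t. \<psi> t x)"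
    using transport_derivative(1)[OF test] by blast
  note ftc = lipschitz_fundamental_theorem[OF K zero_le_one transport_derivative(2)[OF test]]
  have AB: "set_integrable lebesgue {0..1} (\<lambda>t. ?A t + ?B t)"
    using ftc(1) by (rule set_integrable_cong[THEN iffD1, rotated -1]) (auto simp: split)
  have A: "set_integrable lebesgue {0..1} ?A"
    using absolutely_integrable_continuous_real[OF integral_continuous_in_time[OF ct]] .
  from set_integral_diff(1)[OF AB A] show B: ?int by simp
  have "(LINT t:{0..1}|lebesgue. ?A t) + (LINT t:{0..1}|lebesgue. ?B t) = (LINT t:{0..1}|lebesgue. ?A t + ?B t)"
    by (rule set_integral_add(2)[OF A B, symmetric])
  also have "((\<lambda>t. ?A t + ?B t) has_integral (LINT t:{0..1}|lebesgue. ?A t + ?B t)) {0..1}"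
    by (rule has_integral_set_lebesgue_integral[OF AB])
  then have "(LINT t:{0..1}|lebesgue. ?A t + ?B t) = (LINT x:\<Omega>|\<mu> 1. \<psi> 1 x) - (LINT x:\<Omega>|\<mu> 0. \<psi> 0 x)"
    by (rule has_integral_unique[OF has_integral_eq[rotated, OF _]]) (use ftc(2) in \<open>auto simp: split intro: has_integral_eq\<close>)
  finally show ?id .
qed

end

section \<open>Square integrability, parametric integrals and supports\<close>

lemma integrable_inner_L2:
  fixes f h :: "'a \<Rightarrow> 'b::euclidean_space"
  assumes "f \<in> borel_measurable M" "h \<in> borel_measurable M"
    and "integrable M (\<lambda>x. (norm (f x))\<^sup>2)" "integrable M (\<lambda>x. (norm (h x))\<^sup>2)"
  shows "integrable M (\<lambda>x. f x \<bullet> h x)"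
proof (rule Bochner_Integration.integrable_bound[OF Bochner_Integration.integrable_add[OF assms(3,4)]])
  show "(\<lambda>x. f x \<bullet> h x) \<in> borel_measurable M" using assms(1,2) by (rule borel_measurable_inner)
  have "\<bar>f x \<bullet> h x\<bar> \<le> (norm (f x))\<^sup>2 + (norm (h x))\<^sup>2" for x
  proof -
    have "\<bar>f x \<bullet> h x\<bar> \<le> norm (f x) * norm (h x)" by (rule Cauchy_Schwarz_ineq2)
    moreover have "2 * norm (f x) * norm (h x) \<le> (norm (f x))\<^sup>2 + (norm (h x))\<^sup>2"
      by (rule sum_squares_bound)
    moreover have "0 \<le> norm (f x) * norm (h x)" by simp
    ultimately show ?thesis by linarith
  qed
  then show "AE x in M. norm (f x \<bullet> h x) \<le> norm ((norm (f x))\<^sup>2 + (norm (h x))\<^sup>2)"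
    by (intro AE_I2) simp
qed

lemma continuous_parametric_integral:
  fixes q :: "'p::metric_space \<Rightarrow> 'a \<Rightarrow> 'b::euclidean_space"
  assumes "finite_measure M" and "\<And>p. q p \<in> borel_measurable M"
    and "\<And>x. x \<in> space M \<Longrightarrow> continuous_on UNIV (\<lambda>p. q p x)"
    and "\<And>p x. x \<in> space M \<Longrightarrow> norm (q p x) \<le> b"
  shows "continuous_on UNIV (\<lambda>p. LINT x|M. q p x)"
  unfolding continuous_on_sequentially
proof (intro allI ballI impI, elim conjE)
  fix X and p :: 'p assume X: "X \<longlonglongrightarrow> p"
  have "(\<lambda>n. LINT x|M. q (X n) x) \<longlonglongrightarrow> (LINT x|M. q p x)"
  proof (rule integral_dominated_convergence[where w = "\<lambda>_. b"])
    show "AE x in M. (\<lambda>n. q (X n) x) \<longlonglongrightarrow> q p x"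
      using assms(3) X unfolding continuous_on_sequentially by (auto simp: o_def)
  qed (use assms(1,2,4) in \<open>auto simp: finite_measure.integrable_const\<close>)
  then show "((\<lambda>p. LINT x|M. q p x) \<circ> X) \<longlonglongrightarrow> (LINT x|M. q p x)" by (simp add: o_def)
qed

text \<open>The points that violate the condition are covered by the null sets of a countable
  basis.\<close>

lemma AE_in_support:
  fixes \<nu> :: "'a::{metric_space, second_countable_topology} measure"
  assumes "sets \<nu> = sets borel"
  shows "AE x in \<nu>. \<forall>r>0. 0 < emeasure \<nu> (ball x r)"
proof -
  obtain \<B> :: "'a set set" where \<B>: "countable \<B>" "topological_basis \<B>"
    using ex_countable_basis by auto
  let ?N = "\<Union>U\<in>{U \<in> \<B>. emeasure \<nu> U = 0}. U"
  have o: "open U" if "U \<in> \<B>" for U using topological_basis_open[OF \<B>(2) that] .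
  have "?N \<in> null_sets \<nu>"
    by (rule null_sets_UN') (use \<B>(1) o assms in \<open>auto simp: null_sets_def\<close>)
  moreover have "{x \<in> space \<nu>. \<not> (\<forall>r>0. 0 < emeasure \<nu> (ball x r))} \<subseteq> ?N"
  proof
    fix x assume "x \<in> {x \<in> space \<nu>. \<not> (\<forall>r>0. 0 < emeasure \<nu> (ball x r))}"
    then obtain r where r: "(0::real) < r" "\<not> 0 < emeasure \<nu> (ball x r)" by blast
    obtain U where U: "U \<in> \<B>" "x \<in> U" "U \<subseteq> ball x r"
      using topological_basisE[OF \<B>(2), of "ball x r" x] r(1) by auto
    have "emeasure \<nu> U \<le> emeasure \<nu> (ball x r)"
      using U assms by (intro emeasure_mono) auto
    then show "x \<in> ?N" using U r by (auto simp: not_less)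
  qed
  ultimately show ?thesis by (intro AE_I'[of ?N])
qed

context transported_measures
begin

section \<open>Competitors tested against gradients\<close>

lemma gradient_test:
  assumes \<psi>: "\<And>x. (\<psi> has_derivative (\<lambda>h. f x \<bullet> h)) (at x)" and f: "continuous_on UNIV f"
    and a: "\<And>t. (a has_real_derivative a' t) (at t)" and a': "continuous_on UNIV a'"
  shows "C1_test \<Omega> (\<lambda>t x. a t * \<psi> x) (\<lambda>t x. a' t * \<psi> x) (\<lambda>t x. a t *\<^sub>R f x)"
proof -
  have c\<psi>: "continuous_on X \<psi>" for X
    using has_derivative_continuous[OF \<psi>] by (intro continuous_at_imp_continuous_on) auto
  have ca: "continuous_on X a" for X
    using DERIV_isCont[OF a] by (intro continuous_at_imp_continuous_on) auto
  have cf: "continuous_on X f" and ca': "continuous_on Y a'" for X Y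
    using f a' by (auto intro: continuous_on_subset)
  have "((\<lambda>p. a (fst p) * \<psi> (snd p)) has_derivative
      (\<lambda>p. a t * (f x \<bullet> snd p) + (a' t * fst p) * \<psi> x)) (at (t, x) within {0..1} \<times> \<Omega>)" for t x
  proof -
    have d1: "((\<lambda>p. a (fst p)) has_derivative (\<lambda>p. a' t * fst p)) (at (t, x) within {0..1} \<times> \<Omega>)"
      using a[of t, unfolded has_field_derivative_def]
      by (intro has_derivative_compose[OF has_derivative_fst[OF has_derivative_ident]]) simp
    have d2: "((\<lambda>p. \<psi> (snd p)) has_derivative (\<lambda>p. f x \<bullet> snd p)) (at (t, x) within {0..1} \<times> \<Omega>)"
      using \<psi>[of x]
      by (intro has_derivative_compose[OF has_derivative_snd[OF has_derivative_ident]]) simp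
    from has_derivative_mult[OF d1 d2] show ?thesis by simp
  qed
  then have "((\<lambda>(s, y). a s * \<psi> y) has_derivative (\<lambda>(r, h). r * (a' t * \<psi> x) + (a t *\<^sub>R f x) \<bullet> h))
      (at (t, x) within {0..1} \<times> \<Omega>)" for t x
    by (simp add: case_prod_beta' algebra_simps)
  then show ?thesis unfolding C1_test_def case_prod_beta'
    by (auto intro!: continuous_intros continuous_on_compose2[OF ca'] continuous_on_compose2[OF ca]
        continuous_on_compose2[OF c\<psi>] continuous_on_compose2[OF cf])
qed

text \<open>Time sections of a jointly measurable field are measurable. Cutting them off outside
  \<open>\<Omega>\<close> gives Borel functions on the whole space, for which squared norms are
  ordinary real integrals.\<close>

lemma CE_D:
  assumes w: "w \<in> CE \<Omega> \<mu>" and t: "t \<in> {0..1}"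
  shows "(\<lambda>x. indicator \<Omega> x *\<^sub>R w t x) \<in> borel_measurable borel"
    and "integrable (\<mu> t) (\<lambda>x. (norm (indicator \<Omega> x *\<^sub>R w t x))\<^sup>2)"
    and "L2_normsq \<Omega> (\<mu> t) (w t) = ennreal (LINT x|\<mu> t. (norm (indicator \<Omega> x *\<^sub>R w t x))\<^sup>2)"
proof -
  have "(\<lambda>(t, x). w t x) \<in> borel_measurable (restrict_space borel ({0..1} \<times> \<Omega>))"
    using w by (simp add: CE_def)
  moreover have "(\<lambda>x. (t, x)) \<in> measurable (restrict_space borel \<Omega>) (restrict_space borel ({0..1} \<times> \<Omega>))"
    by (rule measurable_restrict_space3) (use t in \<open>auto intro!: borel_measurable_continuous_onI continuous_intros\<close>)
  ultimately have "(\<lambda>x. case (t, x) of (t, x) \<Rightarrow> w t x) \<in> borel_measurable (restrict_space borel \<Omega>)"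
    by (rule measurable_compose[rotated])
  then have "w t \<in> borel_measurable (restrict_space borel \<Omega>)" by simp
  then show m: "(\<lambda>x. indicator \<Omega> x *\<^sub>R w t x) \<in> borel_measurable borel"
    by (subst (asm) borel_measurable_restrict_space_iff) auto
  then have m': "(\<lambda>x. (norm (indicator \<Omega> x *\<^sub>R w t x))\<^sup>2) \<in> borel_measurable (\<mu> t)"
    unfolding measurable_\<mu>[OF t] by (intro borel_measurable_power measurable_compose[OF _ borel_measurable_norm])
  have eq: "L2_normsq \<Omega> (\<mu> t) (w t) = (\<integral>\<^sup>+x. ennreal ((norm (indicator \<Omega> x *\<^sub>R w t x))\<^sup>2) \<partial>\<mu> t)"
    unfolding L2_normsq_def by (intro nn_integral_cong) (auto simp: indicator_def)
  have "L2_normsq \<Omega> (\<mu> t) (w t) < \<infinity>" using w t by (simp add: CE_def)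
  then show i: "integrable (\<mu> t) (\<lambda>x. (norm (indicator \<Omega> x *\<^sub>R w t x))\<^sup>2)"
    using m' by (intro integrableI_bounded) (auto simp: eq)
  then show "L2_normsq \<Omega> (\<mu> t) (w t) = ennreal (LINT x|\<mu> t. (norm (indicator \<Omega> x *\<^sub>R w t x))\<^sup>2)"
    unfolding eq by (intro nn_integral_eq_integral) auto
qed

lemma continuous_L2:
  fixes f :: "'a \<Rightarrow> 'a"
  assumes t: "t \<in> {0..1}" and f: "continuous_on \<Omega> f"
  shows "(\<lambda>x. indicator \<Omega> x *\<^sub>R f x) \<in> borel_measurable borel"
    and "integrable (\<mu> t) (\<lambda>x. (norm (indicator \<Omega> x *\<^sub>R f x))\<^sup>2)"
    and "L2_normsq \<Omega> (\<mu> t) f = ennreal (LINT x|\<mu> t. (norm (indicator \<Omega> x *\<^sub>R f x))\<^sup>2)"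
proof -
  show "(\<lambda>x. indicator \<Omega> x *\<^sub>R f x) \<in> borel_measurable borel" by (rule indicator_measurable[OF f])
  have "set_integrable (\<mu> t) \<Omega> (\<lambda>x. (norm (f x))\<^sup>2)"
    by (intro set_integrable_continuous t continuous_intros f)
  moreover have sq: "(\<lambda>x. indicator \<Omega> x *\<^sub>R (norm (f x))\<^sup>2) = (\<lambda>x. (norm (indicator \<Omega> x *\<^sub>R f x))\<^sup>2)"
    by (auto simp: indicator_def)
  ultimately show i: "integrable (\<mu> t) (\<lambda>x. (norm (indicator \<Omega> x *\<^sub>R f x))\<^sup>2)"
    by (simp only: set_integrable_def)
  have "L2_normsq \<Omega> (\<mu> t) f = (\<integral>\<^sup>+x. ennreal ((norm (indicator \<Omega> x *\<^sub>R f x))\<^sup>2) \<partial>\<mu> t)"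
    unfolding L2_normsq_def by (intro nn_integral_cong) (auto simp: indicator_def)
  then show "L2_normsq \<Omega> (\<mu> t) f = ennreal (LINT x|\<mu> t. (norm (indicator \<Omega> x *\<^sub>R f x))\<^sup>2)"
    using i by (simp add: nn_integral_eq_integral)
qed

lemma set_integral_inner:
  "(LINT x:\<Omega>|\<mu> t. f x \<bullet> h x) = (LINT x|\<mu> t. (indicator \<Omega> x *\<^sub>R f x) \<bullet> (indicator \<Omega> x *\<^sub>R h x))"
  unfolding set_lebesgue_integral_def
  by (intro Bochner_Integration.integral_cong) (auto simp: indicator_def)

text \<open>Both \<open>w\<close> and \<open>v\<close> solve the continuity equation for the same
  measures. With a test function \<open>a t * \<psi> x\<close> all other terms agree, and as
  \<open>a\<close> is arbitrary the spatial integrals agree at almost every time.\<close>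

lemma CE_gradient_tests:
  assumes w: "w \<in> CE \<Omega> \<mu>" and grad: "gradient_field f" and f: "continuous_on UNIV f"
  shows "AE t in lebesgue. t \<in> {0..1} \<longrightarrow> (LINT x:\<Omega>|\<mu> t. f x \<bullet> w t x) - (LINT x:\<Omega>|\<mu> t. f x \<bullet> v t x) = 0"
proof -
  obtain \<psi> where \<psi>: "\<And>x. (\<psi> has_derivative (\<lambda>h. f x \<bullet> h)) (at x)"
    using grad by (auto simp: gradient_field_def)
  let ?W = "\<lambda>t. LINT x:\<Omega>|\<mu> t. f x \<bullet> w t x" and ?V = "\<lambda>t. LINT x:\<Omega>|\<mu> t. f x \<bullet> v t x"
  have tests: "set_integrable lebesgue {0..1} (\<lambda>t. a t * ?W t)"
    "set_integrable lebesgue {0..1} (\<lambda>t. a t * ?V t)"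
    "(LINT t:{0..1}|lebesgue. a t * ?W t) = (LINT t:{0..1}|lebesgue. a t * ?V t)"
    if a: "\<And>t. (a has_real_derivative a' t) (at t)" "continuous_on UNIV a'" for a a'
  proof -
    note test = gradient_test[OF \<psi> f a]
    have W: "set_integrable lebesgue {0..1} (\<lambda>t. LINT x:\<Omega>|\<mu> t. (a t *\<^sub>R f x) \<bullet> w t x)"
      "(LINT t:{0..1}|lebesgue. LINT x:\<Omega>|\<mu> t. a' t * \<psi> x)
        + (LINT t:{0..1}|lebesgue. LINT x:\<Omega>|\<mu> t. (a t *\<^sub>R f x) \<bullet> w t x)
        = (LINT x:\<Omega>|\<mu> 1. a 1 * \<psi> x) - (LINT x:\<Omega>|\<mu> 0. a 0 * \<psi> x)"
      using w test unfolding CE_def by blast+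
    note V = continuity_equation[OF test]
    show "set_integrable lebesgue {0..1} (\<lambda>t. a t * ?W t)" "set_integrable lebesgue {0..1} (\<lambda>t. a t * ?V t)"
      "(LINT t:{0..1}|lebesgue. a t * ?W t) = (LINT t:{0..1}|lebesgue. a t * ?V t)"
      using W V by (simp_all add: set_integral_mult_right)
  qed
  \<comment> \<open>The factor \<open>a = 1\<close> extracts integrability in time of the spatial
    integrals themselves.\<close>
  have one: "((\<lambda>t. 1) has_real_derivative (\<lambda>t. 0) t) (at t)" for t :: real by simp
  have WV: "set_integrable lebesgue {0..1} ?W" "set_integrable lebesgue {0..1} ?V"
    using tests(1,2)[OF one] by simp_all
  show ?thesis
  proof (rule AE_zero_of_C1_tests)
    show "set_integrable lebesgue {0..1} (\<lambda>t. ?W t - ?V t)" using WV by (rule set_integral_diff)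
    fix a a' :: "real \<Rightarrow> real"
    assume a: "\<And>t. (a has_real_derivative a' t) (at t)" "continuous_on UNIV a'"
    show "(LINT t:{0..1}|lebesgue. a t * (?W t - ?V t)) = 0"
      using tests[OF a] by (simp add: right_diff_distrib set_integral_diff)
  qed
qed

text \<open>The exceptional set of the preceding result depends on the gradient. A countable family
  leaves a single one, and uniform approximation on \<open>\<Omega>\<close> reaches every gradient
  because both fields are integrable at the given time.\<close>

lemma CE_all_gradient_tests:
  assumes w: "w \<in> CE \<Omega> \<mu>"
  shows "AE t in lebesgue. t \<in> {0..1} \<longrightarrow> (\<forall>f. gradient_field f \<longrightarrow> continuous_on UNIV f \<longrightarrow>
    (LINT x:\<Omega>|\<mu> t. f x \<bullet> w t x) = (LINT x:\<Omega>|\<mu> t. f x \<bullet> v t x))"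
proof -
  let ?F = "{f :: 'a \<Rightarrow> 'a. gradient_field f \<and> continuous_on UNIV f}"
  have "continuous_on \<Omega> f" if "f \<in> ?F" for f using that by (auto intro: continuous_on_subset)
  from countable_uniformly_dense_subfamily[OF compact this]
  obtain \<G> where *: "countable \<G> \<and> \<G> \<subseteq> ?F \<and> (\<forall>f\<in>?F. \<forall>e>0. \<exists>h\<in>\<G>. \<forall>x\<in>\<Omega>. norm (f x - h x) < e)"
    by (rule exE)
  then have \<G>: "countable \<G>" "\<G> \<subseteq> ?F" by simp_all
  have dense: "\<exists>h\<in>\<G>. \<forall>x\<in>\<Omega>. norm (f x - h x) < e" if "f \<in> ?F" "e > 0" for f e
    by (rule *[THEN conjunct2, THEN conjunct2, rule_format, OF that])
  have "AE t in lebesgue. \<forall>h\<in>\<G>. t \<in> {0..1} \<longrightarrow>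
      (LINT x:\<Omega>|\<mu> t. h x \<bullet> w t x) - (LINT x:\<Omega>|\<mu> t. h x \<bullet> v t x) = 0"
    using \<G>(1,2) by (intro AE_ball_countable' CE_gradient_tests[OF w]) auto
  then show ?thesis
  proof eventually_elim
    case (elim t)
    show ?case
    proof (intro impI allI)
      fix f :: "'a \<Rightarrow> 'a"
      assume t: "t \<in> {0..1}" and f: "gradient_field f" "continuous_on UNIV f"
      define I where "I h x = indicator \<Omega> x *\<^sub>R h x" for h :: "'a \<Rightarrow> 'a" and x
      define W where "W = I (w t)"
      define V where "V = I (v t)"
      have cI: "I h \<in> borel_measurable (\<mu> t)" "integrable (\<mu> t) (\<lambda>x. (norm (I h x))\<^sup>2)"
        if "continuous_on UNIV h" for h
        using continuous_L2[OF t continuous_on_subset[OF that subset_UNIV]]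
        by (auto simp: I_def[abs_def] measurable_\<mu>[OF t])
      have W: "W \<in> borel_measurable (\<mu> t)" "integrable (\<mu> t) (\<lambda>x. (norm (W x))\<^sup>2)"
        using CE_D[OF w t] by (auto simp: W_def I_def[abs_def] measurable_\<mu>[OF t])
      have V: "V \<in> borel_measurable (\<mu> t)" "integrable (\<mu> t) (\<lambda>x. (norm (V x))\<^sup>2)"
        using cI[OF v_cont[OF t]] by (simp_all add: V_def)
      have prod: "integrable (\<mu> t) (\<lambda>x. I h x \<bullet> W x)" "integrable (\<mu> t) (\<lambda>x. I h x \<bullet> V x)"
        if "continuous_on UNIV h" for h
        using integrable_inner_L2[OF cI(1)[OF that] W(1) cI(2)[OF that] W(2)]
          integrable_inner_L2[OF cI(1)[OF that] V(1) cI(2)[OF that] V(2)] .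
      define R where "R h = (LINT x|\<mu> t. I h x \<bullet> (W x - V x))" for h
      have R: "R h = (LINT x:\<Omega>|\<mu> t. h x \<bullet> w t x) - (LINT x:\<Omega>|\<mu> t. h x \<bullet> v t x)"
        if "continuous_on UNIV h" for h
        using prod[OF that] by (simp add: R_def set_integral_inner W_def V_def inner_diff_right I_def)
      interpret prob_space "\<mu> t" using \<mu>_facts(1)[OF t] .
      have abs_int: "integrable (\<mu> t) (\<lambda>x. norm (X x))"
        if "X \<in> borel_measurable (\<mu> t)" "integrable (\<mu> t) (\<lambda>x. (norm (X x))\<^sup>2)" for X :: "'a \<Rightarrow> 'a"
      proof (rule Bochner_Integration.integrable_bound[OF Bochner_Integration.integrable_add[OF that(2) integrable_const[of 1]]])
        \<comment> \<open>On a probability space this elementary inequality makes square integrable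
          fields integrable.\<close>
        have "norm (X x) \<le> (norm (X x))\<^sup>2 + 1" for x
          using sum_squares_bound[of "norm (X x)" 1] norm_ge_zero[of "X x"]
          unfolding power_one mult_1_right by linarith
        then show "AE x in \<mu> t. norm (norm (X x)) \<le> norm ((norm (X x))\<^sup>2 + 1)" by (intro AE_I2) simp
      qed (use that in auto)
      define k where "k = (LINT x|\<mu> t. norm (W x) + norm (V x))"
      have kint: "integrable (\<mu> t) (\<lambda>x. norm (W x) + norm (V x))"
        using abs_int[OF W] abs_int[OF V] by simp
      have k: "k \<ge> 0" unfolding k_def by (intro integral_nonneg_AE AE_I2) simp
      have "\<bar>R f\<bar> \<le> e" if e: "e > 0" for e
      proof -
        \<comment> \<open>The approximation error is multiplied by the mass \<open>k\<close> of both
          fields; \<open>k + 1\<close> keeps the denominator positive.\<close>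
        define e' where "e' = e / (k + 1)"
        have e': "e' > 0" using e k by (simp add: e'_def)
        obtain h where h: "h \<in> \<G>" "\<And>x. x \<in> \<Omega> \<Longrightarrow> norm (f x - h x) < e'"
          using dense[of f e'] f e' by blast
        have hc: "continuous_on UNIV h" using h(1) \<G>(2) by auto
        have "R h = 0" using elim h(1) t R[OF hc] by auto
        then have "R f = R f - R h" by simp
        also have "\<dots> = (LINT x|\<mu> t. (I f x - I h x) \<bullet> (W x - V x))"
          using prod[OF f(2)] prod[OF hc]
          by (simp add: R_def inner_diff_left inner_diff_right)
        also have "\<bar>\<dots>\<bar> \<le> (LINT x|\<mu> t. e' * (norm (W x) + norm (V x)))"
        proof (rule integral_abs_bound[THEN order_trans], rule integral_mono_AE')
          show "integrable (\<mu> t) (\<lambda>x. e' * (norm (W x) + norm (V x)))"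
            using kint by (rule integrable_mult_right)
          have "\<bar>(I f x - I h x) \<bullet> (W x - V x)\<bar> \<le> e' * (norm (W x) + norm (V x))" for x
          proof -
            have "\<bar>(I f x - I h x) \<bullet> (W x - V x)\<bar> \<le> norm (I f x - I h x) * norm (W x - V x)"
              by (rule Cauchy_Schwarz_ineq2)
            also have "\<dots> \<le> e' * (norm (W x) + norm (V x))"
              using h(2)[of x] e' norm_triangle_ineq4[of "W x" "V x"]
              by (intro mult_mono) (auto simp: I_def indicator_def)
            finally show ?thesis .
          qed
          then show "AE x in \<mu> t. \<bar>(I f x - I h x) \<bullet> (W x - V x)\<bar> \<le> e' * (norm (W x) + norm (V x))"
            by simp
        qed (use e' in simp)
        also have "\<dots> = e' * k" by (simp add: k_def)
        also have "\<dots> \<le> e" using k e by (simp add: e'_def field_simps)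
        finally show ?thesis .
      qed
      then have "R f = 0" by (metis abs_le_zero_iff field_le_epsilon add_0)
      then show "(LINT x:\<Omega>|\<mu> t. f x \<bullet> w t x) = (LINT x:\<Omega>|\<mu> t. f x \<bullet> v t x)"
        using R[OF f(2)] by simp
    qed
  qed
qed

text \<open>A competitor has the same integrals against gradients as the gradient field \<open>v t\<close>, so \<open>v t\<close> is its
  orthogonal projection.\<close>

lemma CE_norm_ge:
  assumes w: "w \<in> CE \<Omega> \<mu>"
  shows "AE t in lebesgue. t \<in> {0..1} \<longrightarrow> L2_normsq \<Omega> (\<mu> t) (v t) \<le> L2_normsq \<Omega> (\<mu> t) (w t)"
  using CE_all_gradient_tests[OF w]
proof eventually_elim
  case (elim t)
  show ?case
  proof
    assume t: "t \<in> {0..1}"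
    define W where "W x = indicator \<Omega> x *\<^sub>R w t x" for x
    define V where "V x = indicator \<Omega> x *\<^sub>R v t x" for x
    note vL2 = continuous_L2[OF t continuous_on_subset[OF v_cont[OF t] subset_UNIV]]
    have W: "W \<in> borel_measurable (\<mu> t)" "integrable (\<mu> t) (\<lambda>x. (norm (W x))\<^sup>2)"
      using CE_D[OF w t] by (auto simp: W_def[abs_def] measurable_\<mu>[OF t])
    have V: "V \<in> borel_measurable (\<mu> t)" "integrable (\<mu> t) (\<lambda>x. (norm (V x))\<^sup>2)"
      using vL2 by (auto simp: V_def[abs_def] measurable_\<mu>[OF t])
    \<comment> \<open>The test field is \<open>v t\<close> itself, which varies with
      \<open>t\<close>; hence the need for one exceptional set valid for all gradients.\<close>
    have eq: "(LINT x|\<mu> t. V x \<bullet> W x) = (LINT x|\<mu> t. V x \<bullet> V x)"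
      using elim t v_grad[OF t] v_cont[OF t] by (simp add: set_integral_inner V_def W_def)
    have "(LINT x|\<mu> t. (norm (W x - V x))\<^sup>2) =
        (LINT x|\<mu> t. ((norm (W x))\<^sup>2 - 2 * (V x \<bullet> W x)) + V x \<bullet> V x)"
      by (intro Bochner_Integration.integral_cong)
        (simp_all add: power2_norm_eq_inner inner_diff_left inner_diff_right inner_commute)
    also have "\<dots> = (LINT x|\<mu> t. (norm (W x))\<^sup>2) - 2 * (LINT x|\<mu> t. V x \<bullet> W x) + (LINT x|\<mu> t. V x \<bullet> V x)"
      using W V integrable_inner_L2[OF V(1) W(1) V(2) W(2)] integrable_inner_L2[OF V(1) V(1) V(2) V(2)]
      by simp
    also have "\<dots> = (LINT x|\<mu> t. (norm (W x))\<^sup>2) - (LINT x|\<mu> t. (norm (V x))\<^sup>2)"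
      by (simp add: eq power2_norm_eq_inner)
    finally have "(LINT x|\<mu> t. (norm (W x))\<^sup>2) - (LINT x|\<mu> t. (norm (V x))\<^sup>2)
        = (LINT x|\<mu> t. (norm (W x - V x))\<^sup>2)" by (rule sym)
    also have "\<dots> \<ge> 0" by (intro integral_nonneg_AE AE_I2) simp
    finally have "(LINT x|\<mu> t. (norm (V x))\<^sup>2) \<le> (LINT x|\<mu> t. (norm (W x))\<^sup>2)" by simp
    then show "L2_normsq \<Omega> (\<mu> t) (v t) \<le> L2_normsq \<Omega> (\<mu> t) (w t)"
      unfolding vL2(3) CE_D(3)[OF w t] by (intro ennreal_leI) (simp add: V_def W_def)
  qed
qed

text \<open>The field \<open>v\<close> need not be jointly measurable, as nothing is assumed about its dependence on time.
  A jointly measurable version is recovered from the flow: averages of \<open>v t\<close> with respect to \<open>\<mu> t\<close>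
  around a point are limits of averages of difference quotients of the flow, which depend
  continuously on time and space.\<close>

lemma measurable_version:
  "\<exists>w N. (\<lambda>(t, x). w t x) \<in> borel_measurable borel \<and> N \<in> null_sets lborel \<and>
    (\<forall>t\<in>N. w t = (\<lambda>_. 0)) \<and> (\<forall>t\<in>{0..1} - N. AE x in \<mu> t. w t x = v t x)"
proof -
  interpret P: prob_space P by (rule prob_P)
  obtain N0 where N0: "N0 \<in> null_sets lebesgue" "{t. \<not> (t \<in> {0..1} \<longrightarrow>
     (\<forall>x\<in>\<Omega>. ((\<lambda>s. \<phi> s x) has_vector_derivative v t (\<phi> t x)) (at t within {0..1})))} \<subseteq> N0"
    using flow_derivative by (auto simp: eventually_ae_filter)
  \<comment> \<open>The Lebesgue null set is enlarged to a Borel one, so that redefining a field on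
    it preserves Borel measurability.\<close>
  then obtain N1 where N1: "N1 \<in> null_sets lborel" "N0 \<subseteq> N1"
    by (auto simp: null_sets_completion_iff2)
  \<comment> \<open>Time 1 is excluded because forward quotients leave the interval there.\<close>
  define N where "N = N1 \<union> {1}"
  have N: "N \<in> null_sets lborel" unfolding N_def
    using N1(1) by (intro null_sets.Un) auto
  have der: "((\<lambda>s. \<phi> s x) has_vector_derivative v t (\<phi> t x)) (at t within {0..1})" "t < 1"
    if "t \<in> {0..1} - N" "x \<in> \<Omega>" for t x
    using that N0(2) N1(2) by (auto simp: N_def)
  \<comment> \<open>Clamping the time makes difference quotients meaningful for all real times, and
    the averages below continuous on all of time and space.\<close>
  define \<phi>c where "\<phi>c t x = \<phi> (max 0 (min 1 t)) x" for t x
  have \<phi>c: "\<phi>c t x = \<phi> t x" if "t \<in> {0..1}" for t x using that by (simp add: \<phi>c_def)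
  have \<phi>c_cont: "continuous_on X (\<lambda>t. \<phi>c t x)" if "x \<in> \<Omega>" for X x
    unfolding \<phi>c_def by (rule continuous_on_compose2[OF flow_continuous[OF that]])
      (auto intro!: continuous_intros)
  have \<phi>c_meas [measurable]: "\<phi>c t \<in> borel_measurable P" for t
    unfolding \<phi>c_def[abs_def] by (rule flow_measurable) auto
  have \<phi>c_lip: "norm (\<phi>c s x - \<phi>c t x) \<le> C * \<bar>s - t\<bar>" if "x \<in> \<Omega>" for s t x
  proof -
    have "norm (\<phi>c s x - \<phi>c t x) \<le> C * \<bar>max 0 (min 1 s) - max 0 (min 1 t)\<bar>"
      unfolding \<phi>c_def by (intro flow_lipschitz that) auto
    also have "\<dots> \<le> C * \<bar>s - t\<bar>" using C_nonneg by (intro mult_left_mono) auto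
    finally show ?thesis .
  qed
  \<comment> \<open>A continuous cone of height one, zero at distance at least
    \<open>1 / (n + 1)\<close> from the origin.\<close>
  define k where "k n y = max 0 (1 - real (Suc n) * norm y)" for n and y :: 'a
  have k_cont: "continuous_on X (k n)" for X n unfolding k_def[abs_def] by (intro continuous_intros)
  have k_meas [measurable]: "k n \<in> borel_measurable borel" for n
    by (rule borel_measurable_continuous_onI[OF k_cont])
  have k01: "0 \<le> k n y" "k n y \<le> 1" for n y by (auto simp: k_def)
  define q where "q m t z = real (Suc m) *\<^sub>R (\<phi>c (t + 1 / real (Suc m)) z - \<phi>c t z)" for m t z
  have q_meas [measurable]: "q m t \<in> borel_measurable P" for m t
    unfolding q_def[abs_def] by measurable
  have q_bound: "norm (q m t z) \<le> C" if "z \<in> \<Omega>" for m t z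
  proof -
    have "norm (q m t z) \<le> real (Suc m) * (C * \<bar>1 / real (Suc m)\<bar>)"
      unfolding q_def norm_scaleR using \<phi>c_lip[OF that, of "t + 1 / real (Suc m)" t]
      by (intro mult_mono) auto
    then show ?thesis by simp
  qed
  \<comment> \<open>The mass of the kernel around the point; dividing by it turns \<open>Q\<close>
    into an average of difference quotients over the trajectories that pass nearby.\<close>
  define M where "M n p = (LINT z|P. k n (snd p - \<phi>c (fst p) z))" for n and p :: "real \<times> 'a"
  define Q where "Q n m p = (LINT z|P. k n (snd p - \<phi>c (fst p) z) *\<^sub>R q m (fst p) z)"
    for n m and p :: "real \<times> 'a"
  have "continuous_on UNIV (M n)" for n
    unfolding M_def[abs_def]
  proof (rule continuous_parametric_integral[where b = 1])
    show "continuous_on UNIV (\<lambda>p. k n (snd p - \<phi>c (fst p) z))" if "z \<in> space P" for z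
      using that by (intro continuous_on_compose2[OF k_cont] continuous_intros
          continuous_on_compose2[OF \<phi>c_cont]) (auto simp: space_P)
  qed (use k01 P.finite_measure_axioms in auto)
  then have M_meas [measurable]: "M n \<in> borel_measurable borel" for n
    by (rule borel_measurable_continuous_onI)
  have "continuous_on UNIV (Q n m)" for n m
    unfolding Q_def[abs_def]
  proof (rule continuous_parametric_integral[where b = C])
    show "continuous_on UNIV (\<lambda>p. k n (snd p - \<phi>c (fst p) z) *\<^sub>R q m (fst p) z)" if "z \<in> space P" for z
      using that unfolding q_def
      by (intro continuous_intros continuous_on_compose2[OF k_cont]
          continuous_on_compose2[OF \<phi>c_cont]) (auto simp: space_P)
    show "norm (k n (snd p - \<phi>c (fst p) z) *\<^sub>R q m (fst p) z) \<le> C" if "z \<in> space P" for p z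
      using mult_mono[OF k01(2) q_bound[of z m "fst p"], of n "snd p - \<phi>c (fst p) z"] that k01(1)
      by (simp add: space_P)
  qed (use P.finite_measure_axioms in auto)
  then have Q_meas [measurable]: "Q n m \<in> borel_measurable borel" for n m
    by (rule borel_measurable_continuous_onI)
  \<comment> \<open>An iterated limit: \<open>m\<close> turns difference quotients into velocities,
    then \<open>n\<close> contracts the average to the point. Measurability of \<open>lim\<close>
    does not depend on whether the sequence converges.\<close>
  define w where "w t x = (if t \<in> N \<or> t \<notin> {0..1} then 0
    else lim (\<lambda>n. (1 / M n (t, x)) *\<^sub>R lim (\<lambda>m. Q n m (t, x))))" for t x
  have "(\<lambda>p. if fst p \<in> N \<or> fst p \<notin> {0..1} then 0
      else lim (\<lambda>n. (1 / M n p) *\<^sub>R lim (\<lambda>m. Q n m p))) \<in> borel_measurable borel"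
  proof (rule measurable_If)
    have [measurable]: "N \<in> sets borel" using N by auto
    have [measurable]: "fst \<in> borel_measurable (borel :: (real \<times> 'a) measure)"
      by (intro borel_measurable_continuous_onI continuous_intros)
    show "{p \<in> space borel. fst p \<in> N \<or> fst p \<notin> {0..1}} \<in> sets (borel :: (real \<times> 'a) measure)"
      by measurable
    show "(\<lambda>p. lim (\<lambda>n. (1 / M n p) *\<^sub>R lim (\<lambda>m. Q n m p))) \<in> borel_measurable borel"
      by (intro borel_measurable_lim_metric borel_measurable_scaleR borel_measurable_divide M_meas Q_meas) auto
  qed auto
  then have w_meas: "(\<lambda>(t, x). w t x) \<in> borel_measurable borel"
    by (simp only: w_def case_prod_beta' prod.collapse)
  have "AE x in \<mu> t. w t x = v t x" if tN: "t \<in> {0..1} - N" for t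
  proof -
    have t: "t \<in> {0..1}" using tN by simp
    interpret prob_space "\<mu> t" using \<mu>_facts(1)[OF t] .
    have [measurable]: "v t \<in> borel_measurable borel" by (rule borel_measurable_continuous_onI[OF v_cont[OF t]])
    have Mt: "M n (t, x) = (LINT y|\<mu> t. k n (x - y))" for n x
      unfolding M_def using t by (subst integral_\<mu>[OF t]) (auto simp: \<phi>c)
    have k_int: "integrable (\<mu> t) (\<lambda>y. k n (x - y))" for n x
      by (rule integrable_const_bound[where B = 1]) (use k01 in \<open>auto simp: measurable_\<mu>[OF t]\<close>)
    have kv_int: "integrable (\<mu> t) (\<lambda>y. k n (x - y) *\<^sub>R v t y)" for n x
    proof (rule integrable_const_bound[where B = C])
      show "AE y in \<mu> t. norm (k n (x - y) *\<^sub>R v t y) \<le> C"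
        using mult_mono[OF k01(2) v_bound[OF t]] k01(1) by (intro AE_I2) auto
    qed (simp add: measurable_\<mu>[OF t])
    \<comment> \<open>The limit of the quotients depends on a trajectory only through its position
      at time \<open>t\<close>. The average over trajectories therefore becomes an average of
      \<open>v t\<close> with respect to \<open>\<mu> t\<close>.\<close>
    have Qt: "(\<lambda>m. Q n m (t, x)) \<longlonglongrightarrow> (LINT y|\<mu> t. k n (x - y) *\<^sub>R v t y)" for n x
    proof -
      have "(\<lambda>m. LINT z|P. k n (x - \<phi>c t z) *\<^sub>R q m t z) \<longlonglongrightarrow> (LINT z|P. k n (x - \<phi>c t z) *\<^sub>R v t (\<phi>c t z))"
      proof (rule integral_dominated_convergence[where w = "\<lambda>_. C"])
        show "AE z in P. norm (k n (x - \<phi>c t z) *\<^sub>R q m t z) \<le> C" for m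
          using mult_mono[OF k01(2) q_bound] k01(1) by (intro AE_I2) (auto simp: space_P)
        have "(\<lambda>m. q m t z) \<longlonglongrightarrow> v t (\<phi>c t z)" if z: "z \<in> \<Omega>" for z
        proof -
          have "((\<lambda>s. \<phi>c s z) has_vector_derivative v t (\<phi>c t z)) (at t within {0..1})"
            unfolding \<phi>c[OF t]
            by (rule has_vector_derivative_transform[OF t _ der(1)[OF tN z]]) (simp add: \<phi>c)
          from has_vector_derivative_forward_quotients[OF this] der(2)[OF tN z] t
          show ?thesis by (simp add: q_def)
        qed
        then show "AE z in P. (\<lambda>m. k n (x - \<phi>c t z) *\<^sub>R q m t z) \<longlonglongrightarrow> k n (x - \<phi>c t z) *\<^sub>R v t (\<phi>c t z)"
          by (intro AE_I2 tendsto_scaleR tendsto_const) (simp add: space_P)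
      qed auto
      also have "(LINT z|P. k n (x - \<phi>c t z) *\<^sub>R v t (\<phi>c t z)) = (LINT y|\<mu> t. k n (x - y) *\<^sub>R v t y)"
        by (subst integral_\<mu>[OF t]) (auto simp: \<phi>c[OF t])
      finally show ?thesis by (simp add: Q_def)
    qed
    have "AE x in \<mu> t. \<forall>r>0. 0 < emeasure (\<mu> t) (ball x r)"
      by (rule AE_in_support[OF \<mu>_facts(2)[OF t]])
    then show ?thesis
    proof eventually_elim
      case (elim x)
      have M_pos: "0 < M n (t, x)" for n
      proof -
        \<comment> \<open>At half the radius of its support the kernel has dropped to 1/2, and a
          ball around a point of the support of \<open>\<mu> t\<close> has positive measure.\<close>
        define r where "r = 1 / (2 * real (Suc n))"
        have ball: "ball x r \<in> sets (\<mu> t)" by (simp add: \<mu>_facts(2)[OF t])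
        have "0 < measure (\<mu> t) (ball x r)"
          using elim[rule_format, of r] by (simp add: r_def emeasure_eq_measure)
        also have "\<dots> = 2 * (LINT y|\<mu> t. (1 / 2) * indicator (ball x r) y)"
          using ball by simp
        also have "(LINT y|\<mu> t. (1 / 2) * indicator (ball x r) y) \<le> (LINT y|\<mu> t. k n (x - y))"
        proof (rule integral_mono[OF _ k_int])
          show "integrable (\<mu> t) (\<lambda>y. (1 / 2) * indicator (ball x r) y :: real)"
            using ball by (intro integrable_mult_right integrable_real_indicator) (auto simp: emeasure_eq_measure)
          fix y
          show "(1 / 2) * indicator (ball x r) y \<le> k n (x - y)"
          proof (cases "y \<in> ball x r")
            case True
            then have "real (Suc n) * norm (x - y) \<le> real (Suc n) * r"
              by (intro mult_left_mono) (auto simp: dist_norm)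
            also have "\<dots> = 1 / 2" by (simp add: r_def)
            finally show ?thesis using True by (simp add: k_def)
          qed (use k01 in simp)
        qed
        finally show ?thesis by (simp add: Mt)
      qed
      have "(\<lambda>n. (1 / M n (t, x)) *\<^sub>R (LINT y|\<mu> t. k n (x - y) *\<^sub>R v t y)) \<longlonglongrightarrow> v t x"
      proof (rule LIMSEQ_I)
        fix e :: real assume e: "0 < e"
        have "isCont (v t) x" using v_cont[OF t] by (simp add: continuous_on_eq_continuous_at)
        then obtain r where r: "r > 0" "\<And>y. dist y x < r \<Longrightarrow> dist (v t y) (v t x) < e / 2"
          using e unfolding continuous_at_eps_delta by (metis half_gt_zero)
        obtain n0 where n0: "1 / real (Suc n0) < r" using r(1) nat_approx_posE by blast
        have "norm ((1 / M n (t, x)) *\<^sub>R (LINT y|\<mu> t. k n (x - y) *\<^sub>R v t y) - v t x) < e" if n: "n \<ge> n0" for n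
        proof -
          let ?M = "M n (t, x)"
          have "(LINT y|\<mu> t. k n (x - y) *\<^sub>R v t y) - ?M *\<^sub>R v t x
              = (LINT y|\<mu> t. k n (x - y) *\<^sub>R (v t y - v t x))"
            unfolding Mt using k_int[of n x] kv_int[of n x] by (simp add: scaleR_diff_right)
          also have "norm \<dots> \<le> (LINT y|\<mu> t. k n (x - y) * (e / 2))"
          proof (rule order_trans[OF integral_norm_bound], rule integral_mono_AE')
            show "integrable (\<mu> t) (\<lambda>y. k n (x - y) * (e / 2))" using k_int by (rule integrable_mult_left)
            have "norm (k n (x - y) *\<^sub>R (v t y - v t x)) \<le> k n (x - y) * (e / 2)" for y
            proof (cases "dist y x < r")
              case True
              then have "norm (v t y - v t x) \<le> e / 2" using r(2)[of y] by (simp add: dist_norm)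
              from mult_left_mono[OF this k01(1)[of n "x - y"]] show ?thesis
                using k01(1)[of n "x - y"] by simp
            next
              case False
              have "1 \<le> real (Suc n) * (1 / real (Suc n0))" using n by (simp add: field_simps)
              also have "\<dots> \<le> real (Suc n) * norm (x - y)"
                using False n0 by (intro mult_left_mono) (auto simp: dist_norm norm_minus_commute)
              finally have "k n (x - y) = 0" by (simp add: k_def)
              then show ?thesis by simp
            qed
            then show "AE y in \<mu> t. norm (k n (x - y) *\<^sub>R (v t y - v t x)) \<le> k n (x - y) * (e / 2)" by simp
          qed (use k01 e in simp)
          also have "\<dots> = ?M * (e / 2)" by (simp add: Mt)
          finally have bd: "norm ((LINT y|\<mu> t. k n (x - y) *\<^sub>R v t y) - ?M *\<^sub>R v t x) \<le> ?M * (e / 2)" .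
          have "(1 / ?M) *\<^sub>R (LINT y|\<mu> t. k n (x - y) *\<^sub>R v t y) - v t x
              = (1 / ?M) *\<^sub>R ((LINT y|\<mu> t. k n (x - y) *\<^sub>R v t y) - ?M *\<^sub>R v t x)"
            using M_pos[of n] by (simp add: scaleR_diff_right)
          then have "norm ((1 / ?M) *\<^sub>R (LINT y|\<mu> t. k n (x - y) *\<^sub>R v t y) - v t x)
              = norm ((LINT y|\<mu> t. k n (x - y) *\<^sub>R v t y) - ?M *\<^sub>R v t x) / ?M"
            using M_pos[of n] by simp
          also have "\<dots> \<le> e / 2" using bd M_pos[of n] by (simp add: field_simps)
          finally show ?thesis using e by simp
        qed
        then show "\<exists>n0. \<forall>n\<ge>n0. norm ((1 / M n (t, x)) *\<^sub>R (LINT y|\<mu> t. k n (x - y) *\<^sub>R v t y) - v t x) < e"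
          by blast
      qed
      then show ?case using tN by (simp add: w_def limI[OF Qt] limI)
    qed
  qed
  moreover have "\<forall>t\<in>N. w t = (\<lambda>_. 0)" by (auto simp: w_def)
  ultimately show ?thesis using w_meas N by blast
qed

text \<open>The infimum is attained at the jointly measurable version of \<open>v\<close>, which is
  a competitor and has the same norm at almost every time. The converse inequality is the projection
  property of \<open>v t\<close>.\<close>

lemma energy_eq_velocity_energy:
  "energy \<Omega> \<mu> = (\<integral>\<^sup>+t\<in>{0..1}. L2_normsq \<Omega> (\<mu> t) (v t) \<partial>lebesgue)"
proof (rule antisym)
  obtain w N where w_meas: "(\<lambda>(t, x). w t x) \<in> borel_measurable borel" and N: "N \<in> null_sets lborel"
    and w0: "\<And>t. t \<in> N \<Longrightarrow> w t = (\<lambda>_. 0)"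
    and wv: "\<And>t. t \<in> {0..1} - N \<Longrightarrow> AE x in \<mu> t. w t x = v t x"
    using measurable_version by blast
  have wt_meas: "w t \<in> borel_measurable borel" for t
  proof -
    have "(\<lambda>x. (t, x)) \<in> borel_measurable borel"
      by (intro borel_measurable_continuous_onI continuous_intros)
    from measurable_compose[OF this w_meas] show ?thesis by simp
  qed
  have neg: "negligible N" using N by (simp add: negligible_iff_null_sets null_sets_completionI)
  have normsq: "L2_normsq \<Omega> (\<mu> t) (w t) = L2_normsq \<Omega> (\<mu> t) (v t)" if "t \<in> {0..1} - N" for t
    unfolding L2_normsq_def using wv[OF that] by (intro nn_integral_cong_AE) (auto elim!: eventually_mono)
  have "w \<in> CE \<Omega> \<mu>"
    unfolding CE_def mem_Collect_eq
  proof (intro conjI ballI allI impI)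
    show "(\<lambda>(t, x). w t x) \<in> borel_measurable (restrict_space borel ({0..1} \<times> \<Omega>))"
      using w_meas by (rule measurable_restrict_space1)
    fix t :: real assume t: "t \<in> {0..1}"
    \<comment> \<open>Membership in \<open>CE\<close> demands a finite norm at every time; on the
      exceptional set it holds since the version vanishes there.\<close>
    show "L2_normsq \<Omega> (\<mu> t) (w t) < \<infinity>"
    proof (cases "t \<in> N")
      case True
      then show ?thesis by (simp add: w0 L2_normsq_def)
    next
      case False
      then show ?thesis
        using normsq[of t] continuous_L2(3)[OF t continuous_on_subset[OF v_cont[OF t] subset_UNIV]] t by simp
    qed
  next
    fix \<psi> \<psi>t \<psi>x assume test: "C1_test \<Omega> \<psi> \<psi>t \<psi>x"
    let ?W = "\<lambda>t. LINT x:\<Omega>|\<mu> t. \<psi>x t x \<bullet> w t x" and ?V = "\<lambda>t. LINT x:\<Omega>|\<mu> t. \<psi>x t x \<bullet> v t x"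
    have cx: "continuous_on ({0..1} \<times> \<Omega>) (\<lambda>(t, x). \<psi>x t x)" using test by (simp add: C1_test_def)
    have WV: "?W t = ?V t" if tN: "t \<in> {0..1} - N" for t
    proof -
      have t: "t \<in> {0..1}" using tN by simp
      have "(\<lambda>x. indicator \<Omega> x *\<^sub>R \<psi>x t x) \<in> borel_measurable (\<mu> t)"
        using indicator_measurable[OF continuous_section[OF cx t]] by (simp add: measurable_\<mu>[OF t])
      moreover have "(\<lambda>x. indicator \<Omega> x *\<^sub>R v t x) \<in> borel_measurable (\<mu> t)"
        using indicator_measurable[OF continuous_on_subset[OF v_cont[OF t] subset_UNIV]] by (simp add: measurable_\<mu>[OF t])
      moreover have "(\<lambda>x. indicator \<Omega> x *\<^sub>R w t x) \<in> borel_measurable (\<mu> t)"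
        using wt_meas[of t] by (simp add: measurable_\<mu>[OF t])
      ultimately show ?thesis unfolding set_integral_inner
        using wv[OF tN] by (intro integral_cong_AE borel_measurable_inner) (auto elim!: eventually_mono)
    qed
    note V = continuity_equation[OF test]
    show W: "set_integrable lebesgue {0..1} ?W"
      by (rule absolutely_integrable_spike[OF V(1) neg WV])
    have "(?W has_integral (LINT t:{0..1}|lebesgue. ?V t)) {0..1}"
      by (rule has_integral_spike[OF neg WV has_integral_set_lebesgue_integral[OF V(1)]])
    with has_integral_set_lebesgue_integral[OF W]
    have "(LINT t:{0..1}|lebesgue. ?W t) = (LINT t:{0..1}|lebesgue. ?V t)" by (rule has_integral_unique)
    then show "(LINT t:{0..1}|lebesgue. LINT x:\<Omega>|\<mu> t. \<psi>t t x) + (LINT t:{0..1}|lebesgue. ?W t)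
        = (LINT x:\<Omega>|\<mu> 1. \<psi> 1 x) - (LINT x:\<Omega>|\<mu> 0. \<psi> 0 x)"
      using V(2) by simp
  qed
  then have "energy \<Omega> \<mu> \<le> (\<integral>\<^sup>+t\<in>{0..1}. L2_normsq \<Omega> (\<mu> t) (w t) \<partial>lebesgue)"
    unfolding energy_def by (rule INF_lower)
  also have "\<dots> = (\<integral>\<^sup>+t\<in>{0..1}. L2_normsq \<Omega> (\<mu> t) (v t) \<partial>lebesgue)"
  proof (rule nn_integral_cong_AE)
    have "AE t in lebesgue. t \<notin> N" using N by (intro AE_not_in null_sets_completionI)
    then show "AE t in lebesgue. L2_normsq \<Omega> (\<mu> t) (w t) * indicator {0..1} t
        = L2_normsq \<Omega> (\<mu> t) (v t) * indicator {0..1} t"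
      by eventually_elim (auto simp: normsq indicator_def)
  qed
  finally show "energy \<Omega> \<mu> \<le> (\<integral>\<^sup>+t\<in>{0..1}. L2_normsq \<Omega> (\<mu> t) (v t) \<partial>lebesgue)" .
  show "(\<integral>\<^sup>+t\<in>{0..1}. L2_normsq \<Omega> (\<mu> t) (v t) \<partial>lebesgue) \<le> energy \<Omega> \<mu>"
    unfolding energy_def
  proof (rule INF_greatest, rule nn_integral_mono_AE)
    fix w assume w: "w \<in> CE \<Omega> \<mu>"
    show "AE t in lebesgue. L2_normsq \<Omega> (\<mu> t) (v t) * indicator {0..1} t
        \<le> L2_normsq \<Omega> (\<mu> t) (w t) * indicator {0..1} t"
      using CE_norm_ge[OF w] by eventually_elim (auto simp: indicator_def)
  qed
qed

end

section \<open>Energies on the submanifold\<close>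

text \<open>Outside \<open>{0..1}\<close> a curve may take values that are not in the image of
  \<open>E\<close>, so going through the inverse of \<open>E\<close> returns the curve only on the
  interval.\<close>

lemma energy_cong:
  assumes "\<And>t. t \<in> {0..1} \<Longrightarrow> \<rho> t = \<rho>' t"
  shows "energy (\<Omega> :: 'a::euclidean_space set) \<rho> = energy \<Omega> \<rho>'"
proof -
  have "(LINT t:{0..1}|lebesgue. LINT x:\<Omega>|\<rho> t. f t x) = (LINT t:{0..1}|lebesgue. LINT x:\<Omega>|\<rho>' t. f t x)"
    for f :: "real \<Rightarrow> 'a \<Rightarrow> real"
    by (intro set_lebesgue_integral_cong) (auto simp: assms)
  moreover have "set_integrable lebesgue {0..1} (\<lambda>t. LINT x:\<Omega>|\<rho> t. f t x)
      = set_integrable lebesgue {0..1} (\<lambda>t. LINT x:\<Omega>|\<rho>' t. f t x)"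
    for f :: "real \<Rightarrow> 'a \<Rightarrow> real"
    by (intro set_integrable_cong) (auto simp: assms)
  moreover have "(\<forall>t\<in>{0..1}. L2_normsq \<Omega> (\<rho> t) (v t) < \<infinity>) = (\<forall>t\<in>{0..1}. L2_normsq \<Omega> (\<rho>' t) (v t) < \<infinity>)" for v
    by (simp add: assms)
  moreover have "\<rho> 0 = \<rho>' 0" "\<rho> 1 = \<rho>' 1" by (simp_all add: assms)
  ultimately have "CE \<Omega> \<rho> = CE \<Omega> \<rho>'" unfolding CE_def by (simp only:)
  moreover have "(\<integral>\<^sup>+t\<in>{0..1}. L2_normsq \<Omega> (\<rho> t) (v t) \<partial>lebesgue)
      = (\<integral>\<^sup>+t\<in>{0..1}. L2_normsq \<Omega> (\<rho>' t) (v t) \<partial>lebesgue)" for v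
    using assms by (intro nn_integral_cong) (auto simp: indicator_def)
  ultimately show ?thesis by (simp add: energy_def)
qed

context wasserstein_submanifold
begin

text \<open>The zero default makes this true at every time, so the regularity of \<open>B\<close> on
  tangent vectors is available even where the curve is not differentiable.\<close>

lemma velocity_in_tangent_space:
  assumes t: "t \<in> {0..1}"
  shows "velocity A \<gamma> t \<in> tangent_space A (\<gamma> t)"
proof (cases "\<exists>\<xi>. has_velocity A \<gamma> \<xi> t")
  case True
  then obtain \<xi> where \<xi>: "has_velocity A \<gamma> \<xi> t" by blast
  then show ?thesis unfolding velocity_eq[OF \<xi> t] by (simp only: has_velocity_def)
next
  case False
  then have "velocity A \<gamma> t = (\<lambda>_. 0)" by (simp only: velocity_def if_False)
  then show ?thesis using zero_in_tangent_space by simp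
qed

lemma lipschitz_curve_transported:
  assumes \<gamma>: "lipschitz_curve S (riem_dist A g S) \<gamma>"
  shows "\<exists>\<phi> C. transported_measures \<Omega> (E \<circ> \<gamma>) (\<lambda>t. B (\<gamma> t) (velocity A \<gamma> t)) \<phi> C"
proof -
  have \<gamma>S: "\<gamma> t \<in> S" if "t \<in> {0..1}" for t using \<gamma> that by (auto simp: lipschitz_curve_def)
  obtain C where C: "\<And>t x. t \<in> {0..1} \<Longrightarrow> norm (B (\<gamma> t) (velocity A \<gamma> t) x) \<le> C"
    using velocity_field_bounded[OF \<gamma>] by blast
  obtain \<phi> where \<phi>: "flow_of \<Omega> (\<lambda>t. B (\<gamma> t) (velocity A \<gamma> t)) \<phi>"
    using flow_exists[OF \<gamma>] by blast
  have "transported_measures \<Omega> (E \<circ> \<gamma>) (\<lambda>t. B (\<gamma> t) (velocity A \<gamma> t)) \<phi> C"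
  proof
    fix t :: real assume t: "t \<in> {0..1}"
    have "Ck_on (Suc 0) UNIV (B (\<gamma> t) (velocity A \<gamma> t))"
      using B_C1[OF \<gamma>S[OF t] velocity_in_tangent_space[OF t, of \<gamma>]] by simp
    then show "continuous_on UNIV (B (\<gamma> t) (velocity A \<gamma> t))"
      by (auto intro!: continuous_at_imp_continuous_on differentiable_imp_continuous_within)
    show "gradient_field (B (\<gamma> t) (velocity A \<gamma> t))"
      by (rule B_gradient[OF \<gamma>S[OF t] velocity_in_tangent_space[OF t, of \<gamma>]])
    show "(E \<circ> \<gamma>) t \<in> prob_measures \<Omega>" using E_prob[OF \<gamma>S[OF t]] by simp
    show "(E \<circ> \<gamma>) t = distr (restrict_space ((E \<circ> \<gamma>) 0) \<Omega>) borel (\<phi> t)"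
      using flow_transport[OF \<gamma> \<phi> t] by (simp only: o_apply)
  qed (use compact_Omega convex_Omega C \<phi> in auto)
  then show ?thesis by blast
qed

lemma energy_lipschitz_curve:
  assumes \<gamma>: "lipschitz_curve S (riem_dist A g S) \<gamma>"
  shows "energy \<Omega> (E \<circ> \<gamma>) = energy_S \<Omega> A E B \<gamma>"
proof -
  obtain \<phi> C where "transported_measures \<Omega> (E \<circ> \<gamma>) (\<lambda>t. B (\<gamma> t) (velocity A \<gamma> t)) \<phi> C"
    using lipschitz_curve_transported[OF \<gamma>] by blast
  from transported_measures.energy_eq_velocity_energy[OF this]
  show ?thesis by (simp add: energy_S_def)
qed

text \<open>Only the lower bi-Lipschitz inequality of \<open>E\<close> enters; its constant
  multiplies that of the curve.\<close>

lemma lipschitz_curve_inverse: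
  assumes \<rho>: "lipschitz_curve (E ` S) wasserstein \<rho>"
  shows "lipschitz_curve S (riem_dist A g S) (inv_into S E \<circ> \<rho>)"
proof -
  obtain K where K: "K > 0" "\<And>\<theta> \<theta>'. \<theta> \<in> S \<Longrightarrow> \<theta>' \<in> S \<Longrightarrow>
      riem_dist A g S \<theta> \<theta>' / K \<le> wasserstein (E \<theta>) (E \<theta>')"
    using E_bilipschitz by blast
  obtain L where L: "\<And>s t. s \<in> {0..1} \<Longrightarrow> t \<in> {0..1} \<Longrightarrow> wasserstein (\<rho> s) (\<rho> t) \<le> L * \<bar>s - t\<bar>"
    using \<rho> unfolding lipschitz_curve_def by blast
  have \<rho>S: "\<rho> t \<in> E ` S" if "t \<in> {0..1}" for t using \<rho> that by (auto simp: lipschitz_curve_def)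
  have inS: "inv_into S E (\<rho> t) \<in> S" "E (inv_into S E (\<rho> t)) = \<rho> t" if "t \<in> {0..1}" for t
    using inv_into_into[OF \<rho>S[OF that]] f_inv_into_f[OF \<rho>S[OF that]] .
  have "riem_dist A g S (inv_into S E (\<rho> s)) (inv_into S E (\<rho> t)) \<le> (K * L) * \<bar>s - t\<bar>"
    if st: "s \<in> {0..1}" "t \<in> {0..1}" for s t
  proof -
    have "riem_dist A g S (inv_into S E (\<rho> s)) (inv_into S E (\<rho> t)) / K \<le> L * \<bar>s - t\<bar>"
      using K(2)[OF inS(1)[OF st(1)] inS(1)[OF st(2)]] L[OF st] inS(2) st by simp
    then show ?thesis using K(1) by (simp add: field_simps)
  qed
  then show ?thesis unfolding lipschitz_curve_def o_apply using inS(1) by blast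
qed

lemma energy_lipschitz_measure_curve:
  assumes \<rho>: "lipschitz_curve (E ` S) wasserstein \<rho>"
  shows "energy \<Omega> \<rho> = energy_S \<Omega> A E B (inv_into S E \<circ> \<rho>)"
proof -
  have "\<rho> t = (E \<circ> (inv_into S E \<circ> \<rho>)) t" if "t \<in> {0..1}" for t
  proof -
    have "\<rho> t \<in> E ` S" using \<rho> that by (auto simp: lipschitz_curve_def)
    from f_inv_into_f[OF this] show ?thesis by simp
  qed
  then have "energy \<Omega> \<rho> = energy \<Omega> (E \<circ> (inv_into S E \<circ> \<rho>))" by (rule energy_cong)
  also have "\<dots> = energy_S \<Omega> A E B (inv_into S E \<circ> \<rho>)"
    by (rule energy_lipschitz_curve[OF lipschitz_curve_inverse[OF \<rho>]])
  finally show ?thesis .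
qed

end

theorem proposition2p9:
  fixes A :: "('m::{t2_space, second_countable_topology}, 'e::euclidean_space) chart set"
    and g :: "('m, 'e) metric_tensor"
    and \<Omega> :: "'a::euclidean_space set"
    and S :: "'m set"
    and D :: "('m \<times> ('m, 'e) tvec) set"
    and E :: "'m \<Rightarrow> 'a measure"
    and B :: "'m \<Rightarrow> ('m, 'e) tvec \<Rightarrow> 'a \<Rightarrow> 'a"
  assumes "wasserstein_submanifold A g \<Omega> S D E B"
  shows "(\<forall>\<gamma>. lipschitz_curve S (riem_dist A g S) \<gamma> \<longrightarrow>
            energy \<Omega> (E \<circ> \<gamma>) = energy_S \<Omega> A E B \<gamma>) \<and>
         (\<forall>\<rho>. lipschitz_curve (E ` S) wasserstein \<rho> \<longrightarrow>
            energy \<Omega> \<rho> = energy_S \<Omega> A E B (inv_into S E \<circ> \<rho>)) \<and>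
         (\<forall>\<gamma> v. lipschitz_curve S (riem_dist A g S) \<gamma> \<and>
            v = (\<lambda>t. B (\<gamma> t) (velocity A \<gamma> t)) \<longrightarrow>
            energy \<Omega> (E \<circ> \<gamma>) =
              (\<integral>\<^sup>+t\<in>{0..1}. L2_normsq \<Omega> (E (\<gamma> t)) (v t) \<partial>lebesgue))"
proof -
  interpret wasserstein_submanifold A g \<Omega> S D E B by (rule assms)
  show ?thesis
    using energy_lipschitz_curve energy_lipschitz_measure_curve by (simp add: energy_S_def)
qed

end
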